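(* Let $\mathcal{EL} = \{\mathcal{E}_{1}, \ldots, \mathcal{E}_{k},\ell_{1}, \ldots, \ell_{d}\}\subset \mathbb{P}^{2}_{\mathbb{C}}$ be an arrangement consisting of $k\geq 1$ smooth cubic curves and $d\geq 1$ lines whose union has as singularities only nodes ($A_1$), singularities of type $A_{5}$ (local normal form $x^2+y^6=0$), and ordinary triple points ($D_4$). If $\mathcal{EL}$ is free, then $3k+d \leq 9$.
   Context: The curves are pairwise distinct, so the union $C$ is a reduced plane curve of degree $m=3k+d$, defined by a reduced homogeneous polynomial $f\in S=\mathbb{C}[x,y,z]$ of degree $m$. Let $J_f$ be the Jacobian ideal generated by $\partial f/\partial x,\partial f/\partial y,\partial f/\partial z$, and let $\mathrm{Syz}(J_f)$ be the $S$-module of triples $(a,b,c)\in S^3$ with $a f_x+bf_y+cf_z=0$. The curve $C$ is called free if $\mathrm{Syz}(J_f)$ is minimally generated by two homogeneous syzygies of degrees $d_1\le d_2$ with $1\le d_1$ and $d_1+d_2=m-1$. The arrangement $\mathcal{EL}$ is called free if $C$ is free. *)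

theory Defs
  imports "HOL-Analysis.Analysis"
begin

text \<open>Points of C^3 (homogeneous coordinates of the projective plane).\<close>
type_synonym pt = "complex \<times> complex \<times> complex"

definition px :: "pt \<Rightarrow> complex" where "px v = fst v"
definition py :: "pt \<Rightarrow> complex" where "py v = fst (snd v)"
definition pz :: "pt \<Rightarrow> complex" where "pz v = snd (snd v)"

definition mono :: "nat \<times> nat \<times> nat \<Rightarrow> pt \<Rightarrow> complex" where
  "mono e v = px v ^ fst e * py v ^ fst (snd e) * pz v ^ snd (snd e)"

definition mdeg :: "nat \<times> nat \<times> nat \<Rightarrow> nat" where
  "mdeg e = fst e + fst (snd e) + snd (snd e)"

text \<open>Elements of S = C[x,y,z], represented by their (polynomial) functions on C^3
  (faithful since C is infinite).\<close>
definition poly3 :: "(pt \<Rightarrow> complex) \<Rightarrow> bool" where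
  "poly3 f \<longleftrightarrow> (\<exists>c. finite {e. c e \<noteq> 0} \<and>
      (\<forall>v. f v = (\<Sum>e\<in>{e. c e \<noteq> 0}. c e * mono e v)))"

text \<open>Homogeneous polynomial of degree m (the zero polynomial is homogeneous of every degree).\<close>
definition homog :: "nat \<Rightarrow> (pt \<Rightarrow> complex) \<Rightarrow> bool" where
  "homog m f \<longleftrightarrow> (\<exists>c. finite {e. c e \<noteq> 0} \<and> (\<forall>e. c e \<noteq> 0 \<longrightarrow> mdeg e = m) \<and>
      (\<forall>v. f v = (\<Sum>e\<in>{e. c e \<noteq> 0}. c e * mono e v)))"

definition dX :: "(pt \<Rightarrow> complex) \<Rightarrow> pt \<Rightarrow> complex" where
  "dX f v = deriv (\<lambda>t. f (t, py v, pz v)) (px v)"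
definition dY :: "(pt \<Rightarrow> complex) \<Rightarrow> pt \<Rightarrow> complex" where
  "dY f v = deriv (\<lambda>t. f (px v, t, pz v)) (py v)"
definition dZ :: "(pt \<Rightarrow> complex) \<Rightarrow> pt \<Rightarrow> complex" where
  "dZ f v = deriv (\<lambda>t. f (px v, py v, t)) (pz v)"

definition smooth_cubic :: "(pt \<Rightarrow> complex) \<Rightarrow> bool" where
  "smooth_cubic g \<longleftrightarrow> homog 3 g \<and> g \<noteq> (\<lambda>_. 0) \<and>
     (\<forall>v. v \<noteq> 0 \<longrightarrow> \<not> (g v = 0 \<and> dX g v = 0 \<and> dY g v = 0 \<and> dZ g v = 0))"

definition is_line :: "(pt \<Rightarrow> complex) \<Rightarrow> bool" where
  "is_line g \<longleftrightarrow> homog 1 g \<and> g \<noteq> (\<lambda>_. 0)"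

text \<open>Zero set (cone over the projective curve).\<close>
definition zeros :: "(pt \<Rightarrow> complex) \<Rightarrow> pt set" where
  "zeros g = {v. g v = 0}"

type_synonym syz = "(pt \<Rightarrow> complex) \<times> (pt \<Rightarrow> complex) \<times> (pt \<Rightarrow> complex)"

definition Syz :: "(pt \<Rightarrow> complex) \<Rightarrow> syz set" where
  "Syz f = {(a,b,c). poly3 a \<and> poly3 b \<and> poly3 c \<and>
      (\<forall>v. a v * dX f v + b v * dY f v + c v * dZ f v = 0)}"

definition homog_syz :: "nat \<Rightarrow> syz \<Rightarrow> bool" where
  "homog_syz d r \<longleftrightarrow> homog d (fst r) \<and> homog d (fst (snd r)) \<and> homog d (snd (snd r))"

definition lincomb :: "(pt \<Rightarrow> complex) \<Rightarrow> syz \<Rightarrow> (pt \<Rightarrow> complex) \<Rightarrow> syz \<Rightarrow> syz" where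
  "lincomb p r1 q r2 = ((\<lambda>v. p v * fst r1 v + q v * fst r2 v),
                        (\<lambda>v. p v * fst (snd r1) v + q v * fst (snd r2) v),
                        (\<lambda>v. p v * snd (snd r1) v + q v * snd (snd r2) v))"

definition smult_syz :: "(pt \<Rightarrow> complex) \<Rightarrow> syz \<Rightarrow> syz" where
  "smult_syz p r = ((\<lambda>v. p v * fst r v), (\<lambda>v. p v * fst (snd r) v), (\<lambda>v. p v * snd (snd r) v))"

definition free_curve :: "nat \<Rightarrow> (pt \<Rightarrow> complex) \<Rightarrow> bool" where
  "free_curve m f \<longleftrightarrow> (\<exists>d1 d2 r1 r2.
      1 \<le> d1 \<and> d1 \<le> d2 \<and> d1 + d2 = m - 1 \<and>
      r1 \<in> Syz f \<and> r2 \<in> Syz f \<and> homog_syz d1 r1 \<and> homog_syz d2 r2 \<and>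
      (\<forall>s\<in>Syz f. \<exists>p q. poly3 p \<and> poly3 q \<and> s = lincomb p r1 q r2) \<and>
      \<not> (\<exists>p. poly3 p \<and> r1 = smult_syz p r2) \<and>
      \<not> (\<exists>p. poly3 p \<and> r2 = smult_syz p r1))"

definition holo2 :: "(complex \<times> complex \<Rightarrow> complex) \<Rightarrow> (complex \<times> complex) set \<Rightarrow> bool" where
  "holo2 F U \<longleftrightarrow> open U \<and> (\<forall>z\<in>U. \<exists>D. (F has_derivative D) (at z) \<and>
      (\<forall>c a b. D (c * a, c * b) = c * D (a, b)))"

definition contact_equiv :: "(complex \<times> complex \<Rightarrow> complex) \<Rightarrow> (complex \<times> complex \<Rightarrow> complex) \<Rightarrow> bool" where
  "contact_equiv h g \<longleftrightarrow> (\<exists>U V \<phi> \<psi> u.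
      open U \<and> open V \<and> (0,0) \<in> V \<and> \<phi> (0,0) = (0,0) \<and>
      \<phi> ` V = U \<and> \<psi> ` U = V \<and> (\<forall>z\<in>V. \<psi> (\<phi> z) = z) \<and> (\<forall>w\<in>U. \<phi> (\<psi> w) = w) \<and>
      holo2 (fst \<circ> \<phi>) V \<and> holo2 (snd \<circ> \<phi>) V \<and> holo2 (fst \<circ> \<psi>) U \<and> holo2 (snd \<circ> \<psi>) U \<and>
      holo2 u V \<and> (\<forall>z\<in>V. u z \<noteq> 0) \<and> (\<forall>z\<in>V. h (\<phi> z) = u z * g z))"

definition det3 :: "pt \<Rightarrow> pt \<Rightarrow> pt \<Rightarrow> complex" where
  "det3 p v w = px p * (py v * pz w - pz v * py w) - py p * (px v * pz w - pz v * px w)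
              + pz p * (px v * py w - py v * px w)"

definition chart :: "pt \<Rightarrow> pt \<Rightarrow> pt \<Rightarrow> complex \<times> complex \<Rightarrow> pt" where
  "chart p v w st = (px p + fst st * px v + snd st * px w,
                     py p + fst st * py v + snd st * py w,
                     pz p + fst st * pz v + snd st * pz w)"

definition sing_type :: "(pt \<Rightarrow> complex) \<Rightarrow> pt \<Rightarrow> (complex \<times> complex \<Rightarrow> complex) \<Rightarrow> bool" where
  "sing_type f p g \<longleftrightarrow> (\<exists>v w. det3 p v w \<noteq> 0 \<and> contact_equiv (\<lambda>st. f (chart p v w st)) g)"

definition nf_A1 :: "complex \<times> complex \<Rightarrow> complex" where "nf_A1 z = fst z ^ 2 + snd z ^ 2"
definition nf_A5 :: "complex \<times> complex \<Rightarrow> complex" where "nf_A5 z = fst z ^ 2 + snd z ^ 6"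
definition nf_D4 :: "complex \<times> complex \<Rightarrow> complex" where "nf_D4 z = fst z ^ 2 * snd z + snd z ^ 3"

definition sing_point :: "(pt \<Rightarrow> complex) \<Rightarrow> pt \<Rightarrow> bool" where
  "sing_point f p \<longleftrightarrow> p \<noteq> 0 \<and> f p = 0 \<and> dX f p = 0 \<and> dY f p = 0 \<and> dZ f p = 0"

end

theory Submission
  imports Defs "HOL-Complex_Analysis.Cauchy_Integral_Formula"
begin

text \<open>
  Freeness enters only through a nonzero syzygy \<open>\<delta> = (a, b, c)\<close> of degree \<open>r \<le> (m - 1) / 2\<close>, where
  \<open>m = 3k + d\<close>. If \<open>m \<ge> 10\<close>, then \<open>s = (r + 2) / m < 2 / 3\<close>, and \<open>2 / 3\<close> is the smallest log canonical
  threshold among \<open>A\<^sub>1\<close>, \<open>A\<^sub>5\<close> and \<open>D\<^sub>4\<close>; hence the weight \<open>|f|\<^bsup>-2s\<^esup>\<close> is locally integrable on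
  \<open>\<complex>\<^sup>3 - {0}\<close>. Regarded as a vector field, \<open>\<delta>\<close> kills \<open>f\<close>, so integration by parts against this weight
  produces no derivative of the weight. The exponent \<open>s\<close> is chosen such that, with radial cutoffs, the
  boundary contributions cancel by scale invariance. The first integration by parts gives
  \<open>\<integral> |div \<delta>|\<^sup>2 |f|\<^bsup>-2s\<^esup> = 0\<close>. With \<open>div \<delta> = 0\<close>, a second one, applied to \<open>x \<delta>\<close>, \<open>y \<delta>\<close> and \<open>z \<delta>\<close>, gives
  equality in the Cauchy-Schwarz inequality between \<open>\<delta>(v)\<close> and \<open>v\<close>. Thus \<open>\<delta>(v)\<close> is parallel to \<open>v\<close>, and
  Euler's formula together with \<open>\<delta> f = 0\<close> forces \<open>\<delta> = 0\<close>.
\<close>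

text \<open>The bound 9 is where two numbers meet: \<open>r \<le> (m - 1) / 2\<close> gives
  \<open>s \<le> (m + 3) / (2 * m)\<close>, which lies below 2 / 3 exactly for m > 9; for m = 9 and
  r = 4 the value is 2 / 3 itself. The weight has degree -2 (r + 2) \<le> -6 in real dimension 6, so
  it is never integrable at the origin. The cutoffs must therefore remove the origin as well as
  infinity, and their derivatives produce terms without a sign. In polar coordinates the first of
  these terms is a multiple of \<integral> \<xi>'(t) dt for a compactly supported \<xi>, which is 0;
  this is what fixes \<open>s\<close>. Squares appear because the conjugate of a holomorphic
  function is a constant for \<partial>_x, \<partial>_y, \<partial>_z: pairing with the conjugate of
  div \<delta> creates no further derivative. Integrability has to be carried along holomorphic
  coordinate changes. Only finiteness matters, so a covering estimate for Lipschitz maps with a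
  crude constant takes the place of the Jacobian.\<close>

subsection \<open>Lipschitz images and Lebesgue measure\<close>

text \<open>Cubes with disjoint interiors cover \<open>S\<close> inside an open set \<open>T\<close>
  of nearly the same measure. A cube of side \<sigma> contains a point x of \<open>S\<close>, and
  all its points are within n \<sigma> of x, so the image of its part in \<open>S\<close> lies in a
  cube of side 2 L n \<sigma>. Hence the factor (2 L n)^n, which is far from sharp.\<close>

lemma emeasure_lipschitz_image_le:
  fixes \<Phi> :: "'a::euclidean_space \<Rightarrow> 'a"
  assumes lip: "L-lipschitz_on S \<Phi>" and S: "S \<in> sets borel" "bounded S"
    and im: "\<Phi> ` S \<in> sets borel"
  shows "emeasure lborel (\<Phi> ` S)
    \<le> ennreal ((2 * L * real DIM('a)) ^ DIM('a)) * emeasure lborel S"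
proof (rule ennreal_le_epsilon)
  define n where "n = DIM('a)"
  define C where "C = (2 * L * real n) ^ n"
  have L: "L \<ge> 0" using lip by (rule lipschitz_on_nonneg)
  then have C: "C \<ge> 0" by (simp add: C_def)
  fix \<epsilon> :: real assume \<epsilon>: "\<epsilon> > 0"
  define \<eta> where "\<eta> = \<epsilon> / (C + 1)"
  have \<eta>: "\<eta> > 0" "C * \<eta> \<le> \<epsilon>"
    using \<epsilon> C by (auto simp: \<eta>_def field_simps)
  from outer_regular_lborel[OF S(1), of \<eta>] \<eta> obtain T where
    T: "open T" "S \<subseteq> T" "emeasure lborel (T - S) < ennreal \<eta>" by auto
  obtain B where B: "B > 0" "\<And>x. x \<in> S \<Longrightarrow> norm x \<le> B"
    using S(2) by (auto simp: bounded_pos)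
  \<comment> \<open>The covering lemma subdivides \<open>cbox a b\<close> by powers of 2 in every
    direction; starting from a cube makes every piece a cube.\<close>
  define a b :: 'a where "a = - (B *\<^sub>R One)" and "b = B *\<^sub>R One"
  have ab: "a \<bullet> i = - B" "b \<bullet> i = B" if "i \<in> Basis" for i
    using that by (auto simp: a_def b_def)
  have sub: "S \<subseteq> cbox a b"
  proof
    fix x assume x: "x \<in> S"
    show "x \<in> cbox a b"
      unfolding mem_box
    proof safe
      fix i :: 'a assume i: "i \<in> Basis"
      have "\<bar>x \<bullet> i\<bar> \<le> B" using Basis_le_norm[OF i, of x] B(2)[OF x] by simp
      then show "a \<bullet> i \<le> x \<bullet> i" "x \<bullet> i \<le> b \<bullet> i" using ab[OF i] by auto
    qed
  qed
  have ne: "box a b \<noteq> {}" using B(1) ab by (auto simp: box_ne_empty)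
  \<comment> \<open>These radii force every piece of the covering into \<open>T\<close>; the value 1
    outside \<open>T\<close> only completes the gauge.\<close>
  define r where "r x = (if x \<in> T then (SOME e. e > 0 \<and> ball x e \<subseteq> T) else 1)" for x
  have r: "r x > 0 \<and> ball x (r x) \<subseteq> T" if "x \<in> T" for x
  proof -
    have "\<exists>e. e > 0 \<and> ball x e \<subseteq> T" using T(1) that by (auto simp: open_contains_ball)
    from someI_ex[OF this] show ?thesis using that by (simp add: r_def)
  qed
  have ga: "gauge (\<lambda>x. ball x (r x))"
  proof (rule gauge_ball_dependent, rule allI)
    fix x show "0 < r x" using r[of x] by (cases "x \<in> T") (auto simp: r_def)
  qed
  obtain \<D> where D: "countable \<D>" "\<And>K. K \<in> \<D> \<Longrightarrow> interior K \<noteq> {} \<and> (\<exists>c d. K = cbox c d)"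
    "pairwise (\<lambda>A B. interior A \<inter> interior B = {}) \<D>"
    "\<And>K. K \<in> \<D> \<Longrightarrow> \<exists>x \<in> S \<inter> K. K \<subseteq> ball x (r x)"
    "\<And>u v. cbox u v \<in> \<D> \<Longrightarrow> \<exists>n. \<forall>i \<in> Basis. v \<bullet> i - u \<bullet> i = (b \<bullet> i - a \<bullet> i) / 2^n"
    "S \<subseteq> \<Union>\<D>"
    using covering_lemma[OF sub ne ga] by metis
  \<comment> \<open>Padding with the empty set keeps the enumeration free of repetitions even for
    finite \<open>\<D>\<close>; \<open>from_nat_into\<close> alone would repeat a cube and destroy
    disjointness.\<close>
  define K where "K j = (if j \<in> to_nat_on \<D> ` \<D> then from_nat_into \<D> j else {})" for j :: nat
  have KD: "K j = {} \<or> K j \<in> \<D>" for j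
    using D(1) by (auto simp: K_def)
  have KU: "\<Union>\<D> = (\<Union>j. K j)"
  proof
    show "\<Union>\<D> \<subseteq> (\<Union>j. K j)"
    proof
      fix x assume "x \<in> \<Union>\<D>"
      then obtain A where A: "A \<in> \<D>" "x \<in> A" by auto
      then have "K (to_nat_on \<D> A) = A" using D(1) by (auto simp: K_def)
      then show "x \<in> (\<Union>j. K j)" using A by blast
    qed
    show "(\<Union>j. K j) \<subseteq> \<Union>\<D>" using KD by blast
  qed
  have disj: "disjoint_family (\<lambda>j. interior (K j))"
    unfolding disjoint_family_on_def
  proof safe
    fix i j x assume ij: "i \<noteq> j" "x \<in> interior (K i)" "x \<in> interior (K j)"
    then have "K i \<noteq> {}" "K j \<noteq> {}" by auto
    then have "K i \<in> \<D>" "K j \<in> \<D>" using KD by blast+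
    moreover have "K i \<noteq> K j"
    proof
      assume eq: "K i = K j"
      from ij have "i \<in> to_nat_on \<D> ` \<D>" "j \<in> to_nat_on \<D> ` \<D>"
        by (auto simp: K_def split: if_splits)
      then obtain A A' where "A \<in> \<D>" "A' \<in> \<D>" "i = to_nat_on \<D> A" "j = to_nat_on \<D> A'"
        by auto
      then show False using eq ij(1) D(1) by (auto simp: K_def split: if_splits)
    qed
    ultimately have "interior (K i) \<inter> interior (K j) = {}" using D(3) by (auto simp: pairwise_def)
    then show "x \<in> {}" using ij by auto
  qed
  have cube: "\<exists>Q. Q \<in> sets borel \<and> \<Phi> ` (S \<inter> K j) \<subseteq> Q \<and>
      emeasure lborel Q \<le> ennreal C * emeasure lborel (interior (K j))" for j
  proof (cases "K j = {}")
    case True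
    then show ?thesis by (intro exI[of _ "{}"]) auto
  next
    case False
    then have KjD: "K j \<in> \<D>" using KD by blast
    then obtain u v where uv: "K j = cbox u v" "interior (K j) \<noteq> {}" using D(2) by blast
    then obtain k where k: "\<And>i. i \<in> Basis \<Longrightarrow> v \<bullet> i - u \<bullet> i = (b \<bullet> i - a \<bullet> i) / 2^k"
      using D(5) KjD by metis
    define \<sigma> where "\<sigma> = 2 * B / 2 ^ k"
    have \<sigma>: "\<sigma> > 0" "\<And>i. i \<in> Basis \<Longrightarrow> v \<bullet> i - u \<bullet> i = \<sigma>"
      using k ab B(1) by (auto simp: \<sigma>_def)
    obtain x where x: "x \<in> S" "x \<in> K j" using D(4)[OF KjD] by auto
    define Q where "Q = cbox (\<Phi> x - (L * n * \<sigma>) *\<^sub>R One) (\<Phi> x + (L * n * \<sigma>) *\<^sub>R One)"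
    have "\<Phi> ` (S \<inter> K j) \<subseteq> Q"
    proof safe
      fix y assume y: "y \<in> S" "y \<in> K j"
      have "norm (y - x) \<le> (\<Sum>i\<in>Basis. \<bar>(y - x) \<bullet> i\<bar>)" by (rule norm_le_l1)
      also have "\<dots> \<le> (\<Sum>i\<in>(Basis::'a set). \<sigma>)"
      proof (rule sum_mono)
        fix i :: 'a assume i: "i \<in> Basis"
        have "u \<bullet> i \<le> x \<bullet> i" "x \<bullet> i \<le> v \<bullet> i" "u \<bullet> i \<le> y \<bullet> i" "y \<bullet> i \<le> v \<bullet> i"
          using x y i by (auto simp: uv(1) mem_box)
        then show "\<bar>(y - x) \<bullet> i\<bar> \<le> \<sigma>" using \<sigma>(2)[OF i] by (auto simp: inner_diff_left)
      qed
      finally have "norm (y - x) \<le> n * \<sigma>" by (simp add: n_def)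
      then have "norm (\<Phi> y - \<Phi> x) \<le> L * (n * \<sigma>)"
        using lipschitz_on_normD[OF lip y(1) x(1)] L by (meson mult_left_mono order_trans)
      then have *: "\<bar>(\<Phi> y - \<Phi> x) \<bullet> i\<bar> \<le> L * n * \<sigma>" if "i \<in> Basis" for i
        using Basis_le_norm[OF that, of "\<Phi> y - \<Phi> x"] by (simp add: mult.assoc)
      have "\<Phi> x \<bullet> i - L * n * \<sigma> \<le> \<Phi> y \<bullet> i \<and> \<Phi> y \<bullet> i \<le> \<Phi> x \<bullet> i + L * n * \<sigma>"
        if "i \<in> Basis" for i
        using that[THEN *] by (simp add: inner_diff_left abs_le_iff)
      then show "\<Phi> y \<in> Q" by (auto simp: Q_def mem_box inner_diff_left inner_add_left)
    qed
    moreover have "emeasure lborel Q \<le> ennreal C * emeasure lborel (interior (K j))"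
    proof -
      have "emeasure lborel Q = ennreal ((2 * (L * n * \<sigma>)) ^ n)"
        unfolding Q_def using L \<sigma>(1)
        by (subst emeasure_lborel_cbox) (auto simp: inner_diff_left inner_add_left n_def mult_ac)
      moreover have "emeasure lborel (interior (K j)) = ennreal (\<sigma> ^ n)"
      proof -
        have "u \<bullet> i \<le> v \<bullet> i" if "i \<in> Basis" for i using \<sigma>(1) \<sigma>(2)[OF that] by simp
        moreover have "(\<Prod>i\<in>Basis. (v - u) \<bullet> i) = (\<Prod>i\<in>(Basis::'a set). \<sigma>)"
          using \<sigma>(2) by (intro prod.cong) (auto simp: inner_diff_left)
        ultimately show ?thesis by (simp add: uv(1) interior_cbox n_def)
      qed
      moreover have "(2 * (L * n * \<sigma>)) ^ n = C * \<sigma> ^ n"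
        unfolding C_def power_mult_distrib[symmetric] by (simp add: mult.assoc)
      ultimately show ?thesis using C \<sigma>(1) by (simp add: ennreal_mult)
    qed
    ultimately show ?thesis by (intro exI[of _ Q]) (auto simp: Q_def)
  qed
  then obtain Q where Q: "\<And>j. Q j \<in> sets borel" "\<And>j. \<Phi> ` (S \<inter> K j) \<subseteq> Q j"
      "\<And>j. emeasure lborel (Q j) \<le> ennreal C * emeasure lborel (interior (K j))"
    by metis
  have "emeasure lborel (\<Phi> ` S) \<le> emeasure lborel (\<Union>j. Q j)"
  proof (rule emeasure_mono)
    show "\<Phi> ` S \<subseteq> (\<Union>j. Q j)"
    proof safe
      fix x assume x: "x \<in> S"
      then obtain j where "x \<in> K j" using D(6) KU by auto
      then show "\<Phi> x \<in> (\<Union>j. Q j)" using x Q(2)[of j] by blast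
    qed
  qed (use Q in auto)
  also have "\<dots> \<le> (\<Sum>j. emeasure lborel (Q j))"
    by (rule emeasure_subadditive_countably) (use Q in auto)
  also have "\<dots> \<le> (\<Sum>j. ennreal C * emeasure lborel (interior (K j)))"
    by (intro suminf_le Q) auto
  also have "\<dots> = ennreal C * (\<Sum>j. emeasure lborel (interior (K j)))" by simp
  finally have 1: "emeasure lborel (\<Phi> ` S) \<le> ennreal C * (\<Sum>j. emeasure lborel (interior (K j)))" .
  have "(\<Sum>j. emeasure lborel (interior (K j))) = emeasure lborel (\<Union>j. interior (K j))"
    by (rule suminf_emeasure) (use disj in auto)
  also have "\<dots> \<le> emeasure lborel T"
  proof (rule emeasure_mono)
    have "K j \<subseteq> T" for j
    proof (cases "K j = {}")
      case False
      then have "K j \<in> \<D>" using KD by blast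
      from D(4)[OF this] obtain x where "x \<in> S" "K j \<subseteq> ball x (r x)" by auto
      then show ?thesis using r[of x] T(2) by blast
    qed auto
    then show "(\<Union>j. interior (K j)) \<subseteq> T" using interior_subset by blast
  qed (use T in auto)
  also have "emeasure lborel T = emeasure lborel S + emeasure lborel (T - S)"
    using T S(1) by (subst plus_emeasure) (auto simp: Un_absorb1)
  also have "\<dots> \<le> emeasure lborel S + ennreal \<eta>"
    using T(3) by (intro add_left_mono) simp
  finally have "emeasure lborel (\<Phi> ` S) \<le> ennreal C * (emeasure lborel S + ennreal \<eta>)"
    using 1 by (meson mult_left_mono order_trans zero_le)
  also have "\<dots> = ennreal C * emeasure lborel S + ennreal (C * \<eta>)"
    using \<eta>(1) C by (simp add: distrib_left ennreal_mult)
  also have "\<dots> \<le> ennreal C * emeasure lborel S + ennreal \<epsilon>"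
    using \<eta>(2) by (intro add_left_mono ennreal_leI)
  finally show "emeasure lborel (\<Phi> ` S)
      \<le> ennreal ((2 * L * real DIM('a)) ^ DIM('a)) * emeasure lborel S + ennreal \<epsilon>"
    unfolding C_def n_def .
qed

text \<open>The set estimate, applied to the parts of \<open>V\<close> that are mapped into Borel
  sets, is an inequality of measures: Lebesgue measure on the image is at most C times the
  push-forward of Lebesgue measure on \<open>V\<close>. Integrating \<open>q\<close> against both
  sides gives the claim.\<close>

lemma nn_integral_lipschitz_image_le:
  fixes \<Phi> :: "'a::euclidean_space \<Rightarrow> 'a" and q :: "'a \<Rightarrow> ennreal"
  assumes lip: "L-lipschitz_on V \<Phi>" and V: "V \<in> sets borel" "bounded V"
    and im: "\<Phi> ` V \<in> sets borel" and q [measurable]: "q \<in> borel_measurable borel"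
  shows "(\<integral>\<^sup>+y\<in>\<Phi> ` V. q y \<partial>lborel)
    \<le> ennreal ((2 * L * real DIM('a)) ^ DIM('a)) * (\<integral>\<^sup>+x\<in>V. q (\<Phi> x) \<partial>lborel)"
proof -
  define C where "C = ennreal ((2 * L * real DIM('a)) ^ DIM('a))"
  define U where "U = \<Phi> ` V"
  have U [measurable]: "U \<in> sets borel" using im by (simp add: U_def)
  note V(1) [measurable]
  have [measurable]: "\<Phi> \<in> borel_measurable (restrict_space lborel V)"
  proof -
    have "continuous_on V \<Phi>" using lip by (rule lipschitz_on_continuous_on)
    then have "\<Phi> \<in> borel_measurable (restrict_space borel V)"
      by (rule borel_measurable_continuous_on_restrict)
    moreover have "sets (restrict_space borel V) = sets (restrict_space lborel V)"
      by (simp add: sets_restrict_space)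
    ultimately show ?thesis using measurable_cong_sets by blast
  qed
  let ?M = "density lborel (indicator U)"
  let ?D = "distr (restrict_space lborel V) borel \<Phi>"
  have "?M \<le> scale_measure C ?D"
  proof (subst le_measure)
    show "sets ?M = sets (scale_measure C ?D)" by simp
    show "\<forall>A\<in>sets ?M. emeasure ?M A \<le> emeasure (scale_measure C ?D) A"
    proof
      fix A assume "A \<in> sets ?M"
      then have A [measurable]: "A \<in> sets borel" by simp
      define S where "S = \<Phi> -` A \<inter> space (restrict_space lborel V)"
      have SV: "S = \<Phi> -` A \<inter> V" by (simp add: S_def space_restrict_space)
      have "S \<in> sets (restrict_space lborel V)" unfolding S_def by measurable
      then have S: "S \<in> sets borel" using V(1)
        by (auto simp: sets_restrict_space)
      have eq: "U \<inter> A = \<Phi> ` S" by (auto simp: SV U_def)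
      have "emeasure ?M A = emeasure lborel (U \<inter> A)"
        by (subst emeasure_density) (auto simp: indicator_inter_arith[symmetric])
      also have "\<dots> \<le> C * emeasure lborel S"
        unfolding eq C_def
      proof (rule emeasure_lipschitz_image_le)
        show "L-lipschitz_on S \<Phi>" by (rule lipschitz_on_subset[OF lip]) (auto simp: SV)
        show "bounded S" by (rule bounded_subset[OF V(2)]) (auto simp: SV)
        show "\<Phi> ` S \<in> sets borel" by (subst eq[symmetric]) measurable
      qed (rule S)
      also have "emeasure lborel S = emeasure ?D A"
        by (subst emeasure_distr) (auto simp: S_def[symmetric] emeasure_restrict_space V(1) SV)
      finally show "emeasure ?M A \<le> emeasure (scale_measure C ?D) A" by simp
    qed
  qed
  then have "nn_integral ?M q \<le> nn_integral (scale_measure C ?D) q"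
    by (intro nn_integral_mono_measure) auto
  also have "nn_integral ?M q = (\<integral>\<^sup>+y\<in>U. q y \<partial>lborel)"
    by (subst nn_integral_density) (auto simp: mult.commute)
  also have "nn_integral (scale_measure C ?D) q = C * nn_integral ?D q"
    by (rule nn_integral_scale_measure) simp
  also have "nn_integral ?D q = (\<integral>\<^sup>+x\<in>V. q (\<Phi> x) \<partial>lborel)"
    by (subst nn_integral_distr) (auto simp: nn_integral_restrict_space V(1))
  finally show ?thesis by (simp add: C_def U_def)
qed

subsection \<open>The weight\<close>

text \<open>The weight is infinite at \<open>0\<close>, so that a finite integral of \<open>wt q \<circ> f\<close> also shows that the zero set
  of \<open>f\<close> is a null set.\<close>

definition wt :: "real \<Rightarrow> complex \<Rightarrow> ennreal" where
  "wt q t = (if t = 0 then \<infinity> else ennreal (norm t powr (- q)))"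

lemma wt_measurable [measurable]: "wt q \<in> borel_measurable borel"
  unfolding wt_def by measurable

lemma cball_sets_borel [measurable]: "cball a r \<in> sets borel"
  by simp

lemma wt_less_top: "t \<noteq> 0 \<Longrightarrow> wt q t < \<infinity>"
  by (simp add: wt_def)

lemma wt_mult: "wt q (a * b) = wt q a * wt q b"
  by (auto simp: wt_def norm_mult powr_mult ennreal_mult ennreal_top_mult ennreal_mult_top)

lemma wt_add: "wt (q + q') a = wt q a * wt q' a"
  by (auto simp: wt_def powr_add[symmetric] ennreal_mult[symmetric] ennreal_top_mult)

lemma wt_antimono: "q \<ge> 0 \<Longrightarrow> norm a \<le> norm b \<Longrightarrow> wt q b \<le> wt q a"
  by (auto simp: wt_def intro!: ennreal_leI powr_mono2')

lemma wt_mono_exponent: "q \<le> q' \<Longrightarrow> norm a \<le> 1 \<Longrightarrow> wt q a \<le> wt q' a"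
  by (auto simp: wt_def intro!: ennreal_leI powr_mono')

text \<open>Dyadic annuli: between the radii R / 2^(n+1) and R / 2^n the weight is at most
  \<open>A n\<close>, while the area is of order 4^(-n). The resulting series is geometric with
  ratio x = 2^(q - 2), which is where q < 2 enters.\<close>

lemma wt_disc:
  assumes q: "0 \<le> q" "q < 2"
  shows "(\<integral>\<^sup>+t\<in>cball 0 R. wt q t \<partial>lborel) < \<infinity>"
proof (cases "R > 0")
  case False
  \<comment> \<open>For R \<le> 0 the disc is at most the origin: the weight is infinite there, but
    a point is a null set.\<close>
  have "AE t in lborel. wt q t * indicator (cball 0 R) t = 0"
  proof (rule AE_mp[OF AE_lborel_singleton[of 0]], rule AE_I2, rule impI)
    fix t :: complex assume "t \<noteq> 0"
    then show "wt q t * indicator (cball 0 R) t = 0"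
      using False by (auto simp: indicator_def not_less) (meson norm_le_zero_iff order_trans)
  qed
  then have "(\<integral>\<^sup>+t\<in>cball 0 R. wt q t \<partial>lborel) = (\<integral>\<^sup>+(t::complex). 0 \<partial>lborel)"
    by (rule nn_integral_cong_AE)
  then show ?thesis by simp
next
  case R: True
  define A where "A n = ennreal ((R / 2 ^ Suc n) powr (- q))" for n :: nat
  define x where "x = 2 powr (q - 2)"
  define V where "V = unit_ball_vol (real DIM(complex))"
  have x: "0 \<le> x" "x < 1" using q by (auto simp: x_def powr_less_one)
  \<comment> \<open>Full discs replace the annuli in the majorant; their measure is known directly
    and the cost is only a constant factor.\<close>
  have dom: "wt q t * indicator (cball 0 R) t \<le> (\<Sum>n. A n * indicator (cball 0 (R / 2 ^ n)) t)"
    if t: "t \<noteq> 0" for t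
  proof (cases "norm t \<le> R")
    case True
    have ex: "\<exists>n. R / 2 ^ Suc n < norm t"
    proof -
      have "norm t / R > 0" using t R by simp
      then obtain n where "(1/2) ^ n < norm t / R"
        using real_arch_pow_inv[of "norm t / R" "1/2"] by auto
      then have "R / 2 ^ n < norm t" using R by (simp add: field_simps power_divide)
      moreover have "R / 2 ^ Suc n \<le> R / 2 ^ n" using R by (simp add: field_simps)
      ultimately show ?thesis by (meson le_less_trans)
    qed
    define n where "n = (LEAST n. R / 2 ^ Suc n < norm t)"
    have n1: "R / 2 ^ Suc n < norm t" unfolding n_def by (rule LeastI_ex[OF ex])
    have n2: "norm t \<le> R / 2 ^ n"
    proof (cases n)
      case 0 then show ?thesis using True by simp
    next
      case (Suc k)
      then have "\<not> R / 2 ^ Suc k < norm t" unfolding n_def using not_less_Least by (metis lessI)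
      then show ?thesis using Suc by simp
    qed
    have "wt q t \<le> A n"
      using t n1 q R unfolding wt_def A_def
      by (auto intro!: ennreal_leI powr_mono2')
    also have "A n = A n * indicator (cball 0 (R / 2 ^ n)) t" using n2 by simp
    also have "\<dots> \<le> (\<Sum>n. A n * indicator (cball 0 (R / 2 ^ n)) t)"
    proof -
      define B where "B n = A n * indicator (cball 0 (R / 2 ^ n)) t" for n
      have "sum B {n} \<le> suminf B" by (rule sum_le_suminf) auto
      then have "B n \<le> suminf B" by simp
      then show ?thesis unfolding B_def .
    qed
    finally show ?thesis using True by simp
  qed simp
  have "(\<integral>\<^sup>+t\<in>cball 0 R. wt q t \<partial>lborel)
      \<le> (\<integral>\<^sup>+t. (\<Sum>n. A n * indicator (cball (0::complex) (R / 2 ^ n)) t) \<partial>lborel)"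
    by (rule nn_integral_mono_AE) (rule AE_mp[OF AE_lborel_singleton[of 0]], simp add: dom)
  also have "\<dots> = (\<Sum>n. A n * emeasure lborel (cball (0::complex) (R / 2 ^ n)))"
    by (subst nn_integral_suminf) (auto simp: nn_integral_cmult_indicator)
  also have "\<dots> = (\<Sum>n. ennreal (V * R powr (2 - q) * 2 powr q * x ^ n))"
  proof (rule suminf_cong)
    fix n
    have "A n * emeasure lborel (cball (0::complex) (R / 2 ^ n))
        = ennreal ((R / 2 ^ Suc n) powr (- q) * (V * (R / 2 ^ n)\<^sup>2))"
      using R by (simp add: A_def emeasure_cball V_def ennreal_mult)
    also have "(R / 2 ^ Suc n) powr (- q) * (V * (R / 2 ^ n)\<^sup>2)
        = V * R powr (2 - q) * 2 powr q * x ^ n"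
    proof -
      have 1: "(R / 2 ^ Suc n) powr (- q) = R powr (- q) * 2 powr (q * (1 + real n))"
      proof -
        have "R / 2 ^ Suc n = R * 2 powr (- (1 + real n))"
          unfolding powr_minus_divide by (simp add: powr_add powr_realpow)
        then have "(R / 2 ^ Suc n) powr (- q) = R powr (- q) * (2 powr (- (1 + real n))) powr (- q)"
          using R by (simp only: powr_mult)
        then show ?thesis by (simp only: powr_powr minus_mult_minus mult.commute[of q])
      qed
      have 2: "(R / 2 ^ n)\<^sup>2 = R powr 2 * 2 powr (- 2 * real n)"
      proof -
        have "R / 2 ^ n = R * 2 powr (- real n)"
          by (simp add: powr_minus_divide powr_realpow)
        then have "(R / 2 ^ n) powr 2 = R powr 2 * (2 powr (- real n)) powr 2"
          using R by (simp only: powr_mult)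
        moreover have "(R / 2 ^ n) powr 2 = (R / 2 ^ n)\<^sup>2"
          using R powr_realpow[of "R / 2 ^ n" 2] by simp
        moreover have "(2 powr (- real n)) powr 2 = 2 powr (- 2 * real n)"
          unfolding powr_powr by (simp add: mult.commute)
        ultimately show ?thesis by simp
      qed
      have 3: "x ^ n = 2 powr ((q - 2) * real n)"
        unfolding powr_powr[symmetric] x_def by (simp add: powr_realpow)
      have 4: "R powr (- q) * R powr 2 = R powr (2 - q)"
        by (simp add: powr_add[symmetric])
      have 5: "2 powr (q * (1 + real n)) * 2 powr (- 2 * real n) = 2 powr q * 2 powr ((q - 2) * real n)"
        by (simp only: powr_add[symmetric]) (simp add: algebra_simps)
      have ac: "a * b * (V * (c * d)) = V * (a * c) * (b * d)" for a b c d :: real by simp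
      show ?thesis unfolding 1 2 3 ac 4 5 by (rule mult.assoc[symmetric])
    qed
    finally show "A n * emeasure lborel (cball (0::complex) (R / 2 ^ n))
        = ennreal (V * R powr (2 - q) * 2 powr q * x ^ n)" .
  qed
  also have "\<dots> = ennreal (\<Sum>n. V * R powr (2 - q) * 2 powr q * x ^ n)"
    by (rule suminf_ennreal2) (use x in \<open>auto simp: V_def intro!: summable_mult summable_geometric\<close>)
  also have "\<dots> < \<infinity>" by simp
  finally show ?thesis .
qed

lemma wt_disc_shift_le:
  fixes c :: complex
  shows "(\<integral>\<^sup>+x\<in>cball 0 R. wt q (x + c) \<partial>lborel) \<le> (\<integral>\<^sup>+t\<in>cball 0 (R + norm c). wt q t \<partial>lborel)"
proof -
  have "(\<integral>\<^sup>+x\<in>cball 0 R. wt q (x + c) \<partial>lborel)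
      \<le> (\<integral>\<^sup>+x. wt q (c + x) * indicator (cball 0 (R + norm c)) (c + x) \<partial>lborel)"
    by (rule nn_integral_mono)
       (auto simp: indicator_def add.commute intro: order_trans[OF norm_triangle_ineq])
  also have "\<dots> = (\<integral>\<^sup>+t\<in>cball 0 (R + norm c). wt q t \<partial>distr lborel borel ((+) c))"
    by (subst nn_integral_distr) auto
  also have "\<dots> = (\<integral>\<^sup>+t\<in>cball 0 (R + norm c). wt q t \<partial>lborel)"
    by (simp add: lborel_distr_plus)
  finally show ?thesis .
qed

text \<open>For holomorphic \<open>F\<close> and \<open>q = 2 * s\<close> this is the analytic form
  of "s lies below the log canonical threshold of F at p".\<close>

definition locint :: "real \<Rightarrow> ('a::euclidean_space \<Rightarrow> complex) \<Rightarrow> 'a \<Rightarrow> bool" where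
  "locint q F p \<longleftrightarrow> (\<exists>U. open U \<and> p \<in> U \<and> (\<integral>\<^sup>+x\<in>U. wt q (F x) \<partial>lborel) < \<infinity>)"

lemma locint_small:
  assumes "locint q F p" "e > 0"
  obtains r where "0 < r" "r \<le> e" "(\<integral>\<^sup>+x\<in>ball p r. wt q (F x) \<partial>lborel) < \<infinity>"
proof -
  obtain U where U: "open U" "p \<in> U" "(\<integral>\<^sup>+x\<in>U. wt q (F x) \<partial>lborel) < \<infinity>"
    using assms(1) by (auto simp: locint_def)
  then obtain r where r: "r > 0" "ball p r \<subseteq> U" by (auto simp: open_contains_ball)
  have "(\<integral>\<^sup>+x\<in>ball p (min r e). wt q (F x) \<partial>lborel) \<le> (\<integral>\<^sup>+x\<in>U. wt q (F x) \<partial>lborel)"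
    using r by (intro nn_integral_mono) (auto simp: indicator_def)
  then show ?thesis using that[of "min r e"] r assms(2) U by (auto intro: le_less_trans)
qed

text \<open>The three normal forms contain a product \<open>p m\<close> of two smooth branches at distance \<open>2 |c|\<close>. Moving half
  of the exponent of the larger factor to \<open>c\<close> leaves the exponent \<open>3 s\<close> on every factor, which is below
  the critical value \<open>2\<close> exactly if \<open>s < 2 / 3\<close>.\<close>

lemma wt_product_le:
  assumes "s \<ge> 0" "norm c \<le> norm p \<or> norm c \<le> norm m"
  shows "wt (2 * s) (p * m) \<le> wt s c * (wt (3 * s) p + wt (3 * s) m)"
proof -
  have *: "wt (2 * s) (p * m) \<le> wt s c * wt (3 * s) p" if "norm p \<le> norm m" "norm c \<le> norm m" for p m
  proof -
    have "wt (2 * s) (p * m) = wt (2 * s) p * (wt s m * wt s m)"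
      by (simp add: wt_mult wt_add[symmetric])
    also have "\<dots> \<le> wt (2 * s) p * (wt s p * wt s c)"
      using that assms(1) by (intro mult_mono wt_antimono) auto
    also have "\<dots> = wt s c * wt (3 * s) p"
      using wt_add[of "2 * s" s p] by (simp add: mult_ac)
    finally show ?thesis .
  qed
  show ?thesis
  proof (cases "norm p \<le> norm m")
    case True
    then have "wt (2 * s) (p * m) \<le> wt s c * wt (3 * s) p" using assms by (intro *) auto
    also have "\<dots> \<le> wt s c * (wt (3 * s) p + wt (3 * s) m)" by (intro mult_left_mono) auto
    finally show ?thesis .
  next
    case False
    then have "wt (2 * s) (m * p) \<le> wt s c * wt (3 * s) m" using assms by (intro *) auto
    also have "\<dots> \<le> wt s c * (wt (3 * s) p + wt (3 * s) m)" by (intro mult_left_mono) auto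
    finally show ?thesis by (simp add: mult.commute)
  qed
qed

lemma wt_sum_of_squares_le:
  assumes "s \<ge> 0"
  shows "wt (2 * s) (x\<^sup>2 + c\<^sup>2) \<le> wt s c * (wt (3 * s) (x + \<i> * c) + wt (3 * s) (x + - \<i> * c))"
proof -
  have "x\<^sup>2 + c\<^sup>2 = (x + \<i> * c) * (x + - \<i> * c)" by (simp add: algebra_simps power2_eq_square)
  moreover have "norm c \<le> norm (x + \<i> * c) \<or> norm c \<le> norm (x + - \<i> * c)"
  proof -
    have "2 * norm c = norm ((x + \<i> * c) - (x + - \<i> * c))" by (simp add: norm_mult)
    also have "\<dots> \<le> norm (x + \<i> * c) + norm (x + - \<i> * c)" by (rule norm_triangle_ineq4)
    finally show ?thesis by linarith
  qed
  ultimately show ?thesis using wt_product_le[OF assms] by metis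
qed

text \<open>The common Fubini argument for the three normal forms. For fixed y the two inner
  integrals are those of a translated weight, bounded by the integral \<open>J\<close> over the disc
  of radius 2 because |c y| \<le> 1; what remains is the integral of |y|^(-3s). Both are finite
  since 3 s < 2.\<close>

lemma locint_of_wt_le:
  fixes g :: "complex \<times> complex \<Rightarrow> complex" and c :: "complex \<Rightarrow> complex"
  assumes s: "0 \<le> s" "s < 2 / 3" and [measurable]: "c \<in> borel_measurable borel"
    and c: "\<And>y. norm y \<le> 1 \<Longrightarrow> norm (c y) \<le> 1"
    and le: "\<And>x y. norm y \<le> 1 \<Longrightarrow>
      wt (2 * s) (g (x, y)) \<le> wt (3 * s) y * (wt (3 * s) (x + \<i> * c y) + wt (3 * s) (x + - \<i> * c y))"
  shows "locint (2 * s) g (0, 0)"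
  unfolding locint_def
proof (intro exI conjI)
  define J where "J = (\<integral>\<^sup>+t\<in>cball 0 2. wt (3 * s) t \<partial>lborel)"
  define G where "G x y = wt (3 * s) y * indicator (cball 0 1) y *
    (wt (3 * s) (x + \<i> * c y) * indicator (cball 0 1) x + wt (3 * s) (x + - \<i> * c y) * indicator (cball 0 1) x)"
    for x y
  have J: "J < \<infinity>" unfolding J_def using s by (intro wt_disc) auto
  have inner: "(\<integral>\<^sup>+x\<in>cball 0 1. wt (3 * s) (x + d) \<partial>lborel) \<le> J" if "norm d \<le> 1" for d
    unfolding J_def using that
    by (intro order_trans[OF wt_disc_shift_le] nn_integral_mono) (auto simp: indicator_def)
  have "(\<integral>\<^sup>+z\<in>ball (0,0) 1. wt (2 * s) (g z) \<partial>lborel)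
      \<le> (\<integral>\<^sup>+z. G (fst z) (snd z) \<partial>(lborel \<Otimes>\<^sub>M lborel))"
    unfolding lborel_prod
  proof (rule nn_integral_mono)
    fix z :: "complex \<times> complex"
    obtain x y where z: "z = (x, y)" by force
    show "wt (2 * s) (g z) * indicator (ball (0,0) 1) z \<le> G (fst z) (snd z)"
    proof (cases "z \<in> ball (0,0) 1")
      case True
      then have "norm (x, y) < 1" by (simp add: z dist_norm norm_Pair)
      then have "norm x \<le> 1" "norm y \<le> 1"
        using norm_fst_le[of x y] norm_snd_le[of y x] by linarith+
      then show ?thesis using le[of y x] True by (simp add: z G_def)
    qed simp
  qed
  also have "\<dots> = (\<integral>\<^sup>+y. (\<integral>\<^sup>+x. G x y \<partial>lborel) \<partial>lborel)"
    unfolding G_def by (subst lborel_pair.nn_integral_snd[symmetric]) auto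
  also have "\<dots> \<le> (\<integral>\<^sup>+y. wt (3 * s) y * indicator (cball 0 1) y * (J + J) \<partial>lborel)"
  proof (rule nn_integral_mono)
    fix y :: complex
    have "(\<integral>\<^sup>+x. G x y \<partial>lborel) = wt (3 * s) y * indicator (cball 0 1) y *
       ((\<integral>\<^sup>+x\<in>cball 0 1. wt (3 * s) (x + \<i> * c y) \<partial>lborel) +
        (\<integral>\<^sup>+x\<in>cball 0 1. wt (3 * s) (x + - \<i> * c y) \<partial>lborel))"
      unfolding G_def by (subst nn_integral_cmult, simp, subst nn_integral_add) auto
    also have "\<dots> \<le> wt (3 * s) y * indicator (cball 0 1) y * (J + J)"
    proof (cases "norm y \<le> 1")
      case True
      then show ?thesis using c[OF True]
        by (intro mult_left_mono add_mono inner) (auto simp: norm_mult)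
    qed simp
    finally show "(\<integral>\<^sup>+x. G x y \<partial>lborel) \<le> wt (3 * s) y * indicator (cball 0 1) y * (J + J)" .
  qed
  also have "\<dots> = (\<integral>\<^sup>+y\<in>cball 0 1. wt (3 * s) y \<partial>lborel) * (J + J)"
    by (rule nn_integral_multc) simp
  also have "\<dots> < \<infinity>"
    using J wt_disc[of "3 * s" 1] s by (auto simp: ennreal_mult_less_top)
  finally show "(\<integral>\<^sup>+z\<in>ball (0,0) 1. wt (2 * s) (g z) \<partial>lborel) < \<infinity>" .
qed auto

text \<open>Two transversal lines leave only |y|^(-s) outside the factors. Raising this to
  |y|^(-3s), possible for |y| \<le> 1, is wasteful but fits the common pattern; a node has threshold
  1.\<close>

lemma locint_nf_A1: "0 \<le> s \<Longrightarrow> s < 2 / 3 \<Longrightarrow> locint (2 * s) nf_A1 (0, 0)"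
proof (rule locint_of_wt_le[where c = "\<lambda>y. y"])
  fix x y :: complex assume s: "0 \<le> s" and y: "norm y \<le> 1"
  have "wt (2 * s) (nf_A1 (x, y)) \<le> wt s y * (wt (3 * s) (x + \<i> * y) + wt (3 * s) (x + - \<i> * y))"
    using wt_sum_of_squares_le[OF s, of x y] by (simp add: nf_A1_def)
  also have "\<dots> \<le> wt (3 * s) y * (wt (3 * s) (x + \<i> * y) + wt (3 * s) (x + - \<i> * y))"
    using s y by (intro mult_right_mono wt_mono_exponent) auto
  finally show "wt (2 * s) (nf_A1 (x, y))
    \<le> wt (3 * s) y * (wt (3 * s) (x + \<i> * y) + wt (3 * s) (x + - \<i> * y))" .
qed auto

lemma wt_cube: "wt s (y ^ 3) = wt (3 * s) y"
proof -
  have "wt (3 * s) y = wt (s + (s + s)) y" by (simp add: algebra_simps)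
  then show ?thesis by (simp only: wt_add) (simp add: power3_eq_cube wt_mult mult.assoc)
qed

text \<open>The branches x = \<plusminus> i y^3 have distance of order |y|^3, so the factor |c|^(-s)
  is exactly |y|^(-3s). The threshold 1/2 + 1/6 = 2/3 is attained here.\<close>

lemma locint_nf_A5: "0 \<le> s \<Longrightarrow> s < 2 / 3 \<Longrightarrow> locint (2 * s) nf_A5 (0, 0)"
proof (rule locint_of_wt_le[where c = "\<lambda>y. y ^ 3"])
  fix x y :: complex assume s: "0 \<le> s"
  show "wt (2 * s) (nf_A5 (x, y))
    \<le> wt (3 * s) y * (wt (3 * s) (x + \<i> * y ^ 3) + wt (3 * s) (x + - \<i> * y ^ 3))"
    using wt_sum_of_squares_le[OF s, of x "y ^ 3"]
    by (simp add: nf_A5_def wt_cube power_mult[symmetric])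
qed (auto simp: norm_power power_le_one)

text \<open>Three lines through the origin: the line y = 0 contributes |y|^(-2s), and the distance
  of the other two contributes another |y|^(-s). The total exponent 3 s is again critical at s = 2 /
  3.\<close>

lemma locint_nf_D4: "0 \<le> s \<Longrightarrow> s < 2 / 3 \<Longrightarrow> locint (2 * s) nf_D4 (0, 0)"
proof (rule locint_of_wt_le[where c = "\<lambda>y. y"])
  fix x y :: complex assume s: "0 \<le> s"
  have "nf_D4 (x, y) = y * (x\<^sup>2 + y\<^sup>2)"
    by (simp add: nf_D4_def algebra_simps power2_eq_square power3_eq_cube)
  then have "wt (2 * s) (nf_D4 (x, y)) = wt (2 * s) y * wt (2 * s) (x\<^sup>2 + y\<^sup>2)"
    by (simp add: wt_mult)
  also have "\<dots> \<le> wt (2 * s) y *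
      (wt s y * (wt (3 * s) (x + \<i> * y) + wt (3 * s) (x + - \<i> * y)))"
    by (intro mult_left_mono wt_sum_of_squares_le s) auto
  also have "\<dots> = wt (3 * s) y * (wt (3 * s) (x + \<i> * y) + wt (3 * s) (x + - \<i> * y))"
    using wt_add[of "2 * s" s y] by (simp add: mult.assoc)
  finally show "wt (2 * s) (nf_D4 (x, y))
    \<le> wt (3 * s) y * (wt (3 * s) (x + \<i> * y) + wt (3 * s) (x + - \<i> * y))" .
qed auto

subsection \<open>Lipschitz functions on bounded sets\<close>

text \<open>Lipschitz bounds on balls, with constants that may grow with the radius, survive
  products, which global Lipschitz bounds do not. They later dominate difference quotients.\<close>

definition loclip :: "('a::real_normed_vector \<Rightarrow> 'b::metric_space) \<Rightarrow> bool" where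
  "loclip F \<longleftrightarrow> (\<forall>R. \<exists>L. L-lipschitz_on (cball 0 R) F)"

lemma loclip_continuous: "loclip F \<Longrightarrow> continuous_on UNIV F"
proof -
  assume F: "loclip F"
  have "isCont F x" for x
  proof -
    obtain L where L: "L-lipschitz_on (cball 0 (norm x + 1)) F" using F by (auto simp: loclip_def)
    then have "continuous_on (ball 0 (norm x + 1)) F"
      using lipschitz_on_continuous_on continuous_on_subset ball_subset_cball by blast
    then show ?thesis by (simp add: continuous_on_eq_continuous_at)
  qed
  then show ?thesis by (simp add: continuous_at_imp_continuous_on)
qed

lemma loclip_const: "loclip (\<lambda>x. c)"
  unfolding loclip_def by (intro allI exI[of _ 0] lipschitz_on_constant)

lemma loclip_bounded_linear: "bounded_linear F \<Longrightarrow> loclip F"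
  unfolding loclip_def by (meson bounded_linear.lipschitz_boundE)

lemma loclipE:
  assumes "loclip F" "loclip G"
  obtains L M where "L-lipschitz_on (cball 0 R) F" "M-lipschitz_on (cball 0 R) G"
  using assms unfolding loclip_def by blast

lemma loclip_add:
  fixes F G :: "'a::real_normed_vector \<Rightarrow> 'b::real_normed_vector"
  assumes "loclip F" "loclip G"
  shows "loclip (\<lambda>x. F x + G x)"
  unfolding loclip_def
proof
  fix R
  obtain L M where "L-lipschitz_on (cball 0 R) F" "M-lipschitz_on (cball 0 R) G"
    using loclipE[OF assms] by blast
  then show "\<exists>L. L-lipschitz_on (cball 0 R) (\<lambda>x. F x + G x)"
    by (intro exI[of _ "L + M"] lipschitz_on_add)
qed

lemma loclip_Pair:
  assumes "loclip F" "loclip G"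
  shows "loclip (\<lambda>x. (F x, G x))"
  unfolding loclip_def
proof
  fix R
  obtain L M where "L-lipschitz_on (cball 0 R) F" "M-lipschitz_on (cball 0 R) G"
    using loclipE[OF assms] by blast
  then show "\<exists>L. L-lipschitz_on (cball 0 R) (\<lambda>x. (F x, G x))"
    by (intro exI[of _ "sqrt (L\<^sup>2 + M\<^sup>2)"] lipschitz_on_Pair)
qed

lemma loclip_bound:
  fixes F :: "'a::real_normed_vector \<Rightarrow> 'b::real_normed_vector"
  assumes "loclip F"
  obtains B where "B \<ge> 0" "\<And>x. x \<in> cball 0 R \<Longrightarrow> norm (F x) \<le> B"
proof -
  obtain L where L: "L-lipschitz_on (cball 0 (max R 0)) F" using assms by (auto simp: loclip_def)
  show ?thesis
  proof (rule that[of "norm (F 0) + L * max R 0"])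
    show "0 \<le> norm (F 0) + L * max R 0" using lipschitz_on_nonneg[OF L] by simp
    fix x :: 'a assume x: "x \<in> cball 0 R"
    then have "norm (F x - F 0) \<le> L * norm (x - 0)"
      by (intro lipschitz_on_normD[OF L]) auto
    also have "\<dots> \<le> L * max R 0" using x lipschitz_on_nonneg[OF L] by (intro mult_left_mono) auto
    finally show "norm (F x) \<le> norm (F 0) + L * max R 0"
      using norm_triangle_ineq2[of "F x" "F 0"] by linarith
  qed
qed

lemma loclip_bilinear:
  fixes F :: "'a::real_normed_vector \<Rightarrow> 'b::real_normed_vector"
    and G :: "'a \<Rightarrow> 'c::real_normed_vector" and bp :: "'b \<Rightarrow> 'c \<Rightarrow> 'd::real_normed_vector"
  assumes bl: "bounded_bilinear bp" and F: "loclip F" and G: "loclip G"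
  shows "loclip (\<lambda>x. bp (F x) (G x))"
  unfolding loclip_def
proof
  fix R
  obtain K where K: "K > 0" "\<And>a b. norm (bp a b) \<le> norm a * norm b * K"
    using bounded_bilinear.pos_bounded[OF bl] by auto
  obtain L M where L: "L-lipschitz_on (cball 0 R) F" and M: "M-lipschitz_on (cball 0 R) G"
    using loclipE[OF F G] by blast
  obtain A where A: "A \<ge> 0" "\<And>x. x \<in> cball 0 R \<Longrightarrow> norm (F x) \<le> A" using loclip_bound[OF F] by blast
  obtain B where B: "B \<ge> 0" "\<And>x. x \<in> cball 0 R \<Longrightarrow> norm (G x) \<le> B" using loclip_bound[OF G] by blast
  note nn = lipschitz_on_nonneg[OF L] lipschitz_on_nonneg[OF M]
  have "((A * M + L * B) * K)-lipschitz_on (cball 0 R) (\<lambda>x. bp (F x) (G x))"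
  proof (rule lipschitz_onI)
    fix x y :: 'a assume xy: "x \<in> cball 0 R" "y \<in> cball 0 R"
    have "bp (F x) (G x) - bp (F y) (G y) = bp (F x) (G x - G y) + bp (F x - F y) (G y)"
      by (simp add: bounded_bilinear.diff_left[OF bl] bounded_bilinear.diff_right[OF bl])
    then have "norm (bp (F x) (G x) - bp (F y) (G y))
        \<le> norm (bp (F x) (G x - G y)) + norm (bp (F x - F y) (G y))"
      by (metis norm_triangle_ineq)
    also have "\<dots> \<le> norm (F x) * norm (G x - G y) * K + norm (F x - F y) * norm (G y) * K"
      by (intro add_mono K)
    also have "\<dots> \<le> A * (M * dist x y) * K + (L * dist x y) * B * K"
      using xy A B nn K(1) lipschitz_on_normD[OF L xy] lipschitz_on_normD[OF M xy]
      by (intro add_mono mult_right_mono mult_mono) (auto simp: dist_norm)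
    finally show "dist (bp (F x) (G x)) (bp (F y) (G y)) \<le> (A * M + L * B) * K * dist x y"
      by (simp add: dist_norm algebra_simps)
  qed (use A B nn K in auto)
  then show "\<exists>L. L-lipschitz_on (cball 0 R) (\<lambda>x. bp (F x) (G x))" by blast
qed

lemma loclip_mult:
  fixes F G :: "'a::real_normed_vector \<Rightarrow> 'b::real_normed_algebra"
  shows "loclip F \<Longrightarrow> loclip G \<Longrightarrow> loclip (\<lambda>x. F x * G x)"
  by (rule loclip_bilinear[OF bounded_bilinear_mult])

text \<open>The set \<open>S\<close> admits outer functions that are Lipschitz only on the range,
  such as a shifted negative power on the nonnegative reals.\<close>

lemma loclip_compose_lipschitz:
  assumes F: "loclip F" and g: "K-lipschitz_on S g" and S: "range F \<subseteq> S"
  shows "loclip (\<lambda>x. g (F x))"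
  unfolding loclip_def
proof
  fix R
  obtain L where L: "L-lipschitz_on (cball 0 R) F" using F by (auto simp: loclip_def)
  have "(K * L)-lipschitz_on (cball 0 R) (\<lambda>x. g (F x))"
  proof (rule lipschitz_on_compose2[OF L])
    show "K-lipschitz_on (F ` cball 0 R) g" by (rule lipschitz_on_subset[OF g]) (use S in auto)
  qed
  then show "\<exists>L. L-lipschitz_on (cball 0 R) (\<lambda>x. g (F x))" by blast
qed

section \<open>Coordinate functions on three-space\<close>

lemma bounded_linear_px: "bounded_linear px"
  unfolding px_def[abs_def] by (rule bounded_linear_fst)

lemma bounded_linear_py: "bounded_linear py"
  unfolding py_def[abs_def] by (rule bounded_linear_compose[OF bounded_linear_fst bounded_linear_snd])

lemma bounded_linear_pz: "bounded_linear pz"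
  unfolding pz_def[abs_def] by (rule bounded_linear_compose[OF bounded_linear_snd bounded_linear_snd])

lemma pt_simps [simp]: "px (a, b, c) = a" "py (a, b, c) = b" "pz (a, b, c) = c"
  by (simp_all add: px_def py_def pz_def)

lemma pt_eta: "(px v, py v, pz v) = v"
  by (simp add: px_def py_def pz_def)

lemma pt_zero [simp]: "px 0 = 0" "py 0 = 0" "pz 0 = 0"
  by (simp_all add: px_def py_def pz_def)

lemma continuous_on_pt [continuous_intros]:
  "continuous_on S g \<Longrightarrow> continuous_on S (\<lambda>x. px (g x))"
  "continuous_on S g \<Longrightarrow> continuous_on S (\<lambda>x. py (g x))"
  "continuous_on S g \<Longrightarrow> continuous_on S (\<lambda>x. pz (g x))"
  by (rule bounded_linear.continuous_on[OF bounded_linear_px]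
      bounded_linear.continuous_on[OF bounded_linear_py]
      bounded_linear.continuous_on[OF bounded_linear_pz], assumption)+

lemma loclip_pt: "loclip px" "loclip py" "loclip pz"
  by (rule loclip_bounded_linear, rule bounded_linear_px bounded_linear_py bounded_linear_pz)+

subsection \<open>Holomorphic functions on three-space\<close>

definition lin3 :: "complex \<Rightarrow> complex \<Rightarrow> complex \<Rightarrow> pt \<Rightarrow> complex" where
  "lin3 a b c w = a * px w + b * py w + c * pz w"

lemma partials_eqI:
  assumes "(f has_derivative lin3 a b c) (at v)"
  shows "dX f v = a" "dY f v = b" "dZ f v = c"
proof -
  have f: "(f has_derivative lin3 a b c) (at (px v, py v, pz v))"
    using assms by (simp add: pt_eta)
  have "((\<lambda>t. f (t, py v, pz v)) has_derivative (\<lambda>h. lin3 a b c (h, 0, 0))) (at (px v))"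
    by (rule has_derivative_compose[where g = f and f' = "\<lambda>h. (h, 0, 0)"], auto intro!: derivative_eq_intros f simp: zero_prod_def)
  then show "dX f v = a"
    unfolding dX_def by (intro DERIV_imp_deriv) (simp add: has_field_derivative_def lin3_def)
  have "((\<lambda>t. f (px v, t, pz v)) has_derivative (\<lambda>h. lin3 a b c (0, h, 0))) (at (py v))"
    by (rule has_derivative_compose[where g = f and f' = "\<lambda>h. (0, h, 0)"], auto intro!: derivative_eq_intros f simp: zero_prod_def)
  then show "dY f v = b"
    unfolding dY_def by (intro DERIV_imp_deriv) (simp add: has_field_derivative_def lin3_def)
  have "((\<lambda>t. f (px v, py v, t)) has_derivative (\<lambda>h. lin3 a b c (0, 0, h))) (at (pz v))"
    by (rule has_derivative_compose[where g = f and f' = "\<lambda>h. (0, 0, h)"], auto intro!: derivative_eq_intros f simp: zero_prod_def)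
  then show "dZ f v = c"
    unfolding dZ_def by (intro DERIV_imp_deriv) (simp add: has_field_derivative_def lin3_def)
qed

text \<open>This ties the one-variable derivatives \<open>dX\<close>, \<open>dY\<close>,
  \<open>dZ\<close> to a complex-linear total derivative. The Lipschitz part serves the passage to
  the limit in difference quotients, the continuity of the partials the integrability of the
  integrands.\<close>

definition hol3 :: "(pt \<Rightarrow> complex) \<Rightarrow> bool" where
  "hol3 f \<longleftrightarrow> loclip f \<and> (\<forall>v. (f has_derivative lin3 (dX f v) (dY f v) (dZ f v)) (at v)) \<and>
     continuous_on UNIV (dX f) \<and> continuous_on UNIV (dY f) \<and> continuous_on UNIV (dZ f)"

lemma hol3I:
  assumes "loclip f" "\<And>v. (f has_derivative lin3 (A v) (B v) (C v)) (at v)"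
    and "continuous_on UNIV A" "continuous_on UNIV B" "continuous_on UNIV C"
  shows "hol3 f" "dX f = A" "dY f = B" "dZ f = C"
proof -
  show "dX f = A" "dY f = B" "dZ f = C" using partials_eqI[OF assms(2)] by auto
  then show "hol3 f" using assms by (simp add: hol3_def)
qed

lemma hol3_const: "hol3 (\<lambda>_. k)" "dX (\<lambda>_. k) = (\<lambda>_. 0)" "dY (\<lambda>_. k) = (\<lambda>_. 0)" "dZ (\<lambda>_. k) = (\<lambda>_. 0)"
proof -
  have *: "((\<lambda>_. k) has_derivative lin3 0 0 0) (at v)" for v
    using has_derivative_const[of k "at v"] by (simp add: lin3_def[abs_def])
  show "hol3 (\<lambda>_. k)" "dX (\<lambda>_. k) = (\<lambda>_. 0)" "dY (\<lambda>_. k) = (\<lambda>_. 0)" "dZ (\<lambda>_. k) = (\<lambda>_. 0)"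
    by (rule hol3I[of "\<lambda>_. k", OF loclip_const *]; simp)+
qed

lemma hol3_coord:
  shows "hol3 px" "dX px = (\<lambda>_. 1)" "dY px = (\<lambda>_. 0)" "dZ px = (\<lambda>_. 0)"
    and "hol3 py" "dX py = (\<lambda>_. 0)" "dY py = (\<lambda>_. 1)" "dZ py = (\<lambda>_. 0)"
    and "hol3 pz" "dX pz = (\<lambda>_. 0)" "dY pz = (\<lambda>_. 0)" "dZ pz = (\<lambda>_. 1)"
proof -
  have x: "(px has_derivative lin3 1 0 0) (at v)" for v
    using bounded_linear_imp_has_derivative[OF bounded_linear_px] by (simp add: lin3_def[abs_def])
  have y: "(py has_derivative lin3 0 1 0) (at v)" for v
    using bounded_linear_imp_has_derivative[OF bounded_linear_py] by (simp add: lin3_def[abs_def])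
  have z: "(pz has_derivative lin3 0 0 1) (at v)" for v
    using bounded_linear_imp_has_derivative[OF bounded_linear_pz] by (simp add: lin3_def[abs_def])
  show "hol3 px" "dX px = (\<lambda>_. 1)" "dY px = (\<lambda>_. 0)" "dZ px = (\<lambda>_. 0)"
    by (rule hol3I[OF loclip_pt(1) x]; simp)+
  show "hol3 py" "dX py = (\<lambda>_. 0)" "dY py = (\<lambda>_. 1)" "dZ py = (\<lambda>_. 0)"
    by (rule hol3I[OF loclip_pt(2) y]; simp)+
  show "hol3 pz" "dX pz = (\<lambda>_. 0)" "dY pz = (\<lambda>_. 0)" "dZ pz = (\<lambda>_. 1)"
    by (rule hol3I[OF loclip_pt(3) z]; simp)+
qed

lemma hol3D:
  assumes "hol3 f"
  shows "loclip f" "(f has_derivative lin3 (dX f v) (dY f v) (dZ f v)) (at v)"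
    "continuous_on UNIV f" "continuous_on UNIV (dX f)" "continuous_on UNIV (dY f)" "continuous_on UNIV (dZ f)"
  using assms unfolding hol3_def by (blast intro: loclip_continuous)+

lemma hol3_add:
  assumes "hol3 f" "hol3 g"
  shows "hol3 (\<lambda>v. f v + g v)" "dX (\<lambda>v. f v + g v) = (\<lambda>v. dX f v + dX g v)"
    "dY (\<lambda>v. f v + g v) = (\<lambda>v. dY f v + dY g v)" "dZ (\<lambda>v. f v + g v) = (\<lambda>v. dZ f v + dZ g v)"
proof -
  note F = hol3D[OF assms(1)] and G = hol3D[OF assms(2)]
  have *: "((\<lambda>v. f v + g v) has_derivative lin3 (dX f v + dX g v) (dY f v + dY g v) (dZ f v + dZ g v)) (at v)" for v
    using has_derivative_add[OF F(2) G(2)] by (rule has_derivative_eq_rhs) (auto simp: lin3_def algebra_simps)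
  note L = loclip_add[OF F(1) G(1)]
  show "hol3 (\<lambda>v. f v + g v)" "dX (\<lambda>v. f v + g v) = (\<lambda>v. dX f v + dX g v)"
    "dY (\<lambda>v. f v + g v) = (\<lambda>v. dY f v + dY g v)" "dZ (\<lambda>v. f v + g v) = (\<lambda>v. dZ f v + dZ g v)"
    using F G by (rule_tac hol3I[OF L *]; auto intro!: continuous_intros)+
qed

lemma hol3_mult:
  assumes "hol3 f" "hol3 g"
  shows "hol3 (\<lambda>v. f v * g v)" "dX (\<lambda>v. f v * g v) = (\<lambda>v. dX f v * g v + f v * dX g v)"
    "dY (\<lambda>v. f v * g v) = (\<lambda>v. dY f v * g v + f v * dY g v)"
    "dZ (\<lambda>v. f v * g v) = (\<lambda>v. dZ f v * g v + f v * dZ g v)"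
proof -
  note F = hol3D[OF assms(1)] and G = hol3D[OF assms(2)]
  have *: "((\<lambda>v. f v * g v) has_derivative lin3 (dX f v * g v + f v * dX g v)
      (dY f v * g v + f v * dY g v) (dZ f v * g v + f v * dZ g v)) (at v)" for v
    using has_derivative_mult[OF F(2) G(2)] by (rule has_derivative_eq_rhs) (auto simp: lin3_def algebra_simps)
  note L = loclip_mult[OF F(1) G(1)]
  show "hol3 (\<lambda>v. f v * g v)" "dX (\<lambda>v. f v * g v) = (\<lambda>v. dX f v * g v + f v * dX g v)"
    "dY (\<lambda>v. f v * g v) = (\<lambda>v. dY f v * g v + f v * dY g v)"
    "dZ (\<lambda>v. f v * g v) = (\<lambda>v. dZ f v * g v + f v * dZ g v)"
    using F G by (rule_tac hol3I[OF L *]; auto intro!: continuous_intros)+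
qed

lemma hol3_prod: "(\<And>i. i \<in> I \<Longrightarrow> hol3 (F i)) \<Longrightarrow> hol3 (\<lambda>v. \<Prod>i\<in>I. F i v)"
  by (induction I rule: infinite_finite_induct) (auto intro: hol3_const hol3_mult)

text \<open>An inductive description of polynomial functions makes closure under partial derivatives a rule
  induction.\<close>

inductive polyfun :: "(pt \<Rightarrow> complex) \<Rightarrow> bool" where
  const: "polyfun (\<lambda>_. k)"
| x: "polyfun px" | y: "polyfun py" | z: "polyfun pz"
| add: "polyfun f \<Longrightarrow> polyfun g \<Longrightarrow> polyfun (\<lambda>v. f v + g v)"
| mult: "polyfun f \<Longrightarrow> polyfun g \<Longrightarrow> polyfun (\<lambda>v. f v * g v)"

lemma polyfun_hol3: "polyfun f \<Longrightarrow> hol3 f"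
  by (induction rule: polyfun.induct) (auto intro: hol3_const hol3_coord hol3_add hol3_mult)

lemma polyfun_partials: "polyfun f \<Longrightarrow> polyfun (dX f) \<and> polyfun (dY f) \<and> polyfun (dZ f)"
  by (induction rule: polyfun.induct)
     (auto simp: hol3_const hol3_coord hol3_add hol3_mult polyfun_hol3 intro!: polyfun.intros)

lemma polyfun_sum: "(\<And>i. i \<in> I \<Longrightarrow> polyfun (F i)) \<Longrightarrow> polyfun (\<lambda>v. \<Sum>i\<in>I. F i v)"
  by (induction I rule: infinite_finite_induct) (auto intro: polyfun.intros)

lemma polyfun_power: "polyfun f \<Longrightarrow> polyfun (\<lambda>v. f v ^ n)"
  by (induction n) (auto intro: polyfun.intros)

lemma homog_polyfun: "homog m f \<Longrightarrow> polyfun f"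
proof -
  assume "homog m f"
  then obtain c where c: "\<And>v. f v = (\<Sum>e\<in>{e. c e \<noteq> 0}. c e * mono e v)"
    by (auto simp: homog_def)
  have "polyfun (\<lambda>v. \<Sum>e\<in>{e. c e \<noteq> 0}. c e * mono e v)"
    unfolding mono_def by (intro polyfun_sum polyfun.mult polyfun_power polyfun.const polyfun.x polyfun.y polyfun.z)
  then show ?thesis by (simp add: c[symmetric])
qed

text \<open>Complex dilation. The product type carries only real scalar multiplication, while
  homogeneity and Wirtinger derivatives involve complex factors.\<close>

definition scl :: "complex \<Rightarrow> pt \<Rightarrow> pt" where
  "scl \<mu> v = (\<mu> * px v, \<mu> * py v, \<mu> * pz v)"

lemma homog_scl: "homog m f \<Longrightarrow> f (scl \<mu> v) = \<mu> ^ m * f v"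
proof -
  assume "homog m f"
  then obtain c where c: "\<And>v. f v = (\<Sum>e\<in>{e. c e \<noteq> 0}. c e * mono e v)" "\<And>e. c e \<noteq> 0 \<Longrightarrow> mdeg e = m"
    by (auto simp: homog_def)
  have "c e * mono e (scl \<mu> v) = \<mu> ^ m * (c e * mono e v)" if "c e \<noteq> 0" for e
    using c(2)[OF that] by (auto simp: mono_def scl_def mdeg_def power_mult_distrib power_add)
  then show ?thesis unfolding c(1) sum_distrib_left by (intro sum.cong) auto
qed

lemma scl_of_real: "scl (of_real r) v = r *\<^sub>R v"
  by (cases v) (auto simp: scl_def scaleR_conv_of_real)

text \<open>Differentiating the homogeneity identity in v yields a factor \<mu> from the inner
  dilation; cancelling it lowers the degree by one.\<close>

lemma partials_scl:
  assumes f: "hol3 f" and h: "\<And>\<mu> v. f (scl \<mu> v) = \<mu> ^ m * f v" and \<mu>: "\<mu> \<noteq> 0" and m: "m \<ge> 1"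
  shows "dX f (scl \<mu> v) = \<mu> ^ (m - 1) * dX f v" "dY f (scl \<mu> v) = \<mu> ^ (m - 1) * dY f v"
    "dZ f (scl \<mu> v) = \<mu> ^ (m - 1) * dZ f v"
proof -
  have "bounded_linear (scl \<mu>)"
    unfolding scl_def[abs_def]
    by (intro bounded_linear_Pair bounded_linear_const_mult bounded_linear_px bounded_linear_py
      bounded_linear_pz)
  then have "(scl \<mu> has_derivative scl \<mu>) (at v)" by (rule bounded_linear_imp_has_derivative)
  from has_derivative_compose[OF this hol3D(2)[OF f]]
  have "((\<lambda>v. \<mu> ^ m * f v) has_derivative
      (\<lambda>w. lin3 (dX f (scl \<mu> v)) (dY f (scl \<mu> v)) (dZ f (scl \<mu> v)) (scl \<mu> w))) (at v)"
    by (simp add: h)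
  then have "((\<lambda>v. \<mu> ^ m * f v) has_derivative
      lin3 (\<mu> * dX f (scl \<mu> v)) (\<mu> * dY f (scl \<mu> v)) (\<mu> * dZ f (scl \<mu> v))) (at v)"
    by (rule has_derivative_eq_rhs) (auto simp: lin3_def scl_def algebra_simps)
  note * = partials_eqI[OF this]
  have e: "\<mu> ^ m = \<mu> * \<mu> ^ (m - 1)" using m by (cases m) auto
  show "dX f (scl \<mu> v) = \<mu> ^ (m - 1) * dX f v" "dY f (scl \<mu> v) = \<mu> ^ (m - 1) * dY f v"
    "dZ f (scl \<mu> v) = \<mu> ^ (m - 1) * dZ f v"
    using * \<mu> by (auto simp: hol3_mult[OF hol3_const(1) f] hol3_const e)
qed

lemma euler:
  assumes f: "hol3 f" and h: "\<And>\<mu> v. f (scl \<mu> v) = \<mu> ^ m * f v"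
  shows "px v * dX f v + py v * dY f v + pz v * dZ f v = of_nat m * f v"
proof -
  have sc: "((\<lambda>\<mu>. scl \<mu> v) has_derivative (\<lambda>k. scl k v)) (at 1)"
    unfolding scl_def by (auto intro!: derivative_eq_intros)
  have "((\<lambda>\<mu>. f (scl \<mu> v)) has_derivative (\<lambda>k. lin3 (dX f v) (dY f v) (dZ f v) (scl k v))) (at 1)"
    by (rule has_derivative_compose[OF sc, where g = f]) (use hol3D(2)[OF f, of v] in \<open>simp add: scl_def pt_eta\<close>)
  then have "((\<lambda>\<mu>. f (scl \<mu> v)) has_field_derivative
      (px v * dX f v + py v * dY f v + pz v * dZ f v)) (at 1)"
    unfolding has_field_derivative_def
    by (rule has_derivative_eq_rhs) (auto simp: lin3_def scl_def algebra_simps)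
  moreover have "((\<lambda>\<mu>. f (scl \<mu> v)) has_field_derivative (of_nat m * f v)) (at 1)"
    unfolding h by (auto intro!: derivative_eq_intros)
  ultimately show ?thesis by (rule DERIV_unique)
qed

subsection \<open>Local integrability near singular points\<close>

text \<open>\<open>holo2\<close> gives only pointwise complex differentiability, so a bound for the
  derivative has to come from Cauchy's estimate. If |F| < M on the ball of radius e, then coordinate
  discs of radius r = e / 2 about points of the smaller ball stay inside; both partials are at most
  M / r, and the derivative at most 2 M / r.\<close>

lemma holo2_lipschitz:
  assumes F: "holo2 F V" and V: "(0, 0) \<in> V"
  obtains r L where "r > 0" "ball (0, 0) r \<subseteq> V" "L-lipschitz_on (ball (0, 0) r) F"
proof -
  have "open V" using F by (simp add: holo2_def)
  then obtain e where e: "e > 0" "cball (0, 0) e \<subseteq> V" using V by (auto simp: open_contains_cball)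
  obtain D where D: "\<And>z. z \<in> V \<Longrightarrow> (F has_derivative D z) (at z)"
    "\<And>z c a b. z \<in> V \<Longrightarrow> D z (c * a, c * b) = c * D z (a, b)"
    using F unfolding holo2_def by metis
  define r where "r = e / 2"
  have r: "r > 0" using e by (simp add: r_def)
  have cont: "continuous_on V F"
    by (rule continuous_at_imp_continuous_on, rule ballI, rule has_derivative_continuous, rule D(1))
  have "compact (F ` cball (0, 0) e)"
    by (intro compact_continuous_image continuous_on_subset[OF cont] e) auto
  then have "bounded (F ` cball (0, 0) e)" by (rule compact_imp_bounded)
  then obtain M where M: "M > 0" "\<And>z. z \<in> cball (0, 0) e \<Longrightarrow> norm (F z) < M"
    unfolding bounded_pos_less by blast
  have in1: "(t, snd z) \<in> cball (0, 0) e" if z: "z \<in> ball (0, 0) r" and t: "t \<in> cball (fst z) r"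
    for z :: "complex \<times> complex" and t
  proof -
    have "norm (t, snd z) \<le> norm (t - fst z, 0 :: complex) + norm z"
      using norm_triangle_ineq[of "(t - fst z, 0)" z] by (cases z) auto
    moreover have "norm (t - fst z, 0 :: complex) = dist (fst z) t" by (simp add: norm_Pair dist_norm norm_minus_commute)
    moreover have "norm z < r" using z by (simp add: zero_prod_def[symmetric])
    ultimately show ?thesis using t by (simp add: zero_prod_def[symmetric] r_def)
  qed
  have in2: "(fst z, t) \<in> cball (0, 0) e" if z: "z \<in> ball (0, 0) r" and t: "t \<in> cball (snd z) r"
    for z :: "complex \<times> complex" and t
  proof -
    have "norm (fst z, t) \<le> norm (0 :: complex, t - snd z) + norm z"
      using norm_triangle_ineq[of "(0, t - snd z)" z] by (cases z) auto
    moreover have "norm (0 :: complex, t - snd z) = dist (snd z) t" by (simp add: norm_Pair dist_norm norm_minus_commute)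
    moreover have "norm z < r" using z by (simp add: zero_prod_def[symmetric])
    ultimately show ?thesis using t by (simp add: zero_prod_def[symmetric] r_def)
  qed
  have cauchy: "norm d \<le> M / r"
    if deriv: "\<And>t. t \<in> cball ctr r \<Longrightarrow> (h has_field_derivative h' t) (at t)" and d: "d = h' ctr"
      and bd: "\<And>t. t \<in> cball ctr r \<Longrightarrow> norm (h t) < M" for h h' :: "complex \<Rightarrow> complex" and ctr d
  proof -
    have c: "continuous_on (cball ctr r) h"
      by (rule continuous_at_imp_continuous_on, rule ballI, rule DERIV_isCont, rule deriv)
    have "h holomorphic_on ball ctr r"
      unfolding holomorphic_on_def
    proof
      fix t assume "t \<in> ball ctr r"
      then have "(h has_field_derivative h' t) (at t)" using deriv by simp
      then show "h field_differentiable at t within ball ctr r"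
        unfolding field_differentiable_def using has_field_derivative_at_within by blast
    qed
    from Cauchy_higher_deriv_bound[OF this c, of 0 M 1]
    have "norm (deriv h ctr) \<le> M / r" using bd r by auto
    then show ?thesis using DERIV_imp_deriv[OF deriv[of ctr]] r d by simp
  qed
  have lin1: "D z (h, 0) = D z (1, 0) * h" if "z \<in> V" for z h
    using D(2)[OF that, of h 1 0] by (simp add: mult.commute)
  have lin2: "D z (0, h) = D z (0, 1) * h" if "z \<in> V" for z h
    using D(2)[OF that, of h 0 1] by (simp add: mult.commute)
  have bd1: "norm (D z (1, 0)) \<le> M / r" if z: "z \<in> ball (0, 0) r" for z :: "complex \<times> complex"
  proof (rule cauchy[where h = "\<lambda>t. F (t, snd z)" and ctr = "fst z" and h' = "\<lambda>t. D (t, snd z) (1, 0)"])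
    fix t assume t: "t \<in> cball (fst z) r"
    have V: "(t, snd z) \<in> V" using in1[OF z t] e by auto
    have 1: "((\<lambda>t. (t, snd z)) has_derivative (\<lambda>h. (h, 0))) (at t)"
      by (auto intro!: derivative_eq_intros)
    have "((\<lambda>t. F (t, snd z)) has_derivative (\<lambda>h. D (t, snd z) (h, 0))) (at t)"
      by (rule has_derivative_compose[OF 1 D(1)[OF V]])
    then show "((\<lambda>t. F (t, snd z)) has_field_derivative D (t, snd z) (1, 0)) (at t)"
      unfolding has_field_derivative_def
      by (rule has_derivative_eq_rhs) (rule ext, rule lin1[OF V])
    show "norm (F (t, snd z)) < M" using in1[OF z t] M by blast
  qed auto
  have bd2: "norm (D z (0, 1)) \<le> M / r" if z: "z \<in> ball (0, 0) r" for z :: "complex \<times> complex"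
  proof (rule cauchy[where h = "\<lambda>t. F (fst z, t)" and ctr = "snd z" and h' = "\<lambda>t. D (fst z, t) (0, 1)"])
    fix t assume t: "t \<in> cball (snd z) r"
    have V: "(fst z, t) \<in> V" using in2[OF z t] e by auto
    have 1: "((\<lambda>t. (fst z, t)) has_derivative (\<lambda>h. (0, h))) (at t)"
      by (auto intro!: derivative_eq_intros)
    have "((\<lambda>t. F (fst z, t)) has_derivative (\<lambda>h. D (fst z, t) (0, h))) (at t)"
      by (rule has_derivative_compose[OF 1 D(1)[OF V]])
    then show "((\<lambda>t. F (fst z, t)) has_field_derivative D (fst z, t) (0, 1)) (at t)"
      unfolding has_field_derivative_def
      by (rule has_derivative_eq_rhs) (rule ext, rule lin2[OF V])
    show "norm (F (fst z, t)) < M" using in2[OF z t] M by blast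
  qed auto
  have sub: "ball (0, 0) r \<subseteq> V"
    using e ball_subset_cball[of "(0,0)" r] subset_cball[of r e "(0,0)"] by (auto simp: r_def)
  have "(2 * (M / r))-lipschitz_on (ball (0, 0) r) F"
  proof (rule bounded_derivative_imp_lipschitz)
    fix z :: "complex \<times> complex" assume z: "z \<in> ball (0, 0) r"
    then have zV: "z \<in> V" using sub by auto
    show "(F has_derivative D z) (at z within ball (0, 0) r)"
      using D(1)[OF zV] by (rule has_derivative_at_withinI)
    show "onorm (D z) \<le> 2 * (M / r)"
    proof (rule onorm_bound)
      fix ab :: "complex \<times> complex"
      obtain a b where ab: "ab = (a, b)" by force
      have "linear (D z)" using D(1)[OF zV] has_derivative_linear by blast
      then have "D z (a, b) = D z (a, 0) + D z (0, b)"
        using linear_add[of "D z" "(a, 0)" "(0, b)"] by simp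
      also have "\<dots> = a * D z (1, 0) + b * D z (0, 1)"
        unfolding lin1[OF zV, of a] lin2[OF zV, of b] by (simp add: mult.commute)
      finally have "norm (D z ab) \<le> norm a * norm (D z (1, 0)) + norm b * norm (D z (0, 1))"
        using norm_triangle_ineq[of "a * D z (1, 0)" "b * D z (0, 1)"] by (simp add: ab norm_mult)
      also have "\<dots> \<le> norm ab * (M / r) + norm ab * (M / r)"
        using norm_fst_le[of a b] norm_snd_le[of b a]
        unfolding ab by (intro add_mono mult_mono bd1[OF z] bd2[OF z]) auto
      finally show "norm (D z ab) \<le> 2 * (M / r) * norm ab" by (simp add: algebra_simps)
    qed (use M r in auto)
  qed (use M r in auto)
  then show ?thesis using that r sub by blast
qed

lemma holo2_continuous_on: "holo2 F U \<Longrightarrow> continuous_on U F"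
  unfolding holo2_def
  by (rule continuous_at_imp_continuous_on, rule ballI, auto dest!: bspec has_derivative_continuous)

text \<open>On a small ball \<open>N\<close> the coordinate change is Lipschitz and the unit
  \<open>u\<close> is bounded away from 0. The integral of the weight of \<open>F\<close> over the
  image of \<open>N\<close> is thus at most a constant times that of the weight of \<open>g\<close>
  over \<open>N\<close>.\<close>

lemma locint_contact_equiv:
  assumes ce: "contact_equiv F g" and F: "continuous_on UNIV F" and g: "continuous_on UNIV g"
    and q: "q \<ge> 0" and loc: "locint q g (0, 0)"
  shows "locint q F (0, 0)"
proof -
  obtain U V \<phi> \<psi> u where *: "open U \<and> open V \<and> (0,0) \<in> V \<and> \<phi> (0,0) = (0,0) \<and>
      \<phi> ` V = U \<and> \<psi> ` U = V \<and> (\<forall>z\<in>V. \<psi> (\<phi> z) = z) \<and> (\<forall>w\<in>U. \<phi> (\<psi> w) = w) \<and>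
      holo2 (fst \<circ> \<phi>) V \<and> holo2 (snd \<circ> \<phi>) V \<and> holo2 (fst \<circ> \<psi>) U \<and> holo2 (snd \<circ> \<psi>) U \<and>
      holo2 u V \<and> (\<forall>z\<in>V. u z \<noteq> 0) \<and> (\<forall>z\<in>V. F (\<phi> z) = u z * g z)"
    using ce unfolding contact_equiv_def by (elim exE)
  from * have UV: "open U" "open V" "(0,0) \<in> V" and \<phi>0: "\<phi> (0,0) = (0,0)" and im: "\<phi> ` V = U"
    and hol: "holo2 (fst \<circ> \<phi>) V" "holo2 (snd \<circ> \<phi>) V" "holo2 (fst \<circ> \<psi>) U" "holo2 (snd \<circ> \<psi>) U"
    and u: "holo2 u V" "\<And>z. z \<in> V \<Longrightarrow> u z \<noteq> 0"
    by simp_all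
  from * have inv: "\<And>z. z \<in> V \<Longrightarrow> \<psi> (\<phi> z) = z" "\<And>w. w \<in> U \<Longrightarrow> \<phi> (\<psi> w) = w"
    and eq: "\<And>z. z \<in> V \<Longrightarrow> F (\<phi> z) = u z * g z"
    by simp_all
  have [measurable]: "F \<in> borel_measurable borel" "g \<in> borel_measurable borel"
    using F g by (auto intro: borel_measurable_continuous_onI)
  obtain r1 L1 where r1: "r1 > 0" "ball (0, 0) r1 \<subseteq> V" "L1-lipschitz_on (ball (0, 0) r1) (fst \<circ> \<phi>)"
    using holo2_lipschitz[OF hol(1) UV(3)] .
  obtain r2 L2 where r2: "r2 > 0" "ball (0, 0) r2 \<subseteq> V" "L2-lipschitz_on (ball (0, 0) r2) (snd \<circ> \<phi>)"
    using holo2_lipschitz[OF hol(2) UV(3)] .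
  define c where "c = norm (u (0, 0)) / 2"
  have c: "c > 0" using u(2) UV(3) by (auto simp: c_def)
  have "isCont u (0, 0)"
    using holo2_continuous_on[OF u(1)] UV by (simp add: continuous_on_eq_continuous_at)
  then obtain r3 where r3: "r3 > 0" "\<And>z. dist z (0, 0) < r3 \<Longrightarrow> dist (u z) (u (0, 0)) < c"
    using c unfolding continuous_at by (metis LIM_def dist_self)
  have uc: "c \<le> norm (u z)" if "z \<in> ball (0, 0) r3" for z
  proof -
    have "norm (u (0, 0) - u z) < c" using r3(2)[of z] that by (simp add: dist_commute dist_norm[symmetric])
    then have "norm (u (0, 0)) - norm (u z) < c" using norm_triangle_ineq2[of "u (0,0)" "u z"] by linarith
    then show ?thesis by (simp add: c_def)
  qed
  obtain r where r: "0 < r" "r \<le> min r1 (min r2 r3)" and fin: "(\<integral>\<^sup>+x\<in>ball (0,0) r. wt q (g x) \<partial>lborel) < \<infinity>"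
    using locint_small[OF loc, of "min r1 (min r2 r3)"] r1 r2 r3 by auto
  define N where "N = ball ((0::complex), (0::complex)) r"
  have [measurable]: "N \<in> sets borel" by (simp add: N_def)
  have NV: "N \<subseteq> V" using r r1(2) subset_ball[of r r1 "(0,0)"] by (auto simp: N_def)
  \<comment> \<open>Writing the image as a preimage under the continuous inverse shows that it is
    open, so it qualifies as a neighbourhood.\<close>
  have "\<phi> ` N = \<psi> -` N \<inter> U"
  proof
    show "\<phi> ` N \<subseteq> \<psi> -` N \<inter> U" using NV im inv(1) by auto
    show "\<psi> -` N \<inter> U \<subseteq> \<phi> ` N"
    proof
      fix y assume "y \<in> \<psi> -` N \<inter> U"
      then show "y \<in> \<phi> ` N" using inv(2)[of y] by (intro image_eqI[of _ _ "\<psi> y"]) auto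
    qed
  qed
  moreover have "continuous_on U \<psi>"
    using continuous_on_Pair[OF holo2_continuous_on[OF hol(3)] holo2_continuous_on[OF hol(4)]]
    by (simp add: o_def)
  ultimately have opn: "open (\<phi> ` N)"
    using continuous_on_open_vimage[OF UV(1), of \<psi>] by (auto simp: N_def)
  define L where "L = sqrt (L1\<^sup>2 + L2\<^sup>2)"
  have "L-lipschitz_on N (\<lambda>z. ((fst \<circ> \<phi>) z, (snd \<circ> \<phi>) z))"
    unfolding L_def
  proof (rule lipschitz_on_Pair)
    show "L1-lipschitz_on N (fst \<circ> \<phi>)"
      by (rule lipschitz_on_subset[OF r1(3)]) (use r subset_ball[of r r1 "(0,0)"] in \<open>auto simp: N_def\<close>)
    show "L2-lipschitz_on N (snd \<circ> \<phi>)"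
      by (rule lipschitz_on_subset[OF r2(3)]) (use r subset_ball[of r r2 "(0,0)"] in \<open>auto simp: N_def\<close>)
  qed
  then have lip: "L-lipschitz_on N \<phi>" by simp
  define C where "C = ennreal ((2 * L * real DIM(complex \<times> complex)) ^ DIM(complex \<times> complex))"
  have "(\<integral>\<^sup>+y\<in>\<phi> ` N. wt q (F y) \<partial>lborel) \<le> C * (\<integral>\<^sup>+x\<in>N. wt q (F (\<phi> x)) \<partial>lborel)"
    unfolding C_def
    by (rule nn_integral_lipschitz_image_le[OF lip]) (use opn in \<open>auto simp: N_def\<close>)
  also have "\<dots> \<le> C * (\<integral>\<^sup>+x. wt q (of_real c) * (wt q (g x) * indicator N x) \<partial>lborel)"
  proof (intro mult_left_mono nn_integral_mono)
    fix x
    show "wt q (F (\<phi> x)) * indicator N x \<le> wt q (of_real c) * (wt q (g x) * indicator N x)"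
    proof (cases "x \<in> N")
      case True
      then have "x \<in> V" "c \<le> norm (u x)" using NV uc r subset_ball[of r r3 "(0,0)"] by (auto simp: N_def)
      then have "wt q (F (\<phi> x)) \<le> wt q (of_real c) * wt q (g x)"
        using q c unfolding eq[OF \<open>x \<in> V\<close>] wt_mult by (intro mult_right_mono wt_antimono) auto
      then show ?thesis using True by simp
    qed simp
  qed simp
  also have "\<dots> = C * (wt q (of_real c) * (\<integral>\<^sup>+x\<in>N. wt q (g x) \<partial>lborel))"
    by (subst nn_integral_cmult) auto
  also have "\<dots> < \<infinity>"
    using fin c wt_less_top[of "of_real c" q] by (auto simp: C_def N_def ennreal_mult_less_top)
  finally show ?thesis
    unfolding locint_def using opn \<phi>0 r(1) by (intro exI[of _ "\<phi> ` N"]) (auto simp: N_def intro!: image_eqI[of _ _ "(0,0)"])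
qed

text \<open>No implicit function is constructed. With the second variable fixed near 0, the slice s
  \<mapsto> F(s, t) is so close to its linear part that it is injective with inverse of Lipschitz
  constant 2 / |d|. The slice integral is therefore controlled by the integral of |\<tau>|^(-q) over
  a disc, uniformly in t.\<close>

lemma locint_submersion:
  fixes F :: "complex \<times> complex \<Rightarrow> complex"
  assumes deriv: "\<And>s t. ((\<lambda>s. F (s, t)) has_field_derivative Fs (s, t)) (at s)"
    and F: "continuous_on UNIV F" and Fs: "continuous_on UNIV Fs" and ne: "Fs (0, 0) \<noteq> 0"
    and q: "0 \<le> q" "q < 2"
  shows "locint q F (0, 0)"
proof -
  define d where "d = Fs (0, 0)"
  have "F \<in> borel_measurable borel" using F by (rule borel_measurable_continuous_onI)
  then have [measurable]: "F \<in> borel_measurable (borel \<Otimes>\<^sub>M borel)" by (simp add: borel_prod)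
  have "isCont Fs (0, 0)" using Fs by (simp add: continuous_on_eq_continuous_at)
  moreover have "norm d / 2 > 0" using ne by (simp add: d_def)
  ultimately obtain \<delta> where \<delta>: "\<delta> > 0" "\<And>z. dist z (0, 0) < \<delta> \<Longrightarrow> dist (Fs z) d < norm d / 2"
    unfolding continuous_at d_def by (metis LIM_def dist_self)
  define r where "r = \<delta> / 3"
  have r: "r > 0" using \<delta> by (simp add: r_def)
  have close: "norm (Fs (s, t) - d) \<le> norm d / 2" if "s \<in> cball 0 r" "t \<in> cball 0 r" for s t
  proof -
    have "norm (s, t) \<le> norm s + norm t" by (rule norm_Pair_le)
    then have "dist (s, t) (0, 0) < \<delta>" using that \<delta>(1) by (simp add: dist_norm r_def)
    then show ?thesis using \<delta>(2)[of "(s, t)"] by (simp add: dist_norm)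
  qed
  \<comment> \<open>F(s, t) - d s has derivative at most |d| / 2 in s, so it can undo at most half
    of the expansion by d.\<close>
  have inj: "norm d / 2 * norm (s - s') \<le> norm (F (s, t) - F (s', t))"
    if t: "t \<in> cball 0 r" and s: "s \<in> cball 0 r" "s' \<in> cball 0 r" for s s' t
  proof -
    have "norm ((F (s, t) - d * s) - (F (s', t) - d * s')) \<le> norm d / 2 * norm (s - s')"
    proof (rule field_differentiable_bound[of "cball 0 r" "\<lambda>s. F (s, t) - d * s" "\<lambda>s. Fs (s, t) - d"])
      fix z :: complex assume "z \<in> cball 0 r"
      then show "norm (Fs (z, t) - d) \<le> norm d / 2" using close t by blast
      show "((\<lambda>s. F (s, t) - d * s) has_field_derivative Fs (z, t) - d) (at z within cball 0 r)"
        by (auto intro!: derivative_eq_intros has_field_derivative_at_within[OF deriv])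
    qed (use s in auto)
    moreover have "norm (d * (s - s')) \<le> norm (F (s, t) - F (s', t)) +
        norm ((F (s, t) - d * s) - (F (s', t) - d * s'))"
    proof -
      have "d * (s - s') = (F (s, t) - F (s', t)) - ((F (s, t) - d * s) - (F (s', t) - d * s'))"
        by (simp add: algebra_simps)
      then show ?thesis using norm_triangle_ineq4 by metis
    qed
    ultimately show ?thesis by (simp add: norm_mult)
  qed
  have "compact (F ` (cball 0 r \<times> cball 0 r))"
    by (intro compact_continuous_image continuous_on_subset[OF F] compact_Times) auto
  then obtain R where R: "\<And>z. z \<in> cball 0 r \<times> cball 0 r \<Longrightarrow> norm (F z) \<le> R"
    using compact_imp_bounded bounded_iff by (metis imageI)
  define L where "L = 2 / norm d"
  define C where "C = ennreal ((2 * L * real DIM(complex)) ^ DIM(complex))"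
  define J where "J = (\<integral>\<^sup>+t\<in>cball 0 R. wt q t \<partial>lborel)"
  have J: "J < \<infinity>" unfolding J_def by (rule wt_disc[OF q])
  have inner: "(\<integral>\<^sup>+s\<in>cball 0 r. wt q (F (s, t)) \<partial>lborel) \<le> C * J" if t: "t \<in> cball 0 r" for t
  proof -
    define h where "h s = F (s, t)" for s
    define T where "T = h ` cball 0 r"
    define \<Phi> where "\<Phi> = inv_into (cball 0 r) h"
    have cont: "continuous_on UNIV h"
      unfolding h_def by (intro continuous_on_compose2[OF F]) (auto intro!: continuous_intros)
    have injh: "inj_on h (cball 0 r)"
    proof (rule inj_onI)
      fix s s' assume "s \<in> cball 0 r" "s' \<in> cball 0 r" "h s = h s'"
      then have "norm d / 2 * norm (s - s') \<le> 0" using inj[OF t, of s s'] by (simp add: h_def)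
      then show "s = s'" using ne by (auto simp: d_def mult_le_0_iff)
    qed
    have cT: "compact T" unfolding T_def by (intro compact_continuous_image continuous_on_subset[OF cont]) auto
    have imT: "\<Phi> ` T = cball 0 r" unfolding \<Phi>_def T_def by (rule inv_into_image_cancel[OF injh]) simp
    have h\<Phi>: "h (\<Phi> \<tau>) = \<tau>" "\<Phi> \<tau> \<in> cball 0 r" if "\<tau> \<in> T" for \<tau>
      using that f_inv_into_f[of \<tau> h "cball 0 r"] inv_into_into[of \<tau> h "cball 0 r"]
      unfolding \<Phi>_def T_def by blast+
    have lip: "L-lipschitz_on T \<Phi>"
    proof (rule lipschitz_onI)
      fix x y assume "x \<in> T" "y \<in> T"
      then have "norm d / 2 * norm (\<Phi> x - \<Phi> y) \<le> norm (x - y)"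
        using inj[OF t, of "\<Phi> x" "\<Phi> y"] h\<Phi>[of x] h\<Phi>[of y] by (simp add: h_def)
      then show "dist (\<Phi> x) (\<Phi> y) \<le> L * dist x y"
        using ne by (simp add: L_def dist_norm field_simps d_def)
    qed (simp add: L_def)
    have [measurable]: "h \<in> borel_measurable borel" using cont by (rule borel_measurable_continuous_onI)
    have "(\<integral>\<^sup>+s\<in>\<Phi> ` T. wt q (h s) \<partial>lborel) \<le> C * (\<integral>\<^sup>+\<tau>\<in>T. wt q (h (\<Phi> \<tau>)) \<partial>lborel)"
      unfolding C_def
      by (rule nn_integral_lipschitz_image_le[OF lip])
         (use cT imT in \<open>auto simp: compact_imp_bounded borel_compact\<close>)
    also have "\<dots> \<le> C * J"
      unfolding J_def
    proof (intro mult_left_mono nn_integral_mono)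
      fix \<tau>
      show "wt q (h (\<Phi> \<tau>)) * indicator T \<tau> \<le> wt q \<tau> * indicator (cball 0 R) \<tau>"
      proof (cases "\<tau> \<in> T")
        case True
        then obtain s where s: "s \<in> cball 0 r" "\<tau> = F (s, t)" by (auto simp: T_def h_def)
        then have "norm \<tau> \<le> R" using R[of "(s, t)"] t by auto
        then show ?thesis using h\<Phi>(1)[OF True] True by simp
      qed simp
    qed simp
    finally show ?thesis by (simp add: imT h_def)
  qed
  have "(\<integral>\<^sup>+z\<in>ball (0,0) r. wt q (F z) \<partial>lborel)
      \<le> (\<integral>\<^sup>+z. wt q (F z) * (indicator (cball 0 r) (fst z) * indicator (cball 0 r) (snd z)) \<partial>(lborel \<Otimes>\<^sub>M lborel))"
    unfolding lborel_prod
  proof (rule nn_integral_mono)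
    fix z :: "complex \<times> complex"
    show "wt q (F z) * indicator (ball (0,0) r) z
      \<le> wt q (F z) * (indicator (cball 0 r) (fst z) * indicator (cball 0 r) (snd z))"
    proof (cases "z \<in> ball (0,0) r")
      case True
      then have "norm z < r" by (simp add: zero_prod_def[symmetric])
      then have "norm (fst z) \<le> r" "norm (snd z) \<le> r"
        using norm_fst_le[of "fst z" "snd z"] norm_snd_le[of "snd z" "fst z"] by auto
      then show ?thesis using True by simp
    qed simp
  qed
  also have "\<dots> = (\<integral>\<^sup>+t. (\<integral>\<^sup>+s. wt q (F (s, t)) * (indicator (cball 0 r) s * indicator (cball 0 r) t) \<partial>lborel) \<partial>lborel)"
    by (subst lborel_pair.nn_integral_snd[symmetric]) auto
  also have "\<dots> \<le> (\<integral>\<^sup>+t. (C * J) * indicator (cball (0::complex) r) t \<partial>lborel)"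
  proof (rule nn_integral_mono)
    fix t :: complex
    show "(\<integral>\<^sup>+s. wt q (F (s, t)) * (indicator (cball 0 r) s * indicator (cball 0 r) t) \<partial>lborel)
        \<le> (C * J) * indicator (cball 0 r) t"
    proof (cases "t \<in> cball 0 r")
      case True
      then show ?thesis using inner[OF True] by simp
    qed simp
  qed
  also have "\<dots> = (C * J) * emeasure lborel (cball (0::complex) r)"
    by (rule nn_integral_cmult_indicator) simp
  also have "\<dots> < \<infinity>" using J emeasure_lborel_cball_finite[of "0::complex" r]
    by (auto simp: C_def ennreal_mult_less_top)
  finally show ?thesis unfolding locint_def using r by (intro exI[of _ "ball (0,0) r"]) auto
qed

text \<open>The cone over an affine chart is parametrized by \<open>\<Phi>\<close>, whose first
  coordinate is the dilation factor. By homogeneity f pulls back to that factor to the power m times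
  the function in the chart, and near 1 the power affects the weight by a bounded factor
  only.\<close>

lemma locint_chart:
  assumes det: "det3 p v w \<noteq> 0" and f: "continuous_on UNIV f"
    and hom: "\<And>\<mu> x. f (scl \<mu> x) = \<mu> ^ m * f x" and q: "q \<ge> 0"
    and loc: "locint q (\<lambda>st. f (chart p v w st)) (0, 0)"
  shows "locint q f p"
proof -
  define F where "F st = f (chart p v w st)" for st
  define \<Delta> where "\<Delta> = det3 p v w"
  \<comment> \<open>\<open>A\<close>, \<open>B\<close>, \<open>C\<close> are the coordinates with
    respect to the basis p, v, w, by Cramer's rule.\<close>
  define A where "A y = det3 y v w / \<Delta>" for y
  define B where "B y = det3 p y w / \<Delta>" for y
  define C where "C y = det3 p v y / \<Delta>" for y
  define \<Phi> where "\<Phi> x = scl (px x) (chart p v w (py x, pz x))" for x :: pt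
  have \<Delta>: "\<Delta> \<noteq> 0" using det by (simp add: \<Delta>_def)
  obtain r where r: "r > 0" "(\<integral>\<^sup>+x\<in>ball (0,0) r. wt q (F x) \<partial>lborel) < \<infinity>"
    using locint_small[OF loc, of 1] by (auto simp: F_def)
  define N where "N = ball ((0::complex), (0::complex)) r"
  \<comment> \<open>Dilation factors within 1/2 of 1 have absolute value at least 1/2, which bounds
    the weight of their m-th power.\<close>
  define I where "I = ball (1::complex) (1/2)"
  define V where "V = I \<times> N"
  have [measurable]: "N \<in> sets borel" "I \<in> sets borel" by (auto simp: N_def I_def)
  have Vopen: "open V" unfolding V_def N_def I_def by (intro open_Times) auto
  have [measurable]: "f \<in> borel_measurable borel" using f by (rule borel_measurable_continuous_onI)
  have contF: "continuous_on UNIV F"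
    unfolding F_def chart_def
    by (intro continuous_on_compose2[OF f]) (auto intro!: continuous_intros)
  then have [measurable]: "F \<in> borel_measurable borel" by (rule borel_measurable_continuous_onI)
  have fst\<Phi>: "px (\<Phi> x) = px x * (px p + py x * px v + pz x * px w)"
    "py (\<Phi> x) = px x * (py p + py x * py v + pz x * py w)"
    "pz (\<Phi> x) = px x * (pz p + py x * pz v + pz x * pz w)" for x
    by (simp_all add: \<Phi>_def scl_def chart_def)
  have "det3 (\<Phi> x) v w = px x * \<Delta>" for x
    unfolding \<Delta>_def det3_def fst\<Phi> by algebra
  then have A\<Phi>: "A (\<Phi> x) = px x" for x using \<Delta> by (simp add: A_def)
  have "det3 p (\<Phi> x) w = px x * py x * \<Delta>" for x
    unfolding \<Delta>_def det3_def fst\<Phi> by algebra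
  then have B\<Phi>: "B (\<Phi> x) = px x * py x" for x using \<Delta> by (simp add: B_def)
  have "det3 p v (\<Phi> x) = px x * pz x * \<Delta>" for x
    unfolding \<Delta>_def det3_def fst\<Phi> by algebra
  then have C\<Phi>: "C (\<Phi> x) = px x * pz x" for x using \<Delta> by (simp add: C_def)
  have cramer: "A y * px p + B y * px v + C y * px w = px y"
    "A y * py p + B y * py v + C y * py w = py y"
    "A y * pz p + B y * pz v + C y * pz w = pz y" for y
  proof -
    have "det3 y v w * px p + det3 p y w * px v + det3 p v y * px w = \<Delta> * px y"
      "det3 y v w * py p + det3 p y w * py v + det3 p v y * py w = \<Delta> * py y"
      "det3 y v w * pz p + det3 p y w * pz v + det3 p v y * pz w = \<Delta> * pz y"
      unfolding \<Delta>_def det3_def by algebra+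
    then show "A y * px p + B y * px v + C y * px w = px y"
      "A y * py p + B y * py v + C y * py w = py y"
      "A y * pz p + B y * pz v + C y * pz w = pz y"
      using \<Delta> by (simp_all add: A_def B_def C_def add_divide_distrib[symmetric])
  qed
  have I0: "a \<noteq> 0" "norm a \<ge> 1/2" if "a \<in> I" for a
  proof -
    have "norm (1 - a) < 1/2" using that by (simp add: I_def dist_norm)
    then show "norm a \<ge> 1/2" using norm_triangle_ineq2[of 1 a] by simp
    then show "a \<noteq> 0" by auto
  qed
  \<comment> \<open>\<open>A\<close> together with \<open>G\<close> inverts \<open>\<Phi>\<close>;
    being continuous where \<open>A\<close> lies in \<open>I\<close>, they exhibit the image of
    \<open>V\<close> as an open set.\<close>
  define G where "G y = (B y / A y, C y / A y)" for y
  have U: "\<Phi> ` V = G -` N \<inter> {y. A y \<in> I}"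
  proof
    show "\<Phi> ` V \<subseteq> G -` N \<inter> {y. A y \<in> I}"
    proof (rule image_subsetI)
      fix x assume x: "x \<in> V"
      then have xI: "px x \<in> I" "(py x, pz x) \<in> N" by (auto simp: V_def px_def py_def pz_def)
      then show "\<Phi> x \<in> G -` N \<inter> {y. A y \<in> I}" using I0 by (simp add: G_def A\<Phi> B\<Phi> C\<Phi>)
    qed
    show "G -` N \<inter> {y. A y \<in> I} \<subseteq> \<Phi> ` V"
    proof
      fix y assume "y \<in> G -` N \<inter> {y. A y \<in> I}"
      then have y: "G y \<in> N" "A y \<in> I" by auto
      have "A y \<noteq> 0" using y I0 by blast
      then have "\<Phi> (A y, G y) = (A y * px p + B y * px v + C y * px w,
          A y * py p + B y * py v + C y * py w, A y * pz p + B y * pz v + C y * pz w)"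
        by (simp add: \<Phi>_def scl_def chart_def G_def algebra_simps)
      then have "\<Phi> (A y, G y) = y" unfolding cramer by (simp add: pt_eta)
      moreover have "(A y, G y) \<in> V" using y by (simp add: V_def)
      ultimately show "y \<in> \<Phi> ` V" by (metis imageI)
    qed
  qed
  have cont: "continuous_on UNIV A" "continuous_on UNIV B" "continuous_on UNIV C"
    unfolding A_def B_def C_def det3_def using \<Delta> by (auto intro!: continuous_intros)
  have oI: "open {y. A y \<in> I}"
    using open_vimage[OF _ cont(1), of I] by (simp add: I_def vimage_def)
  have "continuous_on {y. A y \<in> I} G"
    unfolding G_def using I0 cont
    by (intro continuous_intros) (auto intro: continuous_on_subset)
  then have opn: "open (\<Phi> ` V)"
    unfolding U using continuous_on_open_vimage[OF oI, of G] by (auto simp: N_def)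
  have "loclip \<Phi>"
    unfolding \<Phi>_def scl_def chart_def
    by (simp, intro loclip_Pair loclip_mult loclip_add loclip_pt loclip_const)
  have bV: "bounded V" unfolding V_def I_def N_def by (intro bounded_Times) auto
  then obtain R where "V \<subseteq> cball 0 R" by (auto simp: bounded_iff subset_iff)
  then obtain L where lip: "L-lipschitz_on V \<Phi>"
    using \<open>loclip \<Phi>\<close> lipschitz_on_subset unfolding loclip_def by metis
  define K where "K = ennreal ((2 * L * real DIM(pt)) ^ DIM(pt))"
  define k where "k = wt q ((1/2) ^ m)"
  have "(\<integral>\<^sup>+y\<in>\<Phi> ` V. wt q (f y) \<partial>lborel) \<le> K * (\<integral>\<^sup>+x\<in>V. wt q (f (\<Phi> x)) \<partial>lborel)"
    unfolding K_def
    by (rule nn_integral_lipschitz_image_le[OF lip]) (use opn Vopen bV in auto)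
  also have "\<dots> \<le> K * (\<integral>\<^sup>+x. k * (indicator I (fst x) * (wt q (F (snd x)) * indicator N (snd x))) \<partial>(lborel \<Otimes>\<^sub>M lborel))"
    unfolding lborel_prod
  proof (intro mult_left_mono nn_integral_mono)
    fix x :: pt
    show "wt q (f (\<Phi> x)) * indicator V x
        \<le> k * (indicator I (fst x) * (wt q (F (snd x)) * indicator N (snd x)))"
    proof (cases "x \<in> V")
      case True
      then have xI: "fst x \<in> I" "snd x \<in> N" by (auto simp: V_def)
      have "f (\<Phi> x) = fst x ^ m * F (snd x)"
        by (simp add: \<Phi>_def hom F_def px_def py_def pz_def)
      moreover have "wt q (fst x ^ m) \<le> k"
        unfolding k_def using q I0(2)[OF xI(1)] by (intro wt_antimono) (auto simp: norm_power power_mono norm_divide)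
      ultimately have "wt q (f (\<Phi> x)) \<le> k * wt q (F (snd x))"
        by (simp add: wt_mult mult_right_mono)
      then show ?thesis using True xI by simp
    qed simp
  qed simp
  also have "\<dots> = K * (\<integral>\<^sup>+z. (\<integral>\<^sup>+a. k * (indicator I a * (wt q (F z) * indicator N z)) \<partial>lborel) \<partial>lborel)"
    by (subst lborel_pair.nn_integral_snd[symmetric]) auto
  also have "\<dots> = K * (\<integral>\<^sup>+z. (k * emeasure lborel I) * (wt q (F z) * indicator N z) \<partial>lborel)"
    by (subst nn_integral_cmult, simp, subst nn_integral_multc) (auto simp: mult_ac)
  also have "\<dots> = K * ((k * emeasure lborel I) * (\<integral>\<^sup>+z\<in>N. wt q (F z) \<partial>lborel))"
    by (subst nn_integral_cmult) auto
  also have "\<dots> < \<infinity>"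
    using r(2) wt_less_top[of "(1/2) ^ m" q] emeasure_lborel_ball_finite[of "1::complex" "1/2"]
    by (auto simp: K_def k_def I_def N_def ennreal_mult_less_top)
  finally have fin: "(\<integral>\<^sup>+y\<in>\<Phi> ` V. wt q (f y) \<partial>lborel) < \<infinity>" .
  have "\<Phi> (1, 0, 0) = p" by (simp add: \<Phi>_def scl_def chart_def pt_eta)
  moreover have "(1, 0, 0) \<in> V" using r by (auto simp: V_def I_def N_def)
  ultimately have "p \<in> \<Phi> ` V" by (metis imageI)
  then show ?thesis unfolding locint_def using fin opn by blast
qed

lemma locint_nonzero:
  assumes f: "continuous_on UNIV f" and p: "f p \<noteq> 0" and q: "q \<ge> 0"
  shows "locint q f p"
proof -
  define c where "c = norm (f p) / 2"
  have c: "c > 0" using p by (simp add: c_def)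
  have "isCont f p" using f by (simp add: continuous_on_eq_continuous_at)
  then obtain r where r: "r > 0" "\<And>z. dist z p < r \<Longrightarrow> dist (f z) (f p) < c"
    using c unfolding continuous_at_eps_delta by blast
  have fc: "c \<le> norm (f z)" if "z \<in> ball p r" for z
  proof -
    have "norm (f p - f z) < c" using r(2)[of z] that by (simp add: dist_commute dist_norm[symmetric])
    then show ?thesis using norm_triangle_ineq2[of "f p" "f z"] by (simp add: c_def)
  qed
  have "(\<integral>\<^sup>+y\<in>ball p r. wt q (f y) \<partial>lborel) \<le> (\<integral>\<^sup>+y. wt q (of_real c) * indicator (ball p r) y \<partial>lborel)"
  proof (rule nn_integral_mono)
    fix y
    show "wt q (f y) * indicator (ball p r) y \<le> wt q (of_real c) * indicator (ball p r) y"
      using fc[of y] q c by (cases "y \<in> ball p r") (auto intro!: wt_antimono)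
  qed
  also have "\<dots> = wt q (of_real c) * emeasure lborel (ball p r)"
    by (rule nn_integral_cmult_indicator) simp
  also have "\<dots> < \<infinity>"
    using wt_less_top[of "of_real c" q] c emeasure_lborel_ball_finite[of p r] by (auto simp: ennreal_mult_less_top)
  finally show ?thesis unfolding locint_def using r(1) by (intro exI[of _ "ball p r"]) auto
qed

text \<open>The chart directions are chosen by conjugation: v is the conjugate gradient, along which
  f has derivative |grad f|^2, and w is the conjugate of the cross product of p and v, so the
  determinant is the squared length of that product. It is nonzero because Euler's formula makes p,
  unlike v, tangent to the cone.\<close>

lemma locint_smooth_point:
  assumes f: "hol3 f" and hom: "\<And>\<mu> x. f (scl \<mu> x) = \<mu> ^ m * f x" and q: "0 \<le> q" "q < 2"
    and p: "p \<noteq> 0" "f p = 0" and ne: "dX f p \<noteq> 0 \<or> dY f p \<noteq> 0 \<or> dZ f p \<noteq> 0"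
  shows "locint q f p"
proof -
  define a b c where "a = dX f p" and "b = dY f p" and "c = dZ f p"
  define v :: pt where "v = (cnj a, cnj b, cnj c)"
  have v: "lin3 a b c v \<noteq> 0"
  proof
    assume "lin3 a b c v = 0"
    then have "of_real ((norm a)\<^sup>2 + (norm b)\<^sup>2 + (norm c)\<^sup>2) = (0::complex)"
      by (simp add: lin3_def v_def complex_norm_square del: of_real_power)
    then have "(norm a)\<^sup>2 + (norm b)\<^sup>2 + (norm c)\<^sup>2 = 0" using of_real_eq_0_iff by blast
    then show False using ne by (auto simp: a_def b_def c_def add_nonneg_eq_0_iff)
  qed
  have p0: "lin3 a b c p = 0"
    using euler[OF f hom, of p] p(2) by (simp add: lin3_def a_def b_def c_def mult.commute)
  define c1 c2 c3 where "c1 = py p * pz v - pz p * py v" and "c2 = pz p * px v - px p * pz v"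
    and "c3 = px p * py v - py p * px v"
  define w :: pt where "w = (cnj c1, cnj c2, cnj c3)"
  have det: "det3 p v w \<noteq> 0"
  proof
    assume "det3 p v w = 0"
    moreover have "det3 p v w = c1 * cnj c1 + c2 * cnj c2 + c3 * cnj c3"
      by (simp add: det3_def w_def c1_def c2_def c3_def algebra_simps)
    ultimately have "of_real ((norm c1)\<^sup>2 + (norm c2)\<^sup>2 + (norm c3)\<^sup>2) = (0::complex)"
      by (simp add: complex_norm_square del: of_real_power)
    then have "(norm c1)\<^sup>2 + (norm c2)\<^sup>2 + (norm c3)\<^sup>2 = 0" using of_real_eq_0_iff by blast
    then have 0: "c1 = 0" "c2 = 0" "c3 = 0" by (auto simp: add_nonneg_eq_0_iff)
    \<comment> \<open>The expansion of the triple product grad f \<times> (p \<times> v), in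
      coordinates.\<close>
    have "px p * lin3 a b c v = px v * lin3 a b c p + b * c3 - c * c2"
      "py p * lin3 a b c v = py v * lin3 a b c p + c * c1 - a * c3"
      "pz p * lin3 a b c v = pz v * lin3 a b c p + a * c2 - b * c1"
      by (simp_all add: lin3_def c1_def c2_def c3_def algebra_simps)
    then have "px p = 0" "py p = 0" "pz p = 0" using v p0 0 by auto
    then have "p = 0" using pt_eta[of p] by (metis zero_prod_def)
    then show False using p(1) by simp
  qed
  define Fs where "Fs st = lin3 (dX f (chart p v w st)) (dY f (chart p v w st)) (dZ f (chart p v w st)) v" for st
  have cc: "continuous_on UNIV (chart p v w)"
    unfolding chart_def[abs_def] by (intro continuous_intros)
  have "locint q (\<lambda>st. f (chart p v w st)) (0, 0)"
  proof (rule locint_submersion[where Fs = Fs])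
    fix s t
    have ch: "((\<lambda>s. chart p v w (s, t)) has_derivative (\<lambda>h. scl h v)) (at s)"
      unfolding chart_def scl_def by (auto intro!: derivative_eq_intros simp: mult.commute)
    have "((\<lambda>s. f (chart p v w (s, t))) has_derivative
       (\<lambda>h. lin3 (dX f (chart p v w (s, t))) (dY f (chart p v w (s, t))) (dZ f (chart p v w (s, t))) (scl h v))) (at s)"
      by (rule has_derivative_compose[OF ch hol3D(2)[OF f]])
    then show "((\<lambda>s. f (chart p v w (s, t))) has_field_derivative Fs (s, t)) (at s)"
      unfolding has_field_derivative_def
      by (rule has_derivative_eq_rhs) (auto simp: Fs_def lin3_def scl_def algebra_simps)
  next
    show "continuous_on UNIV (\<lambda>st. f (chart p v w st))"
      by (rule continuous_on_compose2[OF hol3D(3)[OF f] cc]) auto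
    show "continuous_on UNIV Fs"
      unfolding Fs_def lin3_def
      by (intro continuous_intros continuous_on_compose2[OF hol3D(4)[OF f] cc]
        continuous_on_compose2[OF hol3D(5)[OF f] cc] continuous_on_compose2[OF hol3D(6)[OF f] cc]) auto
    have "chart p v w (0, 0) = p" by (simp add: chart_def pt_eta)
    then show "Fs (0, 0) \<noteq> 0" using v by (simp add: Fs_def a_def b_def c_def)
  qed (use q in auto)
  then show ?thesis by (rule locint_chart[OF det hol3D(3)[OF f] hom q(1)])
qed

lemma locint_sing_type:
  assumes f: "hol3 f" and hom: "\<And>\<mu> x. f (scl \<mu> x) = \<mu> ^ m * f x" and s: "0 \<le> s" "s < 2 / 3"
    and "sing_type f p nf_A1 \<or> sing_type f p nf_A5 \<or> sing_type f p nf_D4"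
  shows "locint (2 * s) f p"
proof -
  have cg: "continuous_on UNIV nf_A1" "continuous_on UNIV nf_A5" "continuous_on UNIV nf_D4"
    unfolding nf_A1_def[abs_def] nf_A5_def[abs_def] nf_D4_def[abs_def] by (intro continuous_intros)+
  obtain g where g: "sing_type f p g" "continuous_on UNIV g" "locint (2 * s) g (0, 0)"
    using assms(5) cg locint_nf_A1[OF s] locint_nf_A5[OF s] locint_nf_D4[OF s] by blast
  then obtain v w where vw: "det3 p v w \<noteq> 0" "contact_equiv (\<lambda>st. f (chart p v w st)) g"
    by (auto simp: sing_type_def)
  have cc: "continuous_on UNIV (chart p v w)"
    unfolding chart_def[abs_def] by (intro continuous_intros)
  have "locint (2 * s) (\<lambda>st. f (chart p v w st)) (0, 0)"
  proof (rule locint_contact_equiv[OF vw(2)])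
    show "continuous_on UNIV (\<lambda>st. f (chart p v w st))"
      by (rule continuous_on_compose2[OF hol3D(3)[OF f] cc]) auto
  qed (use g s in auto)
  then show ?thesis using s by (intro locint_chart[OF vw(1) hol3D(3)[OF f] hom]) auto
qed

text \<open>The list of admissible singularities is turned into integrability here; off the curve
  and at its smooth points the exponent 2 s < 2 is harmless.\<close>

lemma locint_away_from_origin:
  assumes f: "hol3 f" and hom: "\<And>\<mu> x. f (scl \<mu> x) = \<mu> ^ m * f x" and s: "0 \<le> s" "s < 2 / 3"
    and sing: "\<And>p. sing_point f p \<Longrightarrow>
           sing_type f p nf_A1 \<or> sing_type f p nf_A5 \<or> sing_type f p nf_D4"
    and p: "p \<noteq> 0"
  shows "locint (2 * s) f p"
proof -
  consider "f p \<noteq> 0" | "sing_point f p" | "f p = 0" "dX f p \<noteq> 0 \<or> dY f p \<noteq> 0 \<or> dZ f p \<noteq> 0"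
    using p by (auto simp: sing_point_def)
  then show ?thesis
  proof cases
    case 1
    then show ?thesis using s by (intro locint_nonzero hol3D(3)[OF f]) auto
  next
    case 2
    then show ?thesis using locint_sing_type[OF f hom s] sing by blast
  next
    case 3
    then show ?thesis using s p by (intro locint_smooth_point[OF f hom]) auto
  qed
qed

text \<open>A compact region avoiding the vertex of the cone. All radial cutoffs below vanish
  outside it.\<close>

definition shell :: "pt set" where "shell = cball 0 2 - ball 0 (1/2)"

lemma shell_measurable [measurable]: "shell \<in> sets borel"
  by (simp add: shell_def)

lemma shell_integral_finite:
  assumes f: "continuous_on UNIV f" and loc: "\<And>p. p \<noteq> 0 \<Longrightarrow> locint q f p"
  shows "(\<integral>\<^sup>+x\<in>shell. wt q (f x) \<partial>lborel) < \<infinity>"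
proof -
  have [measurable]: "f \<in> borel_measurable borel" using f by (rule borel_measurable_continuous_onI)
  have "\<forall>p. \<exists>U. p \<noteq> 0 \<longrightarrow> open U \<and> p \<in> U \<and> (\<integral>\<^sup>+x\<in>U. wt q (f x) \<partial>lborel) < \<infinity>"
    using loc unfolding locint_def by blast
  then obtain U where U: "\<And>p. p \<noteq> 0 \<Longrightarrow> open (U p)" "\<And>p. p \<noteq> 0 \<Longrightarrow> p \<in> U p"
    "\<And>p. p \<noteq> 0 \<Longrightarrow> (\<integral>\<^sup>+x\<in>U p. wt q (f x) \<partial>lborel) < \<infinity>"
    by metis
  have n0: "p \<noteq> 0" if "p \<in> shell" for p using that by (auto simp: shell_def)
  have "compact shell" unfolding shell_def by (intro compact_diff) auto
  moreover have "\<And>p. p \<in> shell \<Longrightarrow> open (U p)" using U(1) n0 by blast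
  moreover have "shell \<subseteq> (\<Union>p\<in>shell. U p)" using U(2) n0 by blast
  ultimately obtain T where T: "T \<subseteq> shell" "finite T" "shell \<subseteq> (\<Union>p\<in>T. U p)"
    by (rule compactE_image)
  have [measurable]: "U p \<in> sets borel" if "p \<in> T" for p
    by (rule borel_open, rule U(1), rule n0, rule subsetD[OF T(1) that])
  have "(\<integral>\<^sup>+x\<in>shell. wt q (f x) \<partial>lborel) \<le> (\<integral>\<^sup>+x. (\<Sum>p\<in>T. wt q (f x) * indicator (U p) x) \<partial>lborel)"
  proof (rule nn_integral_mono)
    fix x
    show "wt q (f x) * indicator shell x \<le> (\<Sum>p\<in>T. wt q (f x) * indicator (U p) x)"
    proof (cases "x \<in> shell")
      case True
      then obtain p where p: "p \<in> T" "x \<in> U p" using T(3) by blast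
      have "wt q (f x) * indicator (U p) x \<le> (\<Sum>p\<in>T. wt q (f x) * indicator (U p) x)"
        by (rule member_le_sum[OF p(1)]) (use T in auto)
      then show ?thesis using True p by simp
    qed simp
  qed
  also have "\<dots> = (\<Sum>p\<in>T. (\<integral>\<^sup>+x\<in>U p. wt q (f x) \<partial>lborel))"
    by (rule nn_integral_sum) auto
  also have "\<dots> < \<infinity>"
  proof -
    have "(\<integral>\<^sup>+x\<in>U p. wt q (f x) \<partial>lborel) < top" if "p \<in> T" for p
      using U(3)[OF n0[OF subsetD[OF T(1) that]]] by simp
    then show ?thesis using T(2) by simp
  qed
  finally show ?thesis .
qed

subsection \<open>Integration by parts\<close>

lemma integrable_continuous_bounded_support:
  fixes F :: "'a::euclidean_space \<Rightarrow> 'b::{banach, second_countable_topology}"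
  assumes F: "continuous_on UNIV F" and supp: "\<And>v. norm v \<ge> R \<Longrightarrow> F v = 0"
  shows "integrable lborel F"
proof -
  have "integrable lborel (\<lambda>v. indicator (cball 0 R) v *\<^sub>R F v)"
    by (rule borel_integrable_compact) (auto intro: continuous_on_subset[OF F])
  also have "(\<lambda>v. indicator (cball 0 R) v *\<^sub>R F v) = F"
    by (rule ext) (auto simp: indicator_def supp)
  finally show ?thesis .
qed

lemma directional_difference_quotient:
  fixes F :: "'a::real_normed_vector \<Rightarrow> 'b::real_normed_vector"
  assumes D: "(F has_derivative D) (at v)"
  shows "(\<lambda>n. real (Suc n) *\<^sub>R (F (v + (1 / real (Suc n)) *\<^sub>R e) - F v)) \<longlonglongrightarrow> D e"
proof (cases "e = 0")
  case True
  then show ?thesis using linear_0[OF has_derivative_linear[OF D]] by simp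
next
  case False
  define h where "h n = (1 / real (Suc n)) *\<^sub>R e" for n
  have "(\<lambda>n. 1 / real (Suc n)) \<longlonglongrightarrow> 0" by (rule LIMSEQ_Suc[OF lim_1_over_n])
  then have "h \<longlonglongrightarrow> 0 *\<^sub>R e" unfolding h_def by (intro tendsto_intros)
  then have "filterlim h (at 0) sequentially"
    using False by (auto simp: filterlim_at h_def)
  moreover have "((\<lambda>k. norm (F (v + k) - F v - D k) / norm k) \<longlongrightarrow> 0) (at 0)"
    using D by (simp add: has_derivative_at)
  ultimately have "(\<lambda>n. norm (F (v + h n) - F v - D (h n)) / norm (h n)) \<longlonglongrightarrow> 0"
    by (rule filterlim_compose[rotated])
  then have "(\<lambda>n. norm e * (norm (F (v + h n) - F v - D (h n)) / norm (h n))) \<longlonglongrightarrow> norm e * 0"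
    by (intro tendsto_intros)
  moreover have "norm e * (norm (F (v + h n) - F v - D (h n)) / norm (h n)) =
      norm (real (Suc n) *\<^sub>R (F (v + h n) - F v) - D e)" for n
  proof -
    have "D (h n) = (1 / real (Suc n)) *\<^sub>R D e"
      unfolding h_def by (rule linear_scale[OF has_derivative_linear[OF D]])
    then have "real (Suc n) *\<^sub>R (F (v + h n) - F v) - D e = real (Suc n) *\<^sub>R (F (v + h n) - F v - D (h n))"
      by (simp add: algebra_simps)
    moreover have "norm (h n) = norm e / real (Suc n)" by (simp add: h_def)
    ultimately show ?thesis using False by simp
  qed
  ultimately have "(\<lambda>n. norm (real (Suc n) *\<^sub>R (F (v + h n) - F v) - D e)) \<longlonglongrightarrow> 0" by simp
  then show ?thesis unfolding h_def using LIM_zero_iff tendsto_norm_zero_iff by blast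
qed

text \<open>Each difference quotient has integral 0 by translation invariance. The Lipschitz bound
  on a ball dominates all of them, so the limit has integral 0 as well.\<close>

lemma integral_directional_derivative_eq_0:
  fixes F :: "'a::euclidean_space \<Rightarrow> complex"
  assumes lip: "loclip F" and supp: "\<And>v. norm v \<ge> R \<Longrightarrow> F v = 0"
    and D: "\<And>v. (F has_derivative D v) (at v)"
  shows "integrable lborel (\<lambda>v. D v e)" and "(\<integral>v. D v e \<partial>lborel) = 0"
proof -
  define G where "G n v = real (Suc n) *\<^sub>R (F (v + (1 / real (Suc n)) *\<^sub>R e) - F v)" for n v
  have cont: "continuous_on UNIV F" by (rule loclip_continuous[OF lip])
  have [measurable]: "F \<in> borel_measurable borel" using cont by (rule borel_measurable_continuous_onI)
  \<comment> \<open>Beyond this radius both v and its translate by at most |e| lie outside the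
    support.\<close>
  define R' where "R' = \<bar>R\<bar> + norm e"
  obtain L where L: "L-lipschitz_on (cball 0 (R' + norm e)) F" using lip by (auto simp: loclip_def)
  have L0: "L \<ge> 0" by (rule lipschitz_on_nonneg[OF L])
  define w where "w v = indicator (cball (0::'a) R') v *\<^sub>R (L * norm e)" for v
  have w: "integrable lborel w"
    unfolding w_def by (rule borel_integrable_compact) auto
  have lim: "(\<lambda>n. G n v) \<longlonglongrightarrow> D v e" for v
    unfolding G_def by (rule directional_difference_quotient[OF D])
  have step: "norm ((1 / real (Suc n)) *\<^sub>R e) \<le> norm e" for n
    using mult_right_mono[of "1 / real (Suc n)" 1 "norm e"] by simp
  have bd: "norm (G n v) \<le> w v" for n v
  proof (cases "norm v \<le> R'")
    case True
    have "norm (F (v + (1 / real (Suc n)) *\<^sub>R e) - F v) \<le> L * norm ((v + (1 / real (Suc n)) *\<^sub>R e) - v)"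
      by (rule lipschitz_on_normD[OF L])
         (use True step[of n] norm_triangle_ineq[of v "(1 / real (Suc n)) *\<^sub>R e"] norm_ge_zero[of e]
          in \<open>auto simp del: norm_scaleR norm_ge_zero\<close>)
    then have "norm (G n v) \<le> real (Suc n) * (L * norm ((1 / real (Suc n)) *\<^sub>R e))"
      using mult_left_mono[of _ _ "real (Suc n)"] unfolding G_def
      by (simp only: norm_scaleR[of "real (Suc n)"] add_diff_cancel_left' abs_of_nat)
    also have "\<dots> = L * norm e" by simp
    finally show ?thesis using True by (simp add: w_def)
  next
    case False
    then have "norm v \<ge> R" "norm (v + (1 / real (Suc n)) *\<^sub>R e) \<ge> R"
      using step[of n] norm_triangle_ineq2[of v "- ((1 / real (Suc n)) *\<^sub>R e)"] norm_ge_zero[of e]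
      unfolding R'_def norm_minus_cancel by (auto simp del: norm_scaleR norm_ge_zero)
    then show ?thesis using False by (simp add: G_def supp w_def)
  qed
  have Gm [measurable]: "G n \<in> borel_measurable lborel" for n
    unfolding G_def by measurable
  have Dm: "(\<lambda>v. D v e) \<in> borel_measurable lborel"
    by (rule borel_measurable_LIMSEQ_metric[OF Gm lim])
  have zero: "(\<integral>v. G n v \<partial>lborel) = 0" for n
  proof -
    define c where "c = (1 / real (Suc n)) *\<^sub>R e"
    have i: "integrable lborel F" by (rule integrable_continuous_bounded_support[OF cont supp])
    have d: "distr lborel borel ((+) c) = lborel" by (rule lborel_distr_plus)
    have e1: "(\<integral>v. F (c + v) \<partial>lborel) = (\<integral>v. F v \<partial>lborel)"
      using integral_distr[of "(+) c" lborel borel F] by (simp add: d)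
    have i1: "integrable lborel (\<lambda>v. F (c + v))"
      using integrable_distr_eq[of "(+) c" lborel borel F] i by (simp add: d)
    have "(\<integral>v. F (c + v) - F v \<partial>lborel) = 0" using i i1 e1 by simp
    then show ?thesis unfolding G_def c_def by (simp add: add.commute)
  qed
  show "integrable lborel (\<lambda>v. D v e)"
    by (rule integrable_dominated_convergence[OF Dm Gm w]) (auto intro: lim bd)
  have "(\<lambda>n. \<integral>v. G n v \<partial>lborel) \<longlonglongrightarrow> (\<integral>v. D v e \<partial>lborel)"
    by (rule integral_dominated_convergence[OF Dm Gm w]) (auto intro: lim bd)
  then show "(\<integral>v. D v e \<partial>lborel) = 0" by (simp add: zero LIMSEQ_const_iff)
qed

text \<open>Antilinear parts drop out of the Wirtinger derivative \<open>T e - \<i> T (\<i> e)\<close>, and the real part of a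
  complex-linear form contributes the form itself.\<close>

lemma wirtinger_combination:
  fixes l1 l2 l3 g1 g2 g3 f1 f2 f3 n1 n2 n3 \<alpha> \<beta> \<gamma> \<eta> :: complex
  defines "T \<equiv> \<lambda>w. \<alpha> * lin3 l1 l2 l3 w + \<beta> * cnj (lin3 g1 g2 g3 w) +
      \<gamma> * of_real (Re (lin3 f1 f2 f3 w)) + \<eta> * of_real (Re (lin3 n1 n2 n3 w))"
  shows "T (1, 0, 0) - \<i> * T (\<i>, 0, 0) = 2 * \<alpha> * l1 + \<gamma> * f1 + \<eta> * n1"
    and "T (0, 1, 0) - \<i> * T (0, \<i>, 0) = 2 * \<alpha> * l2 + \<gamma> * f2 + \<eta> * n2"
    and "T (0, 0, 1) - \<i> * T (0, 0, \<i>) = 2 * \<alpha> * l3 + \<gamma> * f3 + \<eta> * n3"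
proof -
  have *: "\<alpha> * l + \<beta> * cnj g + \<gamma> * of_real (Re f) + \<eta> * of_real (Re n) -
      \<i> * (\<alpha> * (l * \<i>) + \<beta> * cnj (g * \<i>) + \<gamma> * of_real (Re (f * \<i>)) + \<eta> * of_real (Re (n * \<i>)))
      = 2 * \<alpha> * l + \<gamma> * f + \<eta> * n" for l g f n
  proof -
    have re: "of_real (Re z) = z - \<i> * of_real (Im z)" for z
      by (simp add: complex_eq_iff)
    show ?thesis by (simp add: re[of f] re[of n] algebra_simps)
  qed
  show "T (1, 0, 0) - \<i> * T (\<i>, 0, 0) = 2 * \<alpha> * l1 + \<gamma> * f1 + \<eta> * n1"
    unfolding T_def using *[of l1 g1 f1 n1] by (simp add: lin3_def)
  show "T (0, 1, 0) - \<i> * T (0, \<i>, 0) = 2 * \<alpha> * l2 + \<gamma> * f2 + \<eta> * n2"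
    unfolding T_def using *[of l2 g2 f2 n2] by (simp add: lin3_def)
  show "T (0, 0, 1) - \<i> * T (0, 0, \<i>) = 2 * \<alpha> * l3 + \<gamma> * f3 + \<eta> * n3"
    unfolding T_def using *[of l3 g3 f3 n3] by (simp add: lin3_def)
qed

text \<open>Applied to a real derivative at a point, this is twice the Wirtinger derivative
  \<partial> in direction e.\<close>

definition wirt :: "(pt \<Rightarrow> complex) \<Rightarrow> pt \<Rightarrow> complex" where
  "wirt D e = D e - \<i> * D (scl \<i> e)"

lemma has_derivative_norm_squared:
  "((\<lambda>v. (norm v)\<^sup>2) has_derivative (\<lambda>w. 2 * Re (lin3 (cnj (px v)) (cnj (py v)) (cnj (pz v)) w))) (at v)"
proof -
  have "((\<lambda>v. v \<bullet> v) has_derivative (\<lambda>w. v \<bullet> w + w \<bullet> v)) (at v)"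
    by (auto intro!: derivative_eq_intros)
  then have "((\<lambda>v. (norm v)\<^sup>2) has_derivative (\<lambda>w. v \<bullet> w + w \<bullet> v)) (at v)"
    by (simp add: power2_norm_eq_inner)
  then show ?thesis
    by (rule has_derivative_eq_rhs)
       (auto simp: fun_eq_iff lin3_def px_def py_def pz_def inner_prod_def inner_complex_def algebra_simps)
qed

lemma loclip_inner_self:
  fixes F :: "'a::real_normed_vector \<Rightarrow> 'b::real_inner"
  shows "loclip F \<Longrightarrow> loclip (\<lambda>v. (norm (F v))\<^sup>2)"
  unfolding power2_norm_eq_inner by (intro loclip_bilinear[OF bounded_bilinear_inner])

lemma powr_shift_lipschitz:
  assumes "\<epsilon> > 0" "s \<ge> 0"
  shows "(s * \<epsilon> powr (- s - 1))-lipschitz_on {0..} (\<lambda>x. (x + \<epsilon>) powr (- s))"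
proof (rule bounded_derivative_imp_lipschitz)
  fix x :: real assume x: "x \<in> {0..}"
  have "((\<lambda>x. (x + \<epsilon>) powr (- s)) has_real_derivative (- s * (x + \<epsilon>) powr (- s - 1))) (at x)"
    using x assms by (auto intro!: derivative_eq_intros)
  then show "((\<lambda>x. (x + \<epsilon>) powr (- s)) has_derivative (*) (- s * (x + \<epsilon>) powr (- s - 1))) (at x within {0..})"
    unfolding has_field_derivative_def by (rule has_derivative_at_withinI)
  show "onorm ((*) (- s * (x + \<epsilon>) powr (- s - 1))) \<le> s * \<epsilon> powr (- s - 1)"
  proof (rule onorm_bound)
    fix y
    have "(x + \<epsilon>) powr (- s - 1) \<le> \<epsilon> powr (- s - 1)" using x assms by (intro powr_mono2') auto
    then show "norm (- s * (x + \<epsilon>) powr (- s - 1) * y) \<le> s * \<epsilon> powr (- s - 1) * norm y"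
      using assms by (simp add: abs_mult mult_mono)
  qed (use assms in auto)
qed (use assms in auto)

text \<open>Replacing \<open>|f|\<^sup>2\<close> by \<open>|f|\<^sup>2 + \<epsilon>\<close> makes the weight smooth and keeps it a function of \<open>f\<close>, hence annihilated
  by \<open>a \<partial>\<^sub>x + b \<partial>\<^sub>y + c \<partial>\<^sub>z\<close>; no cutoff near the curve is needed.\<close>

lemma integration_by_parts_regularized:
  fixes a b c f g l :: "pt \<Rightarrow> complex" and \<phi> \<phi>' :: "real \<Rightarrow> real"
  assumes hol: "hol3 a" "hol3 b" "hol3 c" "hol3 f" "hol3 g" "hol3 l"
    and syz: "\<And>v. a v * dX f v + b v * dY f v + c v * dZ f v = 0"
    and \<phi>: "\<And>t. (\<phi> has_real_derivative \<phi>' t) (at t)" "\<And>t. t \<ge> 4 \<Longrightarrow> \<phi> t = 0" "\<And>t. \<bar>\<phi>' t\<bar> \<le> B"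
    and \<epsilon>: "\<epsilon> > 0" and s: "s \<ge> 0"
  shows "(\<integral>v. of_real (((norm (f v))\<^sup>2 + \<epsilon>) powr (- s)) * (cnj (g v) *
     (((dX a v + dY b v + dZ c v) * l v + (a v * dX l v + b v * dY l v + c v * dZ l v)) * of_real (\<phi> ((norm v)\<^sup>2)) +
      l v * (a v * cnj (px v) + b v * cnj (py v) + c v * cnj (pz v)) * of_real (\<phi>' ((norm v)\<^sup>2)))) \<partial>lborel) = 0"
proof -
  define P where "P v = ((norm (f v))\<^sup>2 + \<epsilon>) powr (- s)" for v
  define \<kappa> where "\<kappa> v = - s * ((norm (f v))\<^sup>2 + \<epsilon>) powr (- s - 1)" for v
  define ph where "ph v = \<phi> ((norm v)\<^sup>2)" for v :: pt
  define ph' where "ph' v = \<phi>' ((norm v)\<^sup>2)" for v :: pt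
  \<comment> \<open>The field to be integrated is u \<delta>. The factor \<open>cnj (g v)\<close>
    will be invisible to \<partial>, whereas \<open>l\<close> contributes its derivative \<delta>
    l.\<close>
  define u where "u v = l v * (cnj (g v) * of_real (P v * ph v))" for v
  define Df where "Df v = lin3 (cnj (f v) * dX f v) (cnj (f v) * dY f v) (cnj (f v) * dZ f v)" for v
  define Dn where "Dn v = lin3 (cnj (px v)) (cnj (py v)) (cnj (pz v))" for v
  \<comment> \<open>Sorted as in \<open>wirtinger_combination\<close>: a complex-linear part from
    \<open>l\<close>, an antilinear part from \<open>g\<close>, and two real parts from the weight
    and from the cutoff.\<close>
  define Du where "Du v w = (cnj (g v) * of_real (P v * ph v)) * lin3 (dX l v) (dY l v) (dZ l v) w +
      (l v * of_real (P v * ph v)) * cnj (lin3 (dX g v) (dY g v) (dZ g v) w) +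
      (l v * cnj (g v) * of_real (2 * \<kappa> v * ph v)) * of_real (Re (Df v w)) +
      (l v * cnj (g v) * of_real (2 * P v * ph' v)) * of_real (Re (Dn v w))" for v w
  have dP: "(P has_derivative (\<lambda>w. 2 * \<kappa> v * Re (Df v w))) (at v)" for v
  proof -
    have 1: "((\<lambda>v. f v \<bullet> f v) has_derivative (\<lambda>w. 2 * Re (Df v w))) (at v)"
      by (rule has_derivative_eq_rhs[OF has_derivative_inner[OF hol3D(2)[OF hol(4)] hol3D(2)[OF hol(4)]]])
         (auto simp: fun_eq_iff lin3_def Df_def inner_complex_def algebra_simps)
    have 2: "((\<lambda>x. (x + \<epsilon>) powr (- s)) has_real_derivative \<kappa> v) (at (f v \<bullet> f v))"
      unfolding \<kappa>_def power2_norm_eq_inner using \<epsilon> inner_ge_zero[of "f v"]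
      by (auto intro!: derivative_eq_intros simp del: inner_ge_zero)
    have "((\<lambda>v. (f v \<bullet> f v + \<epsilon>) powr (- s)) has_derivative (\<lambda>w. \<kappa> v * (2 * Re (Df v w)))) (at v)"
      using has_derivative_compose[OF 1 2[unfolded has_field_derivative_def]] by simp
    then show ?thesis unfolding P_def[abs_def] power2_norm_eq_inner by (simp add: mult_ac)
  qed
  have dph: "(ph has_derivative (\<lambda>w. 2 * ph' v * Re (Dn v w))) (at v)" for v
    using has_derivative_compose[OF has_derivative_norm_squared[of v] \<phi>(1)[of "(norm v)\<^sup>2", unfolded has_field_derivative_def]]
    by (simp add: ph_def[abs_def] ph'_def Dn_def mult_ac)
  have dg: "((\<lambda>v. cnj (g v)) has_derivative (\<lambda>w. cnj (lin3 (dX g v) (dY g v) (dZ g v) w))) (at v)" for v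
    by (rule bounded_linear.has_derivative[OF bounded_linear_cnj hol3D(2)[OF hol(5)]])
  have du: "(u has_derivative Du v) (at v)" for v
  proof -
    have "(u has_derivative (\<lambda>w. l v * (cnj (g v) * of_real (P v * (2 * ph' v * Re (Dn v w)) + 2 * \<kappa> v * Re (Df v w) * ph v) +
       cnj (lin3 (dX g v) (dY g v) (dZ g v) w) * of_real (P v * ph v)) +
       lin3 (dX l v) (dY l v) (dZ l v) w * (cnj (g v) * of_real (P v * ph v)))) (at v)"
      unfolding u_def[abs_def]
      by (intro has_derivative_mult hol3D(2)[OF hol(6)] dg has_derivative_of_real dP dph)
    then show ?thesis
      by (rule has_derivative_eq_rhs) (auto simp: fun_eq_iff Du_def algebra_simps)
  qed
  have lu: "loclip u"
  proof -
    have g': "loclip (\<lambda>v. cnj (g v))"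
      by (rule loclip_compose_lipschitz[OF hol3D(1)[OF hol(5)], where K = 1 and S = UNIV])
         (auto intro!: lipschitz_onI simp: dist_norm complex_cnj_diff[symmetric] simp del: complex_cnj_diff)
    have P': "loclip P" unfolding P_def[abs_def]
      by (rule loclip_compose_lipschitz[OF loclip_inner_self[OF hol3D(1)[OF hol(4)]] powr_shift_lipschitz[OF \<epsilon> s]]) auto
    have B0: "0 \<le> B" using \<phi>(3)[of 0] by linarith
    have "B-lipschitz_on UNIV \<phi>"
    proof (rule bounded_derivative_imp_lipschitz)
      show "(\<phi> has_derivative (*) (\<phi>' x)) (at x within UNIV)" for x
        using \<phi>(1)[of x] by (simp add: has_field_derivative_def)
      show "onorm ((*) (\<phi>' x)) \<le> B" for x
        by (rule onorm_bound) (use \<phi>(3)[of x] B0 in \<open>auto simp: abs_mult mult_right_mono\<close>)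
    qed (use B0 in auto)
    then have ph': "loclip ph" unfolding ph_def[abs_def]
      by (rule loclip_compose_lipschitz[OF loclip_inner_self[OF loclip_bounded_linear[OF bounded_linear_ident]]]) auto
    have "loclip (\<lambda>v. of_real (P v * ph v) :: complex)"
      by (rule loclip_compose_lipschitz[OF loclip_mult[OF P' ph'], where K = 1 and S = UNIV])
         (auto intro!: lipschitz_onI simp: dist_norm of_real_diff[symmetric] simp del: of_real_diff)
    then show ?thesis unfolding u_def[abs_def] by (intro loclip_mult hol3D(1)[OF hol(6)] g')
  qed
  have su: "u v = 0" if "norm v \<ge> 2" for v
  proof -
    have "(norm v)\<^sup>2 \<ge> 2\<^sup>2" using that by (intro power_mono) auto
    then show ?thesis using \<phi>(2) by (simp add: u_def ph_def)
  qed
  have part: "integrable lborel (\<lambda>v. wirt (\<lambda>w. lin3 (dX k v) (dY k v) (dZ k v) w * u v + k v * Du v w) e) \<and>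
      (\<integral>v. wirt (\<lambda>w. lin3 (dX k v) (dY k v) (dZ k v) w * u v + k v * Du v w) e \<partial>lborel) = 0"
    if k: "hol3 k" for k e
  proof -
    have lk: "loclip (\<lambda>v. k v * u v)" by (intro loclip_mult hol3D(1)[OF k] lu)
    have sk: "k v * u v = 0" if "norm v \<ge> 2" for v using su[OF that] by simp
    have dk: "((\<lambda>v. k v * u v) has_derivative
        (\<lambda>w. lin3 (dX k v) (dY k v) (dZ k v) w * u v + k v * Du v w)) (at v)" for v
      by (rule has_derivative_eq_rhs[OF has_derivative_mult[OF hol3D(2)[OF k] du]]) (auto simp: fun_eq_iff)
    note int = integral_directional_derivative_eq_0[OF lk sk dk]
    show ?thesis unfolding wirt_def using int[where e = e] int[where e = "scl \<i> e"] by simp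
  qed
  define X where "X v = of_real (P v) * (cnj (g v) *
     (((dX a v + dY b v + dZ c v) * l v + (a v * dX l v + b v * dY l v + c v * dZ l v)) * of_real (ph v) +
      l v * (a v * cnj (px v) + b v * cnj (py v) + c v * cnj (pz v)) * of_real (ph' v)))" for v
  \<comment> \<open>The left side is twice the \<partial>-divergence of u \<delta>; each of its
    summands integrates to 0.\<close>
  have key: "wirt (\<lambda>w. lin3 (dX a v) (dY a v) (dZ a v) w * u v + a v * Du v w) (1, 0, 0) +
      wirt (\<lambda>w. lin3 (dX b v) (dY b v) (dZ b v) w * u v + b v * Du v w) (0, 1, 0) +
      wirt (\<lambda>w. lin3 (dX c v) (dY c v) (dZ c v) w * u v + c v * Du v w) (0, 0, 1) = 2 * X v" for v
  proof -
    define q where "q = l v * cnj (g v)"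
    have W: "Du v (1, 0, 0) - \<i> * Du v (\<i>, 0, 0) = 2 * (cnj (g v) * of_real (P v * ph v)) * dX l v +
        (q * of_real (2 * \<kappa> v * ph v)) * (cnj (f v) * dX f v) + (q * of_real (2 * P v * ph' v)) * cnj (px v)"
      "Du v (0, 1, 0) - \<i> * Du v (0, \<i>, 0) = 2 * (cnj (g v) * of_real (P v * ph v)) * dY l v +
        (q * of_real (2 * \<kappa> v * ph v)) * (cnj (f v) * dY f v) + (q * of_real (2 * P v * ph' v)) * cnj (py v)"
      "Du v (0, 0, 1) - \<i> * Du v (0, 0, \<i>) = 2 * (cnj (g v) * of_real (P v * ph v)) * dZ l v +
        (q * of_real (2 * \<kappa> v * ph v)) * (cnj (f v) * dZ f v) + (q * of_real (2 * P v * ph' v)) * cnj (pz v)"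
      unfolding Du_def Df_def Dn_def q_def by (rule wirtinger_combination)+
    have 1: "wirt (\<lambda>w. lin3 (dX a v) (dY a v) (dZ a v) w * u v + a v * Du v w) (1, 0, 0) =
        2 * dX a v * u v + a v * (Du v (1, 0, 0) - \<i> * Du v (\<i>, 0, 0))"
      by (simp add: wirt_def scl_def lin3_def algebra_simps)
    have 2: "wirt (\<lambda>w. lin3 (dX b v) (dY b v) (dZ b v) w * u v + b v * Du v w) (0, 1, 0) =
        2 * dY b v * u v + b v * (Du v (0, 1, 0) - \<i> * Du v (0, \<i>, 0))"
      by (simp add: wirt_def scl_def lin3_def algebra_simps)
    have 3: "wirt (\<lambda>w. lin3 (dX c v) (dY c v) (dZ c v) w * u v + c v * Du v w) (0, 0, 1) =
        2 * dZ c v * u v + c v * (Du v (0, 0, 1) - \<i> * Du v (0, 0, \<i>))"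
      by (simp add: wirt_def scl_def lin3_def algebra_simps)
    \<comment> \<open>Collects everything produced by differentiating the weight. Its cofactor is
      \<delta> f, so this contribution vanishes before any limit is taken.\<close>
    define A where "A = q * of_real (2 * \<kappa> v * ph v) * cnj (f v)"
    have "2 * dX a v * u v + a v * (2 * (cnj (g v) * of_real (P v * ph v)) * dX l v +
          (q * of_real (2 * \<kappa> v * ph v)) * (cnj (f v) * dX f v) + (q * of_real (2 * P v * ph' v)) * cnj (px v)) +
        (2 * dY b v * u v + b v * (2 * (cnj (g v) * of_real (P v * ph v)) * dY l v +
          (q * of_real (2 * \<kappa> v * ph v)) * (cnj (f v) * dY f v) + (q * of_real (2 * P v * ph' v)) * cnj (py v))) +
        (2 * dZ c v * u v + c v * (2 * (cnj (g v) * of_real (P v * ph v)) * dZ l v +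
          (q * of_real (2 * \<kappa> v * ph v)) * (cnj (f v) * dZ f v) + (q * of_real (2 * P v * ph' v)) * cnj (pz v)))
      = 2 * X v + A * (a v * dX f v + b v * dY f v + c v * dZ f v)"
      unfolding X_def u_def q_def A_def of_real_mult of_real_numeral by (simp add: algebra_simps)
    then show ?thesis unfolding 1 2 3 W syz by simp
  qed
  have "(\<integral>v. 2 * X v \<partial>lborel) = 0"
    unfolding key[symmetric] using part[OF hol(1), of "(1,0,0)"] part[OF hol(2), of "(0,1,0)"] part[OF hol(3), of "(0,0,1)"]
    by simp
  then have "(\<integral>v. X v \<partial>lborel) = 0" by simp
  then show ?thesis unfolding X_def P_def ph_def ph'_def .
qed

lemma weight_integrable:
  fixes f X :: "pt \<Rightarrow> complex"
  assumes f: "continuous_on UNIV f" and X: "continuous_on UNIV X" and supp: "\<And>v. v \<notin> shell \<Longrightarrow> X v = 0"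
    and fin: "(\<integral>\<^sup>+x\<in>shell. wt (2 * s) (f x) \<partial>lborel) < \<infinity>"
  shows "integrable lborel (\<lambda>v. of_real (norm (f v) powr (- 2 * s)) * X v)"
proof -
  have [measurable]: "f \<in> borel_measurable borel" "X \<in> borel_measurable borel"
    using f X by (auto intro: borel_measurable_continuous_onI)
  have "compact shell" unfolding shell_def by (intro compact_diff) auto
  then have "compact (X ` shell)" by (intro compact_continuous_image continuous_on_subset[OF X]) auto
  then have "bounded (X ` shell)" by (rule compact_imp_bounded)
  then obtain M where M: "M > 0" "\<And>v. v \<in> shell \<Longrightarrow> norm (X v) \<le> M" unfolding bounded_pos by blast
  have "integrable lborel (\<lambda>v. norm (f v) powr (- 2 * s) * indicator shell v * M)"
  proof (intro integrable_mult_left impI)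
    show "integrable lborel (\<lambda>v. norm (f v) powr (- 2 * s) * indicator shell v)"
    proof (rule integrableI_bounded)
      have "(\<integral>\<^sup>+v. norm (norm (f v) powr (- 2 * s) * indicator shell v) \<partial>lborel)
          \<le> (\<integral>\<^sup>+x\<in>shell. wt (2 * s) (f x) \<partial>lborel)"
        by (rule nn_integral_mono) (auto simp: wt_def indicator_def)
      then show "(\<integral>\<^sup>+v. norm (norm (f v) powr (- 2 * s) * indicator shell v) \<partial>lborel) < \<infinity>"
        using fin by (rule le_less_trans)
    qed measurable
  qed
  then show ?thesis
  proof (rule Bochner_Integration.integrable_bound)
    show "AE v in lborel. norm (of_real (norm (f v) powr (- 2 * s)) * X v)
        \<le> norm (norm (f v) powr (- 2 * s) * indicator shell v * M)"
    proof (rule AE_I2)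
      fix v
      show "norm (of_real (norm (f v) powr (- 2 * s)) * X v)
        \<le> norm (norm (f v) powr (- 2 * s) * indicator shell v * M)"
        using M supp[of v] by (cases "v \<in> shell") (auto simp: norm_mult mult_left_mono)
    qed
  qed measurable
qed

lemma AE_weight_nonzero:
  fixes f :: "pt \<Rightarrow> complex"
  assumes f: "continuous_on UNIV f" and fin: "(\<integral>\<^sup>+x\<in>shell. wt q (f x) \<partial>lborel) < \<infinity>"
  shows "AE v in lborel. v \<in> shell \<longrightarrow> f v \<noteq> 0"
proof -
  have [measurable]: "f \<in> borel_measurable borel" using f by (rule borel_measurable_continuous_onI)
  have "AE v in lborel. wt q (f v) * indicator shell v \<noteq> \<infinity>"
    by (rule nn_integral_PInf_AE) (use fin in auto)
  then show ?thesis by eventually_elim (auto simp: wt_def)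
qed

text \<open>The regularized identity with \<epsilon> = 1 / (n + 1), in the limit. The regularized
  weights are bounded by the true one, which is integrable on the shell, so dominated convergence
  applies once the cutoff also vanishes near the origin.\<close>

lemma integration_by_parts:
  fixes a b c f g l :: "pt \<Rightarrow> complex" and \<phi> \<phi>' :: "real \<Rightarrow> real"
  assumes hol: "hol3 a" "hol3 b" "hol3 c" "hol3 f" "hol3 g" "hol3 l"
    and syz: "\<And>v. a v * dX f v + b v * dY f v + c v * dZ f v = 0"
    and \<phi>: "\<And>t. (\<phi> has_real_derivative \<phi>' t) (at t)" "continuous_on UNIV \<phi>'"
      "\<And>t. t \<ge> 4 \<or> t \<le> 1/4 \<Longrightarrow> \<phi> t = 0 \<and> \<phi>' t = 0"
    and s: "s \<ge> 0" and fin: "(\<integral>\<^sup>+x\<in>shell. wt (2 * s) (f x) \<partial>lborel) < \<infinity>"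
  shows "(\<integral>v. of_real (norm (f v) powr (- 2 * s)) * (cnj (g v) *
     (((dX a v + dY b v + dZ c v) * l v + (a v * dX l v + b v * dY l v + c v * dZ l v)) * of_real (\<phi> ((norm v)\<^sup>2)) +
      l v * (a v * cnj (px v) + b v * cnj (py v) + c v * cnj (pz v)) * of_real (\<phi>' ((norm v)\<^sup>2)))) \<partial>lborel) = 0"
proof -
  define X where "X v = cnj (g v) *
     (((dX a v + dY b v + dZ c v) * l v + (a v * dX l v + b v * dY l v + c v * dZ l v)) * of_real (\<phi> ((norm v)\<^sup>2)) +
      l v * (a v * cnj (px v) + b v * cnj (py v) + c v * cnj (pz v)) * of_real (\<phi>' ((norm v)\<^sup>2)))" for v
  note cf = hol3D(3)[OF hol(4)]
  have "continuous_on UNIV \<phi>"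
    by (rule continuous_at_imp_continuous_on, rule ballI, rule DERIV_isCont, rule \<phi>(1))
  then have "continuous_on UNIV (\<lambda>v::pt. \<phi> ((norm v)\<^sup>2))" "continuous_on UNIV (\<lambda>v::pt. \<phi>' ((norm v)\<^sup>2))"
    using \<phi>(2) by (auto intro!: continuous_on_compose2[of UNIV _ UNIV "\<lambda>v. (norm v)\<^sup>2"] continuous_intros)
  then have cX: "continuous_on UNIV X"
    unfolding X_def using hol by (intro continuous_intros) (auto intro: hol3D)
  have sX: "X v = 0" if "v \<notin> shell" for v
  proof -
    have "norm v > 2 \<or> norm v < 1/2" using that by (auto simp: shell_def)
    then have "(norm v)\<^sup>2 \<ge> 2\<^sup>2 \<or> (norm v)\<^sup>2 \<le> (1/2)\<^sup>2" using power_mono[of 2 "norm v" 2] power_mono[of "norm v" "1/2" 2] by auto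
    then have "\<phi> ((norm v)\<^sup>2) = 0 \<and> \<phi>' ((norm v)\<^sup>2) = 0" by (intro \<phi>(3)) (auto simp: power2_eq_square)
    then show ?thesis by (simp add: X_def)
  qed
  have "compact (\<phi>' ` {1/4..4})" by (intro compact_continuous_image continuous_on_subset[OF \<phi>(2)]) auto
  then have "bounded (\<phi>' ` {1/4..4})" by (rule compact_imp_bounded)
  then obtain B where B: "B > 0" "\<And>t. t \<in> {1/4..4} \<Longrightarrow> norm (\<phi>' t) \<le> B" unfolding bounded_pos by blast
  have B': "\<bar>\<phi>' t\<bar> \<le> B" for t
    using B \<phi>(3)[of t] by (cases "t \<in> {1/4..4}") auto
  have \<phi>4: "\<phi> t = 0" if "t \<ge> 4" for t using \<phi>(3) that by blast
  define W where "W v = norm (f v) powr (- 2 * s)" for v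
  define P where "P n v = ((norm (f v))\<^sup>2 + 1 / real (Suc n)) powr (- s)" for n v
  have [measurable]: "f \<in> borel_measurable borel" "X \<in> borel_measurable borel"
    using cf cX by (auto intro: borel_measurable_continuous_onI)
  have int: "integrable lborel (\<lambda>v. of_real (W v) * X v)"
    unfolding W_def by (rule weight_integrable[OF cf cX sX fin])
  have zero: "(\<integral>v. of_real (P n v) * X v \<partial>lborel) = 0" for n
    unfolding P_def X_def
    by (rule integration_by_parts_regularized[OF hol syz \<phi>(1) \<phi>4 B' _ s])
       simp_all
  have Wsq: "W v = ((norm (f v))\<^sup>2) powr (- s)" if "f v \<noteq> 0" for v
  proof -
    have "(norm (f v))\<^sup>2 = norm (f v) powr 2" using that powr_realpow[of "norm (f v)" 2] by simp
    then have "((norm (f v))\<^sup>2) powr (- s) = norm (f v) powr (2 * (- s))" by (simp only: powr_powr)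
    then show ?thesis by (simp add: W_def)
  qed
  \<comment> \<open>Pointwise convergence would fail on the curve for s > 0: there \<open>W\<close>
    is 0 by the convention for \<open>powr\<close> at 0, while \<open>P n\<close> tends to infinity.
    The curve is a null set within the shell.\<close>
  have ae: "AE v in lborel. v \<in> shell \<longrightarrow> f v \<noteq> 0" by (rule AE_weight_nonzero[OF cf fin])
  have "(\<lambda>n. \<integral>v. of_real (P n v) * X v \<partial>lborel) \<longlonglongrightarrow> (\<integral>v. of_real (W v) * X v \<partial>lborel)"
  proof (rule integral_dominated_convergence[where w = "\<lambda>v. norm (of_real (W v) * X v)"])
    show "integrable lborel (\<lambda>v. norm (of_real (W v) * X v))" using int by (rule integrable_norm)
    show "AE v in lborel. (\<lambda>n. of_real (P n v) * X v) \<longlonglongrightarrow> of_real (W v) * X v"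
      using ae
    proof eventually_elim
      case (elim v)
      show ?case
      proof (cases "v \<in> shell")
        case True
        then have f0: "f v \<noteq> 0" using elim by blast
        have "(\<lambda>n. 1 / real (Suc n)) \<longlonglongrightarrow> 0" by (rule LIMSEQ_Suc[OF lim_1_over_n])
        then have "(\<lambda>n. P n v) \<longlonglongrightarrow> ((norm (f v))\<^sup>2 + 0) powr (- s)"
          unfolding P_def using f0 by (intro tendsto_intros) auto
        then have "(\<lambda>n. P n v) \<longlonglongrightarrow> W v" by (simp add: Wsq[OF f0])
        then show ?thesis by (intro tendsto_intros)
      qed (simp add: sX)
    qed
    show "AE v in lborel. norm (of_real (P n v) * X v) \<le> norm (of_real (W v) * X v)" for n
      using ae
    proof eventually_elim
      case (elim v)
      show ?case
      proof (cases "v \<in> shell")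
        case True
        then have f0: "f v \<noteq> 0" using elim by blast
        have "P n v \<le> W v" unfolding Wsq[OF f0] P_def using f0 s by (intro powr_mono2') auto
        moreover have "P n v \<ge> 0" by (simp add: P_def)
        ultimately show ?thesis by (simp add: norm_mult mult_right_mono)
      qed (simp add: sX)
    qed
  qed (auto simp: P_def W_def)
  then have "(\<integral>v. of_real (W v) * X v \<partial>lborel) = 0" by (simp add: zero LIMSEQ_const_iff)
  then show ?thesis unfolding W_def X_def .
qed

subsection \<open>Radial cutoffs and scaling\<close>

lemma has_derivative_max_square:
  "((\<lambda>t::real. (max 0 t)\<^sup>2) has_real_derivative 2 * max 0 t) (at t)"
proof -
  consider "t > 0" | "t < 0" | "t = 0" by linarith
  then show ?thesis
  proof cases
    case 1
    have "((\<lambda>t::real. t\<^sup>2) has_real_derivative 2 * t) (at t)" by (auto intro!: derivative_eq_intros)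
    then have "((\<lambda>t::real. (max 0 t)\<^sup>2) has_real_derivative 2 * t) (at t)"
      by (rule has_field_derivative_transform_within_open[of _ _ _ "{0<..}"]) (use 1 in auto)
    then show ?thesis using 1 by simp
  next
    case 2
    have "((\<lambda>t::real. 0) has_real_derivative 0) (at t)" by simp
    then have "((\<lambda>t::real. (max 0 t)\<^sup>2) has_real_derivative 0) (at t)"
      by (rule has_field_derivative_transform_within_open[of _ _ _ "{..<0}"]) (use 2 in auto)
    then show ?thesis using 2 by simp
  next
    case 3
    have "((\<lambda>h::real. (max 0 h)\<^sup>2 / h) \<longlongrightarrow> 0) (at 0)"
    proof (rule Lim_null_comparison[where g = "\<lambda>h::real. \<bar>h\<bar>"])
      have "norm ((max 0 h)\<^sup>2 / h) \<le> \<bar>h\<bar>" for h :: real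
        by (cases "h > 0") (auto simp: power2_eq_square max_def)
      then show "\<forall>\<^sub>F h in at 0. norm ((max 0 h)\<^sup>2 / h) \<le> \<bar>h::real\<bar>" by simp
      show "((\<lambda>h::real. \<bar>h\<bar>) \<longlongrightarrow> 0) (at 0)" by (rule tendsto_rabs_zero) (rule tendsto_ident_at)
    qed
    then show ?thesis using 3 by (simp add: DERIV_def)
  qed
qed

text \<open>Class C^1 suffices, since cutoffs are differentiated only once. The step is p(t - 1) /
  (p(t - 1) + p(2 - t)) with p the squared positive part; at every t one of the two summands is
  positive.\<close>

lemma smooth_step_exists:
  obtains \<Psi> \<psi> :: "real \<Rightarrow> real" where
    "\<And>t. (\<Psi> has_real_derivative \<psi> t) (at t)" "continuous_on UNIV \<psi>"
    "\<And>t. t \<le> 1 \<Longrightarrow> \<Psi> t = 0 \<and> \<psi> t = 0" "\<And>t. t \<ge> 2 \<Longrightarrow> \<Psi> t = 1 \<and> \<psi> t = 0" "\<And>t. 0 \<le> \<Psi> t \<and> \<Psi> t \<le> 1"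
proof -
  define p where "p t = (max 0 t)\<^sup>2" for t :: real
  define d where "d t = p (t - 1) + p (2 - t)" for t
  have p0: "p t \<ge> 0" for t by (simp add: p_def)
  have d0: "d t > 0" for t
  proof (cases "t > 1")
    case True
    then have "p (t - 1) > 0" by (simp add: p_def)
    then show ?thesis using p0[of "2 - t"] by (simp add: d_def)
  next
    case False
    then have "p (2 - t) > 0" by (simp add: p_def)
    then show ?thesis using p0[of "t - 1"] by (simp add: d_def)
  qed
  have p': "(p has_real_derivative 2 * max 0 t) (at t)" for t
    unfolding p_def[abs_def] by (rule has_derivative_max_square)
  define e where "e t = 2 * max 0 (t - 1) - 2 * max 0 (2 - t)" for t :: real
  define \<psi> where "\<psi> t = (2 * max 0 (t - 1) * d t - p (t - 1) * e t) / (d t * d t)" for t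
  have p1: "((\<lambda>t. p (t - 1)) has_real_derivative 2 * max 0 (t - 1)) (at t)" for t
    by (rule DERIV_cong[OF DERIV_chain2[OF p', of "\<lambda>t. t - 1" 1]]) (auto intro!: derivative_eq_intros)
  have p2: "((\<lambda>t. p (2 - t)) has_real_derivative - 2 * max 0 (2 - t)) (at t)" for t
    by (rule DERIV_cong[OF DERIV_chain2[OF p', of "\<lambda>t. 2 - t" "-1"]]) (auto intro!: derivative_eq_intros)
  have d': "(d has_real_derivative e t) (at t)" for t
    unfolding d_def[abs_def] e_def using DERIV_add[OF p1 p2] by simp
  have "((\<lambda>t. p (t - 1) / d t) has_real_derivative \<psi> t) (at t)" for t
    unfolding \<psi>_def by (rule DERIV_divide[OF p1 d']) (use d0[of t] in simp)
  moreover have "continuous_on UNIV \<psi>"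
    unfolding \<psi>_def e_def d_def p_def
    by (intro continuous_intros) (use d0 in \<open>force simp: d_def p_def\<close>)
  moreover have "p (t - 1) / d t = 0 \<and> \<psi> t = 0" if "t \<le> 1" for t
    using that by (simp add: p_def \<psi>_def)
  moreover have "p (t - 1) / d t = 1 \<and> \<psi> t = 0" if "t \<ge> 2" for t
  proof -
    have "d t = p (t - 1)" "e t = 2 * max 0 (t - 1)" using that by (auto simp: d_def p_def e_def)
    then show ?thesis using d0[of t] by (simp add: \<psi>_def)
  qed
  moreover have "0 \<le> p (t - 1) / d t \<and> p (t - 1) / d t \<le> 1" for t
    using p0[of "t - 1"] p0[of "2 - t"] d0[of t] by (auto simp: d_def)
  ultimately show ?thesis by (intro that[of "\<lambda>t. p (t - 1) / d t" \<psi>])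
qed

lemma continuous_on_divide_id:
  fixes k :: "real \<Rightarrow> real"
  assumes "continuous_on UNIV k" "\<And>t. t \<le> 1/4 \<Longrightarrow> k t = 0"
  shows "continuous_on UNIV (\<lambda>t. k t / t)"
proof -
  \<comment> \<open>The truncated denominator never vanishes and differs from t only where
    \<open>k\<close> is 0.\<close>
  have "continuous_on UNIV (\<lambda>t. k t / max t (1/8))"
    by (intro continuous_intros assms(1)) (auto simp: max_def)
  also have "(\<lambda>t. k t / max t (1/8)) = (\<lambda>t. k t / t)"
  proof
    fix t
    show "k t / max t (1/8) = k t / t" using assms(2)[of t] by (cases "t \<le> 1/4") auto
  qed
  finally show ?thesis .
qed

lemma has_derivative_divide_id:
  fixes k k' :: "real \<Rightarrow> real"
  assumes k: "\<And>t. (k has_real_derivative k' t) (at t)" "\<And>t. t \<le> 1/4 \<Longrightarrow> k t = 0 \<and> k' t = 0"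
  shows "((\<lambda>t. k t / t) has_real_derivative (k' t / t - k t / t / t)) (at t)"
proof (cases "t < 1/4")
  case True
  have "((\<lambda>t::real. 0) has_real_derivative 0) (at t)" by simp
  then have "((\<lambda>t. k t / t) has_real_derivative 0) (at t)"
    by (rule has_field_derivative_transform_within_open[of _ _ _ "{..<1/4}"]) (use True k in auto)
  then show ?thesis using k(2)[of t] True by simp
next
  case False
  then have "t \<noteq> 0" by auto
  then show ?thesis
    by (auto intro!: derivative_eq_intros k(1) simp: field_simps)
qed

text \<open>64 = 2^6, because the real dimension is 6.\<close>

lemma integral_double:
  fixes F :: "pt \<Rightarrow> complex"
  assumes [measurable]: "F \<in> borel_measurable borel"
  shows "(\<integral>v. F v \<partial>lborel) = 64 * (\<integral>v. F (2 *\<^sub>R v) \<partial>lborel)"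
proof -
  have "(\<integral>v. F v \<partial>lborel) = (\<integral>v. F v \<partial>density (distr lborel borel (\<lambda>x::pt. 0 + 2 *\<^sub>R x)) (\<lambda>_. ennreal (\<bar>2\<bar> ^ DIM(pt))))"
    using lborel_affine[of 2 "0::pt"] by simp
  also have "\<dots> = (\<integral>v. (2 ^ DIM(pt)) *\<^sub>R F v \<partial>distr lborel borel (\<lambda>x::pt. 0 + 2 *\<^sub>R x))"
    by (subst integral_density) auto
  also have "\<dots> = (\<integral>v. (2 ^ DIM(pt)) *\<^sub>R F (0 + 2 *\<^sub>R v) \<partial>lborel)"
    by (rule integral_distr) auto
  also have "\<dots> = 64 * (\<integral>v. F (2 *\<^sub>R v) \<partial>lborel)"
    by (simp add: scaleR_conv_of_real)
  finally show ?thesis .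
qed

text \<open>A discrete substitute for polar coordinates: for a homogeneous density, a single
  dilation compares the cutoffs \<theta>(t) and \<theta>(4 t).\<close>

lemma weighted_scaling:
  fixes f X :: "pt \<Rightarrow> complex" and \<theta> :: "real \<Rightarrow> real"
  assumes "continuous_on UNIV f" "continuous_on UNIV X" "continuous_on UNIV \<theta>"
    and hom: "\<And>v. of_real (norm (f (2 *\<^sub>R v)) powr e) * X (2 *\<^sub>R v) = \<kappa> * (of_real (norm (f v) powr e) * X v)"
  shows "(\<integral>v. of_real (norm (f v) powr e) * (X v * of_real (\<theta> ((norm v)\<^sup>2))) \<partial>lborel) =
    64 * \<kappa> * (\<integral>v. of_real (norm (f v) powr e) * (X v * of_real (\<theta> (4 * (norm v)\<^sup>2))) \<partial>lborel)"
proof -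
  have [measurable]: "f \<in> borel_measurable borel" "X \<in> borel_measurable borel" "\<theta> \<in> borel_measurable borel"
    using assms(1-3) by (auto intro: borel_measurable_continuous_onI)
  have "(\<integral>v. of_real (norm (f v) powr e) * (X v * of_real (\<theta> ((norm v)\<^sup>2))) \<partial>lborel) =
     64 * (\<integral>v. of_real (norm (f (2 *\<^sub>R v)) powr e) * (X (2 *\<^sub>R v) * of_real (\<theta> ((norm (2 *\<^sub>R v))\<^sup>2))) \<partial>lborel)"
    by (rule integral_double) measurable
  also have "(\<lambda>v. of_real (norm (f (2 *\<^sub>R v)) powr e) * (X (2 *\<^sub>R v) * of_real (\<theta> ((norm (2 *\<^sub>R v))\<^sup>2)))) =
      (\<lambda>v. \<kappa> * (of_real (norm (f v) powr e) * (X v * of_real (\<theta> (4 * (norm v)\<^sup>2)))))"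
  proof
    fix v :: pt
    have "(norm (2 *\<^sub>R v))\<^sup>2 = 4 * (norm v)\<^sup>2" by (simp add: power_mult_distrib)
    then show "of_real (norm (f (2 *\<^sub>R v)) powr e) * (X (2 *\<^sub>R v) * of_real (\<theta> ((norm (2 *\<^sub>R v))\<^sup>2))) =
      \<kappa> * (of_real (norm (f v) powr e) * (X v * of_real (\<theta> (4 * (norm v)\<^sup>2))))"
      using hom[of v] by (metis mult.assoc)
  qed
  finally show ?thesis by simp
qed

section \<open>From vanishing integrals to vanishing functions\<close>

lemma open_AE_empty:
  fixes S :: "'a::euclidean_space set"
  assumes "open S" "AE v in lborel. v \<notin> S"
  shows "S = {}"
proof (rule ccontr)
  assume "S \<noteq> {}"
  have "{v \<in> space lborel. \<not> v \<notin> S} \<in> null_sets lborel"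
    using assms by (subst (asm) AE_iff_null) auto
  then have "S \<in> null_sets lborel" by simp
  then have "negligible S" by (simp add: negligible_iff_null_sets null_sets_completionI)
  then show False using open_not_negligible[OF assms(1) \<open>S \<noteq> {}\<close>] by simp
qed

text \<open>By continuity the exceptional set in the open shell 1/2 < |v|^2 < 1 is open; being null,
  it is empty. Homogeneity carries the vanishing along every ray.\<close>

lemma homogeneous_eq_0:
  fixes K :: "pt \<Rightarrow> complex"
  assumes K: "continuous_on UNIV K" and ae: "AE v in lborel. 1/2 \<le> (norm v)\<^sup>2 \<and> (norm v)\<^sup>2 \<le> 1 \<longrightarrow> K v = 0"
    and hom: "\<And>t v. t > 0 \<Longrightarrow> K (t *\<^sub>R v) = of_real (t ^ n) * K v" and v: "v \<noteq> 0"
  shows "K v = 0"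
proof -
  define S where "S = {v. 1/2 < (norm v)\<^sup>2} \<inter> {v. (norm v)\<^sup>2 < 1} \<inter> {v. K v \<noteq> 0}"
  have "open S"
    unfolding S_def by (intro open_Int open_Collect_less open_Collect_neq continuous_intros K)
  moreover have "AE v in lborel. v \<notin> S"
    using ae by eventually_elim (auto simp: S_def)
  ultimately have S: "S = {}" by (rule open_AE_empty)
  \<comment> \<open>Rescales v to squared norm 3/4, the middle of the shell.\<close>
  define t where "t = sqrt (3/4) / norm v"
  have t: "t > 0" using v by (simp add: t_def)
  have "(norm (t *\<^sub>R v))\<^sup>2 = 3/4" using v t by (simp add: power_mult_distrib) (simp add: t_def power_divide)
  moreover have "t *\<^sub>R v \<notin> S" using S by blast
  ultimately have "K (t *\<^sub>R v) = 0" unfolding S_def by (auto simp del: norm_scaleR)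
  then show ?thesis using hom[OF t, of v] t by simp
qed

lemma not_in_shell: "v \<notin> shell \<Longrightarrow> (norm v)\<^sup>2 \<ge> 4 \<or> (norm v)\<^sup>2 \<le> 1/4"
proof -
  assume "v \<notin> shell"
  then have "norm v \<ge> 2 \<or> norm v \<le> 1/2" by (auto simp: shell_def)
  then have "(norm v)\<^sup>2 \<ge> 2\<^sup>2 \<or> (norm v)\<^sup>2 \<le> (1/2)\<^sup>2"
    using power_mono[of 2 "norm v" 2] power_mono[of "norm v" "1/2" 2] by auto
  then show ?thesis by (simp add: power2_eq_square)
qed

text \<open>A nonnegative integrand with integral 0 vanishes almost everywhere, and in the window
  1/2 \<le> |v|^2 \<le> 1 both the cutoff and, off the null set f = 0, the weight are
  positive.\<close>

lemma weighted_square_eq_0: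
  fixes f :: "pt \<Rightarrow> complex" and k :: "pt \<Rightarrow> real" and \<theta> :: "real \<Rightarrow> real"
  assumes f: "continuous_on UNIV f" and k: "continuous_on UNIV k" and k0: "\<And>v. k v \<ge> 0"
    and \<theta>: "continuous_on UNIV \<theta>" "\<And>t. t \<ge> 4 \<or> t \<le> 1/4 \<Longrightarrow> \<theta> t = 0" "\<And>t. \<theta> t \<ge> 0"
      "\<And>t. 1/2 \<le> t \<Longrightarrow> t \<le> 1 \<Longrightarrow> \<theta> t > 0"
    and fin: "(\<integral>\<^sup>+x\<in>shell. wt (2 * s) (f x) \<partial>lborel) < \<infinity>"
    and int: "(\<integral>v. of_real (norm (f v) powr (- 2 * s)) * (of_real (k v) * of_real (\<theta> ((norm v)\<^sup>2))) \<partial>lborel) = (0::complex)"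
  shows "AE v in lborel. 1/2 \<le> (norm v)\<^sup>2 \<and> (norm v)\<^sup>2 \<le> 1 \<longrightarrow> k v = 0"
proof -
  define T where "T v = norm (f v) powr (- 2 * s) * (k v * \<theta> ((norm v)\<^sup>2))" for v
  have T: "of_real (norm (f v) powr (- 2 * s)) * (of_real (k v) * of_real (\<theta> ((norm v)\<^sup>2))) = complex_of_real (T v)" for v
    by (simp add: T_def)
  have "integrable lborel (\<lambda>v. of_real (norm (f v) powr (- 2 * s)) * (complex_of_real (k v) * of_real (\<theta> ((norm v)\<^sup>2))))"
  proof (rule weight_integrable[OF f _ _ fin])
    show "continuous_on UNIV (\<lambda>v. complex_of_real (k v) * of_real (\<theta> ((norm v)\<^sup>2)))"
      by (intro continuous_intros k continuous_on_compose2[OF \<theta>(1), of _ "\<lambda>v. (norm v)\<^sup>2"]) auto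
    show "complex_of_real (k v) * of_real (\<theta> ((norm v)\<^sup>2)) = 0" if "v \<notin> shell" for v
      using \<theta>(2)[OF not_in_shell[OF that]] by simp
  qed
  then have iT: "integrable lborel T" unfolding T complex_of_real_integrable_eq .
  have "(\<integral>v. T v \<partial>lborel) = 0" using int unfolding T integral_complex_of_real by simp
  moreover have T0: "T v \<ge> 0" for v using k0 \<theta>(3) by (simp add: T_def)
  ultimately have "AE v in lborel. T v = 0"
    using integral_nonneg_eq_0_iff_AE[OF iT] by simp
  then show ?thesis using AE_weight_nonzero[OF f fin]
  proof eventually_elim
    case (elim v)
    show ?case
    proof
      assume N: "1/2 \<le> (norm v)\<^sup>2 \<and> (norm v)\<^sup>2 \<le> 1"
      then have "v \<in> shell" using not_in_shell[of v] by auto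
      then have "f v \<noteq> 0" using elim by blast
      then show "k v = 0" using elim \<theta>(4)[of "(norm v)\<^sup>2"] N by (auto simp: T_def)
    qed
  qed
qed

lemma weighted_integrable_radial:
  fixes f X :: "pt \<Rightarrow> complex" and \<theta> :: "real \<Rightarrow> real"
  assumes f: "continuous_on UNIV f" and fin: "(\<integral>\<^sup>+x\<in>shell. wt (2 * s) (f x) \<partial>lborel) < \<infinity>"
    and X: "continuous_on UNIV X"
    and \<theta>: "continuous_on UNIV \<theta>" "\<And>t. t \<ge> 4 \<or> t \<le> 1/4 \<Longrightarrow> \<theta> t = 0"
  shows "integrable lborel (\<lambda>v. of_real (norm (f v) powr (- 2 * s)) * (X v * of_real (\<theta> ((norm v)\<^sup>2))))"
proof (rule weight_integrable[OF f _ _ fin])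
  show "continuous_on UNIV (\<lambda>v. X v * of_real (\<theta> ((norm v)\<^sup>2)))"
    by (intro continuous_intros X continuous_on_compose2[OF \<theta>(1), of _ "\<lambda>v. (norm v)\<^sup>2"]) auto
  show "X v * of_real (\<theta> ((norm v)\<^sup>2)) = 0" if "v \<notin> shell" for v
    using \<theta>(2)[OF not_in_shell[OF that]] by simp
qed

lemma integral_eq_0_cancel:
  fixes A B C :: "'a \<Rightarrow> complex"
  assumes "integrable M A" "integrable M B" "integrable M C"
    and "(\<integral>v. A v + (k * B v - C v) \<partial>M) = 0"
    and "(\<integral>v. C v \<partial>M) = k' * (\<integral>v. B v \<partial>M)" "k' = k"
  shows "(\<integral>v. A v \<partial>M) = 0"
  using assms by simp

lemma lagrange_identity:
  fixes a b c x y z :: complex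
  shows "((norm x)\<^sup>2 + (norm y)\<^sup>2 + (norm z)\<^sup>2) * ((norm a)\<^sup>2 + (norm b)\<^sup>2 + (norm c)\<^sup>2)
      - (norm (a * cnj x + b * cnj y + c * cnj z))\<^sup>2
    = (norm (a * y - b * x))\<^sup>2 + (norm (a * z - c * x))\<^sup>2 + (norm (b * z - c * y))\<^sup>2"
proof -
  have "complex_of_real (((norm x)\<^sup>2 + (norm y)\<^sup>2 + (norm z)\<^sup>2) * ((norm a)\<^sup>2 + (norm b)\<^sup>2 + (norm c)\<^sup>2)
      - (norm (a * cnj x + b * cnj y + c * cnj z))\<^sup>2)
    = complex_of_real ((norm (a * y - b * x))\<^sup>2 + (norm (a * z - c * x))\<^sup>2 + (norm (b * z - c * y))\<^sup>2)"
    unfolding of_real_add of_real_diff of_real_mult complex_norm_square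
    by (simp add: algebra_simps)
  then show ?thesis using of_real_eq_iff by blast
qed

lemma norm_pt_squared: "(norm v)\<^sup>2 = (norm (px v))\<^sup>2 + (norm (py v))\<^sup>2 + (norm (pz v))\<^sup>2"
  by (cases v) (simp add: norm_Pair)

text \<open>A vanishing theorem for syzygies of low degree: \<open>deg\<close> says that (r + 2) / m
  lies below the threshold 2 / 3.\<close>

proposition syzygy_eq_0:
  fixes a b c f :: "pt \<Rightarrow> complex"
  assumes f: "hol3 f" and homf: "\<And>\<mu> x. f (scl \<mu> x) = \<mu> ^ m * f x"
    and poly: "polyfun a" "polyfun b" "polyfun c"
    and hom: "\<And>\<mu> x. a (scl \<mu> x) = \<mu> ^ r * a x" "\<And>\<mu> x. b (scl \<mu> x) = \<mu> ^ r * b x"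
      "\<And>\<mu> x. c (scl \<mu> x) = \<mu> ^ r * c x"
    and r: "r \<ge> 1"
    and syz: "\<And>v. a v * dX f v + b v * dY f v + c v * dZ f v = 0"
    and deg: "3 * (r + 2) < 2 * m"
    and sing: "\<And>p. sing_point f p \<Longrightarrow>
           sing_type f p nf_A1 \<or> sing_type f p nf_A5 \<or> sing_type f p nf_D4"
    and v0: "v0 \<noteq> 0"
  shows "a v0 = 0 \<and> b v0 = 0 \<and> c v0 = 0"
proof -
  \<comment> \<open>This makes the weight homogeneous of degree -2 (r + 2). The density cnj(h) dN
    then has degree (r - 1) + (r + 1) - 2 (r + 2) = -4, the one degree for which the volume element
    \<rho>^5 d\<rho> turns \<xi>'(\<rho>^2) into \<xi>'(t) dt up to a constant.\<close>
  define s where "s = real (r + 2) / real m"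
  have m: "m \<ge> 1" using deg by linarith
  have s: "0 \<le> s" "s < 2 / 3"
  proof -
    show "0 \<le> s" by (simp add: s_def)
    have "3 * real (r + 2) < 2 * real m" using deg by (metis of_nat_less_iff of_nat_mult of_nat_numeral)
    then show "s < 2 / 3" using m by (simp add: s_def field_simps)
  qed
  have sm: "s * real m = real (r + 2)" using m by (simp add: s_def)
  define W where "W v = complex_of_real (norm (f v) powr (- 2 * s))" for v
  note cf = hol3D(3)[OF f]
  have fin: "(\<integral>\<^sup>+x\<in>shell. wt (2 * s) (f x) \<partial>lborel) < \<infinity>"
    by (rule shell_integral_finite[OF cf locint_away_from_origin[OF f homf s sing]])
  have double: "2 *\<^sub>R v = scl 2 v" for v using scl_of_real[of 2 v] by simp
  have Wdouble: "W (2 *\<^sub>R v) = W v / 4 ^ (r + 2)" for v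
  proof -
    have "norm (f (2 *\<^sub>R v)) powr (- 2 * s) = (2 ^ m * norm (f v)) powr (- 2 * s)"
      by (simp add: double homf norm_mult norm_power)
    also have "\<dots> = (2 ^ m) powr (- 2 * s) * norm (f v) powr (- 2 * s)" by (simp add: powr_mult)
    also have "((2::real) ^ m) powr (- 2 * s) = 2 powr (- 2 * (s * real m))"
      by (simp add: powr_realpow[symmetric] powr_powr mult_ac)
    also have "\<dots> = 1 / 4 ^ (r + 2)"
    proof -
      have "(2::real) powr (2 * real (r + 2)) = 4 powr (real (r + 2))"
        using powr_powr[of 2 2 "real (r + 2)"] by simp
      then show ?thesis unfolding sm mult_minus_left powr_minus_divide by (simp only: powr_realpow zero_less_numeral)
    qed
    finally show ?thesis by (simp add: W_def)
  qed
  obtain \<Psi> \<psi> :: "real \<Rightarrow> real" where \<Psi>: "\<And>t. (\<Psi> has_real_derivative \<psi> t) (at t)" "continuous_on UNIV \<psi>"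
    "\<And>t. t \<le> 1 \<Longrightarrow> \<Psi> t = 0 \<and> \<psi> t = 0" "\<And>t. t \<ge> 2 \<Longrightarrow> \<Psi> t = 1 \<and> \<psi> t = 0" "\<And>t. 0 \<le> \<Psi> t \<and> \<Psi> t \<le> 1"
    by (rule smooth_step_exists) (rule that, blast+)
  \<comment> \<open>The dilation \<open>v \<mapsto> 2 v\<close> exchanges the two terms of \<open>\<xi>'\<close>, so \<open>\<xi>'\<close> integrates to \<open>0\<close> against
    homogeneous densities of degree \<open>-4\<close>.\<close>
  define \<xi> where "\<xi> t = \<Psi> (4 * t) - \<Psi> t" for t
  define \<xi>' where "\<xi>' t = 4 * \<psi> (4 * t) - \<psi> t" for t
  have d\<xi>: "(\<xi> has_real_derivative \<xi>' t) (at t)" for t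
  proof -
    have "((\<lambda>t. \<Psi> (4 * t)) has_real_derivative \<psi> (4 * t) * 4) (at t)"
      by (rule DERIV_chain2[OF \<Psi>(1)]) (auto intro!: derivative_eq_intros)
    from DERIV_diff[OF this \<Psi>(1)] show ?thesis by (simp add: \<xi>_def[abs_def] \<xi>'_def mult.commute)
  qed
  have c\<xi>: "continuous_on UNIV \<xi>"
    by (rule continuous_at_imp_continuous_on, rule ballI, rule DERIV_isCont, rule d\<xi>)
  have c\<psi>4: "continuous_on UNIV (\<lambda>t. \<psi> (4 * t))"
    by (rule continuous_on_compose2[OF \<Psi>(2)]) (auto intro!: continuous_intros)
  have c\<xi>': "continuous_on UNIV \<xi>'" unfolding \<xi>'_def by (intro continuous_intros c\<psi>4 \<Psi>(2))
  have z\<psi>: "\<psi> t = 0 \<and> \<psi> (4 * t) = 0" if "t \<ge> 4 \<or> t \<le> 1/4" for t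
    using that \<Psi>(3)[of t] \<Psi>(3)[of "4 * t"] \<Psi>(4)[of t] \<Psi>(4)[of "4 * t"] by fastforce
  have z\<xi>: "\<xi> t = 0 \<and> \<xi>' t = 0" if "t \<ge> 4 \<or> t \<le> 1/4" for t
    using that \<Psi>(3)[of t] \<Psi>(3)[of "4 * t"] \<Psi>(4)[of t] \<Psi>(4)[of "4 * t"] z\<psi>[OF that]
    by (auto simp: \<xi>_def \<xi>'_def)
  have p\<xi>: "\<xi> t \<ge> 0" for t
    using \<Psi>(3)[of t] \<Psi>(4)[of "4 * t"] \<Psi>(5)[of t] \<Psi>(5)[of "4 * t"] by (cases "t \<le> 1") (auto simp: \<xi>_def)
  have one\<xi>: "\<xi> t = 1" if "1/2 \<le> t" "t \<le> 1" for t
    using that \<Psi>(3)[of t] \<Psi>(4)[of "4 * t"] by (simp add: \<xi>_def)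
  define h where "h v = dX a v + dY b v + dZ c v" for v
  define dN where "dN v = a v * cnj (px v) + b v * cnj (py v) + c v * cnj (pz v)" for v
  have hol: "hol3 a" "hol3 b" "hol3 c" using poly by (auto intro: polyfun_hol3)
  have "polyfun (\<lambda>v. dX a v + dY b v + dZ c v)"
    using polyfun_partials poly by (intro polyfun.add) auto
  then have hh: "hol3 h" unfolding h_def[abs_def] by (rule polyfun_hol3)
  note cont = hol3D(3)[OF hol(1)] hol3D(3)[OF hol(2)] hol3D(3)[OF hol(3)] hol3D(3)[OF hh]
  have cdN: "continuous_on UNIV dN" unfolding dN_def by (intro continuous_intros cont)
  have homh: "h (scl \<mu> v) = \<mu> ^ (r - 1) * h v" if "\<mu> \<noteq> 0" for \<mu> v
    unfolding h_def using partials_scl[OF hol(1) hom(1) that r] partials_scl[OF hol(2) hom(2) that r]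
      partials_scl[OF hol(3) hom(3) that r] by (simp add: algebra_simps)
  have homdN: "dN (scl (of_real t) v) = of_real (t ^ (r + 1)) * dN v" for t v
  proof -
    have "px (scl \<mu> v) = \<mu> * px v" "py (scl \<mu> v) = \<mu> * py v" "pz (scl \<mu> v) = \<mu> * pz v" for \<mu>
      by (simp_all add: scl_def)
    then show ?thesis by (simp add: dN_def hom algebra_simps)
  qed
  have h0: "h v = 0" if v: "v \<noteq> 0" for v
  proof -
    \<comment> \<open>The choice g = h, l = 1: the divergence term becomes |h|^2, and all that
      remains is the term with the derivative of the cutoff.\<close>
    have "(\<integral>v. W v * (cnj (h v) * ((h v * 1 + (a v * 0 + b v * 0 + c v * 0)) * of_real (\<xi> ((norm v)\<^sup>2)) +
        1 * dN v * of_real (\<xi>' ((norm v)\<^sup>2)))) \<partial>lborel) = 0"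
      using integration_by_parts[OF hol f hh hol3_const(1)[of 1] syz d\<xi> c\<xi>' z\<xi> s(1) fin]
      unfolding hol3_const h_def dN_def W_def .
    also have "(\<lambda>v. W v * (cnj (h v) * ((h v * 1 + (a v * 0 + b v * 0 + c v * 0)) * of_real (\<xi> ((norm v)\<^sup>2)) +
        1 * dN v * of_real (\<xi>' ((norm v)\<^sup>2))))) = (\<lambda>v. W v * (of_real ((norm (h v))\<^sup>2) * of_real (\<xi> ((norm v)\<^sup>2))) +
        (4 * (W v * ((cnj (h v) * dN v) * of_real (\<psi> (4 * (norm v)\<^sup>2)))) - W v * ((cnj (h v) * dN v) * of_real (\<psi> ((norm v)\<^sup>2)))))"
      unfolding complex_norm_square \<xi>'_def by (simp add: fun_eq_iff algebra_simps)
    finally have int: "(\<integral>v. W v * (of_real ((norm (h v))\<^sup>2) * of_real (\<xi> ((norm v)\<^sup>2))) +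
        (4 * (W v * ((cnj (h v) * dN v) * of_real (\<psi> (4 * (norm v)\<^sup>2)))) - W v * ((cnj (h v) * dN v) * of_real (\<psi> ((norm v)\<^sup>2)))) \<partial>lborel) = 0" .
    have cX: "continuous_on UNIV (\<lambda>v. cnj (h v) * dN v)" by (intro continuous_intros cont cdN)
    have i1: "integrable lborel (\<lambda>v. W v * ((cnj (h v) * dN v) * of_real (\<psi> (4 * (norm v)\<^sup>2))))"
      unfolding W_def by (rule weighted_integrable_radial[OF cf fin cX c\<psi>4]) (use z\<psi> in blast)
    have i2: "integrable lborel (\<lambda>v. W v * ((cnj (h v) * dN v) * of_real (\<psi> ((norm v)\<^sup>2))))"
      unfolding W_def by (rule weighted_integrable_radial[OF cf fin cX \<Psi>(2)]) (use z\<psi> in blast)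
    have i3: "integrable lborel (\<lambda>v. W v * (of_real ((norm (h v))\<^sup>2) * of_real (\<xi> ((norm v)\<^sup>2))))"
      unfolding W_def by (rule weighted_integrable_radial[OF cf fin _ c\<xi>]) (use z\<xi> cont in \<open>auto intro!: continuous_intros\<close>)
    \<comment> \<open>Volume factor 64 times 2^(-4) from the degree -4 equals 4, the coefficient of
      \<psi>(4 t) in \<xi>'; so the two cutoff terms cancel.\<close>
    have "(\<integral>v. W v * ((cnj (h v) * dN v) * of_real (\<psi> ((norm v)\<^sup>2))) \<partial>lborel) =
        64 * (1/16) * (\<integral>v. W v * ((cnj (h v) * dN v) * of_real (\<psi> (4 * (norm v)\<^sup>2))) \<partial>lborel)"
      unfolding W_def
    proof (rule weighted_scaling[OF cf cX \<Psi>(2)], fold W_def)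
      fix v
      have "(2::complex) ^ (r - 1) * 2 ^ (r + 1) = 4 ^ r"
      proof -
        obtain k where k: "r = Suc k" using r by (cases r) auto
        have "(2::complex) ^ k * 2 ^ k = 4 ^ k" by (simp flip: power_mult_distrib)
        then show ?thesis by (simp add: k)
      qed
      then have e: "cnj (h (2 *\<^sub>R v)) * dN (2 *\<^sub>R v) = 4 ^ r * (cnj (h v) * dN v)"
        using homdN[of 2 v] by (simp add: double homh)
      show "W (2 *\<^sub>R v) * (cnj (h (2 *\<^sub>R v)) * dN (2 *\<^sub>R v)) = 1/16 * (W v * (cnj (h v) * dN v))"
        unfolding e Wdouble by (simp add: power_add)
    qed
    then have "(\<integral>v. W v * (of_real ((norm (h v))\<^sup>2) * of_real (\<xi> ((norm v)\<^sup>2))) \<partial>lborel) = 0"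
      by (rule integral_eq_0_cancel[OF i3 i1 i2 int]) simp
    then have "AE v in lborel. 1/2 \<le> (norm v)\<^sup>2 \<and> (norm v)\<^sup>2 \<le> 1 \<longrightarrow> (norm (h v))\<^sup>2 = 0"
      unfolding W_def
      by (intro weighted_square_eq_0[where k = "\<lambda>v. (norm (h v))\<^sup>2" and \<theta> = \<xi>, OF cf _ _ c\<xi> _ p\<xi> _ fin])
         (use z\<xi> one\<xi> cont in \<open>auto intro!: continuous_intros\<close>)
    then have "AE v in lborel. 1/2 \<le> (norm v)\<^sup>2 \<and> (norm v)\<^sup>2 \<le> 1 \<longrightarrow> h v = 0" by simp
    then show ?thesis
      by (rule homogeneous_eq_0[OF cont(4) _ _ v, where n = "r - 1"])
         (use homh in \<open>simp add: scl_of_real[symmetric]\<close>)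
  qed
  \<comment> \<open>Here the density \<open>|dN|\<^sup>2 |f|\<^bsup>-2s\<^esup>\<close> has degree \<open>-2\<close>, and the division by \<open>t\<close> corrects this.\<close>
  define \<phi> where "\<phi> t = \<xi> t / t" for t
  define \<phi>' where "\<phi>' t = \<xi>' t / t - \<xi> t / t / t" for t
  have d\<phi>: "(\<phi> has_real_derivative \<phi>' t) (at t)" for t
    unfolding \<phi>_def[abs_def] \<phi>'_def by (rule has_derivative_divide_id[OF d\<xi>]) (use z\<xi> in blast)
  have c\<phi>: "continuous_on UNIV \<phi>"
    unfolding \<phi>_def[abs_def] by (rule continuous_on_divide_id[OF c\<xi>]) (use z\<xi> in blast)
  have c\<phi>2: "continuous_on UNIV (\<lambda>t. \<phi> t / t)"
    by (rule continuous_on_divide_id[OF c\<phi>]) (use z\<xi> in \<open>simp add: \<phi>_def\<close>)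
  have c\<phi>': "continuous_on UNIV \<phi>'"
    unfolding \<phi>'_def
  proof (rule continuous_on_diff[OF _ c\<phi>2[unfolded \<phi>_def]])
    show "continuous_on UNIV (\<lambda>t. \<xi>' t / t)"
      by (rule continuous_on_divide_id[OF c\<xi>']) (use z\<xi> in blast)
  qed
  have z\<phi>: "\<phi> t = 0 \<and> \<phi>' t = 0" if "t \<ge> 4 \<or> t \<le> 1/4" for t
    using z\<xi>[OF that] by (simp add: \<phi>_def \<phi>'_def)
  \<comment> \<open>The defect in the Cauchy-Schwarz inequality between \<delta>(v) and v;
    Lagrange's identity writes it as the sum of the squared 2 by 2 minors.\<close>
  define K where "K v = (norm v)\<^sup>2 * ((norm (a v))\<^sup>2 + (norm (b v))\<^sup>2 + (norm (c v))\<^sup>2) - (norm (dN v))\<^sup>2" for v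
  have Ksq: "K v = (norm (a v * py v - b v * px v))\<^sup>2 + (norm (a v * pz v - c v * px v))\<^sup>2 +
      (norm (b v * pz v - c v * py v))\<^sup>2" for v
    unfolding K_def norm_pt_squared dN_def by (rule lagrange_identity)
  have cK: "continuous_on UNIV K" unfolding K_def by (intro continuous_intros cont cdN)
  have K0: "K v = 0" if v: "v \<noteq> 0" for v
  proof -
    \<comment> \<open>The integrand for g = k and l = x. Since \<delta> maps the three coordinates
      to a, b, c, the pairs (a, x), (b, y), (c, z) each produce a square.\<close>
    define Y where "Y k x v = cnj (k v) * (k v * of_real (\<phi> ((norm v)\<^sup>2)) + x v * dN v * of_real (\<phi>' ((norm v)\<^sup>2)))"
      for k x :: "pt \<Rightarrow> complex" and v
    \<comment> \<open>\<open>h0\<close> leaves out the origin, where the coordinates vanish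
      instead.\<close>
    have hp: "h v * px v = 0" "h v * py v = 0" "h v * pz v = 0" for v
      using h0[of v] by (cases "v = 0"; simp)+
    have "(\<integral>v. W v * Y a px v \<partial>lborel) = 0" 
      using integration_by_parts[OF hol f hol(1) hol3_coord(1) syz d\<phi> c\<phi>' z\<phi> s(1) fin]
      unfolding hol3_coord h_def[symmetric] dN_def[symmetric] W_def Y_def hp by simp
    moreover have "(\<integral>v. W v * Y b py v \<partial>lborel) = 0" 
      using integration_by_parts[OF hol f hol(2) hol3_coord(5) syz d\<phi> c\<phi>' z\<phi> s(1) fin]
      unfolding hol3_coord h_def[symmetric] dN_def[symmetric] W_def Y_def hp by simp
    moreover have "(\<integral>v. W v * Y c pz v \<partial>lborel) = 0" 
      using integration_by_parts[OF hol f hol(3) hol3_coord(9) syz d\<phi> c\<phi>' z\<phi> s(1) fin]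
      unfolding hol3_coord h_def[symmetric] dN_def[symmetric] W_def Y_def hp by simp
    moreover have iY: "integrable lborel (\<lambda>v. W v * Y k x v)" if "continuous_on UNIV k" "continuous_on UNIV x" for k x
      unfolding W_def
    proof (rule weight_integrable[OF cf _ _ fin])
      show "continuous_on UNIV (Y k x)" unfolding Y_def
        by (intro continuous_intros that cdN continuous_on_compose2[OF c\<phi>, of _ "\<lambda>v. (norm v)\<^sup>2"]
          continuous_on_compose2[OF c\<phi>', of _ "\<lambda>v. (norm v)\<^sup>2"]) auto
      show "Y k x v = 0" if "v \<notin> shell" for v
        using z\<phi>[OF not_in_shell[OF that]] by (simp add: Y_def)
    qed
    ultimately have "(\<integral>v. W v * Y a px v + W v * Y b py v + W v * Y c pz v \<partial>lborel) = 0"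
      using iY[OF cont(1), of px] iY[OF cont(2), of py] iY[OF cont(3), of pz]
        hol3D(3)[OF hol3_coord(1)] hol3D(3)[OF hol3_coord(5)] hol3D(3)[OF hol3_coord(9)] by simp
    \<comment> \<open>With t = |v|^2, the quotient \<phi> = \<xi> / t satisfies \<phi>' = \<xi>' / t
      - \<phi> / t. So |\<delta>|^2 \<phi> + |dN|^2 \<phi>' equals K \<phi> / t plus |dN|^2 \<xi>' /
      t, and the latter is to cancel under dilation.\<close>
    also have "(\<lambda>v. W v * Y a px v + W v * Y b py v + W v * Y c pz v) =
      (\<lambda>v. W v * (of_real (K v) * of_real (\<phi> ((norm v)\<^sup>2) / (norm v)\<^sup>2)) +
        (16 * (W v * ((dN v * cnj (dN v)) * of_real (\<psi> (4 * (norm v)\<^sup>2) / (4 * (norm v)\<^sup>2)))) -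
          W v * ((dN v * cnj (dN v)) * of_real (\<psi> ((norm v)\<^sup>2) / (norm v)\<^sup>2))))"
    proof
      fix v :: pt
      define n where "n = (norm v)\<^sup>2"
      have gen: "w * y1 + w * y2 + w * y3 = w * p + (16 * (w * q) - w * t)"
        if "y1 + y2 + y3 = p + (16 * q - t)" for w y1 y2 y3 p q t :: complex
        using that by algebra
      have 1: "Y a px v + Y b py v + Y c pz v =
          (a v * cnj (a v) + b v * cnj (b v) + c v * cnj (c v)) * of_real (\<phi> n) + dN v * cnj (dN v) * of_real (\<phi>' n)"
        unfolding Y_def n_def[symmetric] by (simp add: dN_def algebra_simps)
      have K: "of_real (K v) = of_real n * (a v * cnj (a v) + b v * cnj (b v) + c v * cnj (c v)) - dN v * cnj (dN v)"
        unfolding K_def n_def[symmetric] of_real_diff of_real_mult of_real_add complex_norm_square ..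
      have "Y a px v + Y b py v + Y c pz v = of_real (K v) * of_real (\<phi> n / n) +
        (16 * ((dN v * cnj (dN v)) * of_real (\<psi> (4 * n) / (4 * n))) - (dN v * cnj (dN v)) * of_real (\<psi> n / n))"
      proof (cases "n = 0")
        case True
        then show ?thesis unfolding 1 using z\<phi>[of 0] by simp
      next
        case False
        define A B F where "A = \<psi> (4 * n) / (4 * n)" and "B = \<psi> n / n" and "F = \<phi> n / n"
        \<comment> \<open>The coefficient 16 is 4 from the chain rule in \<xi>' times 4 from
          dividing by 4 n instead of n.\<close>
        have e1: "\<phi>' n = 16 * A - B - F"
          unfolding \<phi>'_def \<xi>'_def \<phi>_def A_def B_def F_def by (simp add: diff_divide_distrib)
        have e2: "\<phi> n = n * F" using False by (simp add: F_def)
        show ?thesis unfolding 1 K A_def[symmetric] B_def[symmetric] F_def[symmetric]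
          unfolding e1 e2 by (simp add: algebra_simps)
      qed
      then show "W v * Y a px v + W v * Y b py v + W v * Y c pz v =
        W v * (of_real (K v) * of_real (\<phi> ((norm v)\<^sup>2) / (norm v)\<^sup>2)) +
        (16 * (W v * ((dN v * cnj (dN v)) * of_real (\<psi> (4 * (norm v)\<^sup>2) / (4 * (norm v)\<^sup>2)))) -
          W v * ((dN v * cnj (dN v)) * of_real (\<psi> ((norm v)\<^sup>2) / (norm v)\<^sup>2)))"
        unfolding n_def[symmetric] by (rule gen)
    qed
    finally have int: "(\<integral>v. W v * (of_real (K v) * of_real (\<phi> ((norm v)\<^sup>2) / (norm v)\<^sup>2)) +
        (16 * (W v * ((dN v * cnj (dN v)) * of_real (\<psi> (4 * (norm v)\<^sup>2) / (4 * (norm v)\<^sup>2)))) -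
          W v * ((dN v * cnj (dN v)) * of_real (\<psi> ((norm v)\<^sup>2) / (norm v)\<^sup>2))) \<partial>lborel) = 0" .
    have cX: "continuous_on UNIV (\<lambda>v. dN v * cnj (dN v))" by (intro continuous_intros cdN)
    have c\<psi>d: "continuous_on UNIV (\<lambda>t. \<psi> t / t)"
      by (rule continuous_on_divide_id[OF \<Psi>(2)]) (use z\<psi> in blast)
    have c\<psi>4d: "continuous_on UNIV (\<lambda>t. \<psi> (4 * t) / (4 * t))"
      by (rule continuous_on_compose2[OF c\<psi>d]) (auto intro!: continuous_intros)
    have i1: "integrable lborel (\<lambda>v. W v * ((dN v * cnj (dN v)) * of_real (\<psi> (4 * (norm v)\<^sup>2) / (4 * (norm v)\<^sup>2))))"
      unfolding W_def by (rule weighted_integrable_radial[OF cf fin cX c\<psi>4d]) (use z\<psi> in force)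
    have i2: "integrable lborel (\<lambda>v. W v * ((dN v * cnj (dN v)) * of_real (\<psi> ((norm v)\<^sup>2) / (norm v)\<^sup>2)))"
      unfolding W_def by (rule weighted_integrable_radial[OF cf fin cX c\<psi>d]) (use z\<psi> in force)
    have i3: "integrable lborel (\<lambda>v. W v * (of_real (K v) * of_real (\<phi> ((norm v)\<^sup>2) / (norm v)\<^sup>2)))"
      unfolding W_def by (rule weighted_integrable_radial[OF cf fin _ c\<phi>2]) (use z\<phi> cK in \<open>auto intro!: continuous_intros\<close>)
    \<comment> \<open>The density now has degree 2 (r + 1) - 2 (r + 2) = -2, so dilation gives 64 /
      4 = 16, matching the coefficient above.\<close>
    have "(\<integral>v. W v * ((dN v * cnj (dN v)) * of_real (\<psi> ((norm v)\<^sup>2) / (norm v)\<^sup>2)) \<partial>lborel) =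
        64 * (1/4) * (\<integral>v. W v * ((dN v * cnj (dN v)) * of_real (\<psi> (4 * (norm v)\<^sup>2) / (4 * (norm v)\<^sup>2))) \<partial>lborel)"
      unfolding W_def
    proof (rule weighted_scaling[OF cf cX c\<psi>d], fold W_def)
      fix v
      have "(2::complex) ^ (r + 1) * 2 ^ (r + 1) = 4 ^ (r + 1)" by (simp flip: power_mult_distrib)
      then have e: "dN (2 *\<^sub>R v) * cnj (dN (2 *\<^sub>R v)) = 4 ^ (r + 1) * (dN v * cnj (dN v))"
        using homdN[of 2 v] by (simp add: double)
      show "W (2 *\<^sub>R v) * (dN (2 *\<^sub>R v) * cnj (dN (2 *\<^sub>R v))) = 1/4 * (W v * (dN v * cnj (dN v)))"
        unfolding e Wdouble by (simp add: power_add)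
    qed
    then have "(\<integral>v. W v * (of_real (K v) * of_real (\<phi> ((norm v)\<^sup>2) / (norm v)\<^sup>2)) \<partial>lborel) = 0"
      by (rule integral_eq_0_cancel[OF i3 i1 i2 int]) simp
    then have "AE v in lborel. 1/2 \<le> (norm v)\<^sup>2 \<and> (norm v)\<^sup>2 \<le> 1 \<longrightarrow> K v = 0"
      unfolding W_def
    proof (intro weighted_square_eq_0[where k = K and \<theta> = "\<lambda>t. \<phi> t / t", OF cf cK _ c\<phi>2 _ _ _ fin])
      show "0 \<le> K v" for v unfolding Ksq by simp
      show "0 \<le> \<phi> t / t" for t using p\<xi>[of t] by (simp add: \<phi>_def)
      show "0 < \<phi> t / t" if "1/2 \<le> t" "t \<le> 1" for t using one\<xi>[OF that] that by (simp add: \<phi>_def)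
      show "\<phi> t / t = 0" if "4 \<le> t \<or> t \<le> 1/4" for t using z\<phi>[OF that] by simp
    qed auto
    then have ae: "AE v in lborel. 1/2 \<le> (norm v)\<^sup>2 \<and> (norm v)\<^sup>2 \<le> 1 \<longrightarrow> complex_of_real (K v) = 0" by simp
    have "complex_of_real (K v) = 0"
    proof (rule homogeneous_eq_0[OF _ ae _ v, where n = "2 * r + 2"])
      show "continuous_on UNIV (\<lambda>v. complex_of_real (K v))" by (intro continuous_intros cK)
      fix t :: real and v assume t: "t > 0"
      have ka: "norm (k (t *\<^sub>R v)) = t ^ r * norm (k v)" if "\<And>\<mu> x. k (scl \<mu> x) = \<mu> ^ r * k x" for k :: "pt \<Rightarrow> complex"
        unfolding scl_of_real[symmetric] that using t by (simp add: norm_mult norm_power)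
      have kN: "norm (dN (t *\<^sub>R v)) = t ^ (r + 1) * norm (dN v)"
        unfolding scl_of_real[symmetric] homdN using t by (simp add: norm_mult norm_power)
      have "K (t *\<^sub>R v) = t ^ (2 * r + 2) * K v"
      proof -
        have e1: "norm (t *\<^sub>R v) = t * norm v" using t by simp
        have e2: "t ^ (2 * r + 2) = t ^ r * t ^ r * t * t" "t ^ (r + 1) = t ^ r * t"
          by (simp_all add: mult_2 power_add power2_eq_square)
        show ?thesis
          unfolding K_def ka[OF hom(1)] ka[OF hom(2)] ka[OF hom(3)] kN e1 e2
          by (simp add: power2_eq_square algebra_simps)
      qed
      then show "complex_of_real (K (t *\<^sub>R v)) = of_real (t ^ (2 * r + 2)) * of_real (K v)" by simp
    qed
    then show ?thesis by simp
  qed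
  have zero: "a v = 0" "b v = 0" "c v = 0" if v: "v \<noteq> 0" "f v \<noteq> 0" for v
  proof -
    have p: "a v * py v = b v * px v" "a v * pz v = c v * px v" "b v * pz v = c v * py v"
      using K0[OF v(1)] unfolding Ksq by (auto simp: add_nonneg_eq_0_iff)
    have E: "px v * dX f v + py v * dY f v + pz v * dZ f v = of_nat m * f v" by (rule euler[OF f homf])
    have "a v * (of_nat m * f v) = px v * (a v * dX f v + b v * dY f v + c v * dZ f v)"
      unfolding E[symmetric] using p by algebra
    then show "a v = 0" using v m by (simp add: syz)
    have "b v * (of_nat m * f v) = py v * (a v * dX f v + b v * dY f v + c v * dZ f v)"
      unfolding E[symmetric] using p by algebra
    then show "b v = 0" using v m by (simp add: syz)
    have "c v * (of_nat m * f v) = pz v * (a v * dX f v + b v * dY f v + c v * dZ f v)"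
      unfolding E[symmetric] using p by algebra
    then show "c v = 0" using v m by (simp add: syz)
  qed
  \<comment> \<open>The curve f = 0, excluded in \<open>zero\<close>, is null in the shell;
    continuity and homogeneity then reach every point.\<close>
  have ae: "AE v in lborel. 1/2 \<le> (norm v)\<^sup>2 \<and> (norm v)\<^sup>2 \<le> 1 \<longrightarrow> a v = 0 \<and> b v = 0 \<and> c v = 0"
    using AE_weight_nonzero[OF cf fin]
  proof eventually_elim
    case (elim v)
    show ?case
    proof
      assume N: "1/2 \<le> (norm v)\<^sup>2 \<and> (norm v)\<^sup>2 \<le> 1"
      then have "v \<in> shell" using not_in_shell[of v] by auto
      moreover have "v \<noteq> 0" using N by auto
      ultimately show "a v = 0 \<and> b v = 0 \<and> c v = 0" using elim zero by blast
    qed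
  qed
  have k0: "k v0 = 0" if ck: "continuous_on UNIV k" and hk: "\<And>\<mu> x. k (scl \<mu> x) = \<mu> ^ r * k x"
      and aek: "AE v in lborel. 1/2 \<le> (norm v)\<^sup>2 \<and> (norm v)\<^sup>2 \<le> 1 \<longrightarrow> k v = 0" for k :: "pt \<Rightarrow> complex"
    by (rule homogeneous_eq_0[OF ck aek _ v0, where n = r]) (simp add: scl_of_real[symmetric] hk)
  have "a v0 = 0" by (rule k0[OF cont(1) hom(1)]) (use ae in eventually_elim, blast)
  moreover have "b v0 = 0" by (rule k0[OF cont(2) hom(2)]) (use ae in eventually_elim, blast)
  moreover have "c v0 = 0" by (rule k0[OF cont(3) hom(3)]) (use ae in eventually_elim, blast)
  ultimately show ?thesis by blast
qed


section \<open>The degree bound for free arrangements\<close>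

theorem theorem3:
  fixes k d :: nat and E L :: "nat \<Rightarrow> pt \<Rightarrow> complex" and f :: "pt \<Rightarrow> complex"
  assumes "k \<ge> 1" and "d \<ge> 1"
    and "\<And>i. i < k \<Longrightarrow> smooth_cubic (E i)"
    and "\<And>j. j < d \<Longrightarrow> is_line (L j)"
    and "\<And>i i'. i < k \<Longrightarrow> i' < k \<Longrightarrow> i \<noteq> i' \<Longrightarrow> zeros (E i) \<noteq> zeros (E i')"
    and "\<And>j j'. j < d \<Longrightarrow> j' < d \<Longrightarrow> j \<noteq> j' \<Longrightarrow> zeros (L j) \<noteq> zeros (L j')"
    and "\<And>i j. i < k \<Longrightarrow> j < d \<Longrightarrow> zeros (E i) \<noteq> zeros (L j)"
    and f_def: "f = (\<lambda>v. (\<Prod>i<k. E i v) * (\<Prod>j<d. L j v))"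
    and "\<And>p. sing_point f p \<Longrightarrow>
           sing_type f p nf_A1 \<or> sing_type f p nf_A5 \<or> sing_type f p nf_D4"
    and "free_curve (3 * k + d) f"
  shows "3 * k + d \<le> 9"
proof (rule ccontr)
  define m where "m = 3 * k + d"
  assume "\<not> 3 * k + d \<le> 9"
  then have m: "m \<ge> 10" by (simp add: m_def)
  have E: "homog 3 (E i)" if "i < k" for i using assms(3)[OF that] by (simp add: smooth_cubic_def)
  have L: "homog 1 (L j)" if "j < d" for j using assms(4)[OF that] by (simp add: is_line_def)
  have hf: "hol3 f"
    unfolding f_def using E L by (intro hol3_mult hol3_prod polyfun_hol3) (auto intro: homog_polyfun)
  have homf: "f (scl \<mu> x) = \<mu> ^ m * f x" for \<mu> x
  proof -
    have "(\<Prod>i<k. E i (scl \<mu> x)) = (\<Prod>i<k. \<mu> ^ 3 * E i x)"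
      by (intro prod.cong) (auto simp: homog_scl[OF E])
    moreover have "(\<Prod>j<d. L j (scl \<mu> x)) = (\<Prod>j<d. \<mu> * L j x)"
      by (intro prod.cong) (auto simp: homog_scl[OF L])
    ultimately show ?thesis
      by (simp add: f_def m_def prod.distrib power_add power_mult)
  qed
  \<comment> \<open>Minimality of the generators enters as "\<open>r1\<close> is not a multiple of
    \<open>r2\<close>", which rules out \<open>r1\<close> = 0.\<close>
  obtain d1 d2 r1 r2 where d: "1 \<le> d1" "d1 \<le> d2" "d1 + d2 = m - 1" and r1: "r1 \<in> Syz f" "homog_syz d1 r1"
    and ne: "\<not> (\<exists>p. poly3 p \<and> r1 = smult_syz p r2)"
    using assms(10) unfolding free_curve_def m_def by blast
  obtain a b c where abc: "r1 = (a, b, c)" by (cases r1) auto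
  have hom: "homog d1 a" "homog d1 b" "homog d1 c" using r1(2) by (auto simp: homog_syz_def abc)
  have syz: "a v * dX f v + b v * dY f v + c v * dZ f v = 0" for v
    using r1(1) unfolding Syz_def abc by blast
  \<comment> \<open>As 2 d1 \<le> m - 1, one has 3 (d1 + 2) \<le> 3 (m + 3) / 2, and this is below 2
    m precisely when m > 9.\<close>
  have "d1 + d2 + 1 = m" using d(3) m by simp
  then have deg: "3 * (d1 + 2) < 2 * m" using d(2) m by presburger
  have "a v = 0 \<and> b v = 0 \<and> c v = 0" for v
  proof (cases "v = 0")
    case True
    have "k 0 = 0" if "homog d1 k" for k
      using homog_scl[OF that, of 0 0] d(1) by (simp add: scl_def zero_prod_def power_0_left)
    then show ?thesis using hom True by blast
  next
    case False
    show ?thesis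
      by (rule syzygy_eq_0[OF hf homf homog_polyfun[OF hom(1)] homog_polyfun[OF hom(2)] homog_polyfun[OF hom(3)]
        homog_scl[OF hom(1)] homog_scl[OF hom(2)] homog_scl[OF hom(3)] d(1) syz deg assms(9) False])
  qed
  then have "r1 = smult_syz (\<lambda>_. 0) r2" by (auto simp: abc smult_syz_def fun_eq_iff)
  moreover have "poly3 (\<lambda>_. 0)" unfolding poly3_def by (intro exI[of _ "\<lambda>_. 0"]) simp
  ultimately show False using ne by blast
qed

end
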